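(* Let $x_0\in\mathbb R^n$ be a known initial state and suppose $w_k\in\mathcal W=\{w\in\mathbb R^n\mid w^\top Pw\le1\}$ for all $k=0,\dots,T-1$, where $P\in\mathbb R^{n\times n}$, $P\succ0$. With the setting and notation of the context, let $$\textup{Regret}_{\textup{PWB}}^*=\min_{\mathcal K}\ \max_{\mathbf w\in\mathcal W^T}\big(J(x_0,\mathbf u,\mathbf w)-J^*(x_0,\mathbf w)\big),$$ where the minimum is over all causal linear time-varying controllers $\mathbf u=\mathcal K\mathbf x$ ($\mathcal K$ block lower triangular). Consider the semi-definite program $$\bar\gamma^*=\min_{\bar\Phi,\bar\lambda}\ \sum_{i=0}^T\bar\lambda_i$$ subject to $\bar\lambda_i\ge0$ for $i=0,\dots,T$, $$\begin{bmatrix}\mathbb I-\mathcal Z\mathcal A&-\mathcal Z\mathcal B\end{bmatrix}\bar\Phi=\mathcal E,$$ $$\begin{bmatrix}x_0^\top O_1x_0+\bar\lambda_T & x_0^\top O_2^\top & x_0^\top\bar\Phi^{0\top}\\ O_2x_0 & O_3+\sum_{i=0}^{T-1}\bar\lambda_i\mathcal P_{i+1}&\bar\Phi^{w\top}\\ \bar\Phi^0x_0&\bar\Phi^w&C^{-1}\end{bmatrix}\succeq0,$$ over $\bar\lambda\in\mathbb R^{T+1}$ and $\bar\Phi=\begin{bmatrix}\bar\Phi_x\\\bar\Phi_u\end{bmatrix}=[\bar\Phi^0\ \ \bar\Phi^w]$ with $\bar\Phi_x,\bar\Phi_u$ block lower triangular, where $\mathcal P_i\in\mathbb R^{nT\times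 nT}$ has $n\times n$ block $P$ at block position $(i,i)$ and zeros elsewhere. The constraints are linear in $(\bar\Phi,\bar\lambda)$. Let $\omega$ be such that $\|\mathbf w\|^2\le\omega$ for all $\mathbf w\in\mathcal W^T$, and let $\gamma^*$ be the optimal value of the energy-bounded program defined in the context for this $\omega$. Then $$\frac2\pi\,\bar\gamma^*\ \le\ \textup{Regret}_{\textup{PWB}}^*\ \le\ \bar\gamma^*\ \le\ \gamma^*,$$ and for any optimal solution $\bar\Phi^*$, under the control sequence $\mathbf u=\bar\Phi_u^*(\bar\Phi_x^* )^{-1}\mathbf x$ the incurred dynamic regret $J(x_0,\mathbf u,\mathbf w)-J^*(x_0,\mathbf w)$ is at most $\bar\gamma^*$ for every $\mathbf w\in\mathcal W^T$.
   Context: System: $x_{k+1}=A_kx_k+B_ku_k+E_kw_k$ for $k=0,\dots,T-1$, with $T\ge1$, $x_k\in\mathbb R^n$, $u_k\in\mathbb R^m$, $w_k\in\mathbb R^n$, known real matrices $A_k,E_k\in\mathbb R^{n\times n}$, $B_k\in\mathbb R^{n\times m}$, and $E_k$ invertible. Stack $\mathbf x=[x_0^\top,\dots,x_T^\top]^\top$, $\mathbf u=[u_0^\top,\dots,u_T^\top]^\top$, $\mathbf w=[w_0^\top,\dots,w_{T-1}^\top]^\top$, $\boldsymbol\delta=[x_0^\top,\mathbf w^\top]^\top\in\mathbb R^{n(T+1)}$. $\|\cdot\|$ is the Euclidean norm; $\mathcal W^T$ is the $T$-fold Cartesian product. Cost: $J(x_0,\mathbf u,\mathbf w)=\mathbf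 x^\top\mathcal Q\mathbf x+\mathbf u^\top\mathcal R\mathbf u$, where $\mathcal Q=\mathrm{blkdiag}(Q_0,\dots,Q_T)$, $\mathcal R=\mathrm{blkdiag}(R_0,\dots,R_T)$ with symmetric $Q_k\succ0$, $R_k\succ0$, and $\mathbf x$ is the state sequence generated by $x_0,\mathbf u,\mathbf w$. Let $C=\mathrm{blkdiag}(\mathcal Q,\mathcal R)$. The optimal non-causal cost is $J^*(x_0,\mathbf w)=\min_{\tilde{\mathbf u}\in\mathbb R^{m(T+1)}}J(x_0,\tilde{\mathbf u},\mathbf w)$, where $\tilde{\mathbf u}$ may depend on all of $\mathbf w$. Block operators: $\mathcal A=\mathrm{blkdiag}(A_0,\dots,A_{T-1},0)$, $\mathcal B=\mathrm{blkdiag}(B_0,\dots,B_{T-1},0)$, $\mathcal E=\mathrm{blkdiag}(\mathbb I,E_0,\dots,E_{T-1})$, and $\mathcal Z\in\mathbb R^{n(T+1)\times n(T+1)}$ is the block-downshift matrix ($n\times n$ identity blocks on the first block sub-diagonal, zeros elsewhere). The dynamics read $\mathbf x=\mathcal Z\mathcal A\mathbf x+\mathcal Z\mathcal B\mathbf u+\mathcal E\boldsymbol\delta$, i.e. $\mathbf x=F\mathbf u+G\boldsymbol\delta$ with $F=(\mathbb I-\mathcal Z\mathcal A)^{-1}\mathcal Z\mathcal B$, $G=(\mathbb I-\mathcal Z\mathcal A)^{-1}\mathcal E$. One has $J^*(x_0,\mathbf w)=\boldsymbol\delta^\top O\boldsymbol\delta$ with $$O=G^\top(\mathcal Q^{-1}+F\mathcal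 R^{-1}F^\top)^{-1}G=\begin{bmatrix}O_1&O_2^\top\\O_2&O_3\end{bmatrix},\quad O_1\in\mathbb R^{n\times n},\ O_2\in\mathbb R^{nT\times n},\ O_3\in\mathbb R^{nT\times nT}.$$ Controllers: $\mathbf u=\mathcal K\mathbf x$ with $\mathcal K\in\mathbb R^{m(T+1)\times n(T+1)}$ block lower triangular (blocks of size $m\times n$, block diagonal included). The closed loop satisfies $\mathbf x=\Phi_x\boldsymbol\delta$, $\mathbf u=\Phi_u\boldsymbol\delta$ with $\Phi_x\in\mathbb R^{n(T+1)\times n(T+1)}$ and $\Phi_u\in\mathbb R^{m(T+1)\times n(T+1)}$ block lower triangular (blocks $n\times n$ and $m\times n$). Write $\Phi=\begin{bmatrix}\Phi_x\\\Phi_u\end{bmatrix}=[\Phi^0\ \ \Phi^w]$, with $\Phi^0$ the first $n$ columns and $\Phi^w$ the remaining $nT$ columns (and likewise for $\bar\Phi$). Energy-bounded program: for $\omega>0$, $\gamma^*$ is the minimum of $\gamma$ over $\gamma,\lambda\in\mathbb R$ and matrices $\Phi=\begin{bmatrix}\Phi_x\\\Phi_u\end{bmatrix}=[\Phi^0\ \ \Phi^w]$ with $\Phi_x\in\mathbb R^{n(T+1)\times n(T+1)}$ and $\Phi_u\in\mathbb R^{m(T+1)\times n(T+1)}$ block lower triangular (blocks $n\times n$ and $m\times n$), $\Phi^0$ the first $n$ columns and $\Phi^w$ the remaining $nT$ columns of $\Phi$, subject to $\lambda\ge0$, $\begin{bmatrix}\mathbb I-\mathcal Z\mathcal A&-\mathcal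 Z\mathcal B\end{bmatrix}\Phi=\mathcal E$ and $$\begin{bmatrix} x_0^\top O_1x_0-\lambda\omega+\gamma & x_0^\top O_2^\top & x_0^\top\Phi^{0\top}\\ O_2x_0 & O_3+\lambda\mathbb I & \Phi^{w\top}\\ \Phi^0x_0 & \Phi^w & C^{-1}\end{bmatrix}\succeq 0.$$ *)

theory Defs
  imports Complex_Main "Jordan_Normal_Form.Gauss_Jordan_Elimination"
begin

definition positive_semidefinite :: "real mat \<Rightarrow> bool" where
  "positive_semidefinite M \<longleftrightarrow>
     square_mat M \<and> M\<^sup>T = M \<and>
     (\<forall>v \<in> carrier_vec (dim_row M). 0 \<le> scalar_prod v (M *\<^sub>v v))"

definition positive_definite :: "real mat \<Rightarrow> bool" where
  "positive_definite M \<longleftrightarrow>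
     square_mat M \<and> M\<^sup>T = M \<and>
     (\<forall>v \<in> carrier_vec (dim_row M). v \<noteq> 0\<^sub>v (dim_row M) \<longrightarrow> 0 < scalar_prod v (M *\<^sub>v v))"

definition vnorm :: "real vec \<Rightarrow> real" where
  "vnorm v = sqrt (scalar_prod v v)"

text \<open>Meaningful only for invertible matrices; every use below is of that kind.\<close>

definition minv :: "real mat \<Rightarrow> real mat" where
  "minv M = the (mat_inverse M)"

text \<open>The \<open>nr \<times> nc\<close> submatrix whose top left entry is the entry \<open>(r, c)\<close> of \<open>M\<close>.\<close>

definition submat :: "nat \<Rightarrow> nat \<Rightarrow> nat \<Rightarrow> nat \<Rightarrow> real mat \<Rightarrow> real mat" where
  "submat r c nr nc M = mat nr nc (\<lambda>(i, j). M $$ (r + i, c + j))"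

definition append_cols :: "real mat \<Rightarrow> real mat \<Rightarrow> real mat" where
  "append_cols L M = four_block_mat L M (0\<^sub>m 0 (dim_col L)) (0\<^sub>m 0 (dim_col M))"

definition block3_mat ::
  "real mat \<Rightarrow> real mat \<Rightarrow> real mat \<Rightarrow> real mat \<Rightarrow> real mat \<Rightarrow> real mat \<Rightarrow>
   real mat \<Rightarrow> real mat \<Rightarrow> real mat \<Rightarrow> real mat" where
  "block3_mat M11 M12 M13
              M21 M22 M23
              M31 M32 M33 =
     four_block_mat M11 (append_cols M12 M13)
                    (M21 @\<^sub>r M31) (four_block_mat M22 M23 M32 M33)"

text \<open>Block lower triangularity (diagonal blocks included) with respect to \<open>p \<times> q\<close> blocks.\<close>

definition block_lower_triangular :: "nat \<Rightarrow> nat \<Rightarrow> real mat \<Rightarrow> bool" where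
  "block_lower_triangular p q M \<longleftrightarrow>
     (\<forall>i < dim_row M. \<forall>j < dim_col M. i div p < j div q \<longrightarrow> M $$ (i, j) = 0)"

text \<open>The \<open>k\<close>-th block (from 0) of length \<open>p\<close> of a stacked vector.\<close>

definition vblock :: "nat \<Rightarrow> nat \<Rightarrow> real vec \<Rightarrow> real vec" where
  "vblock p k v = vec p (\<lambda>i. v $ (k * p + i))"

record lq_system =
  state_dim :: nat
  input_dim :: nat
  horizon :: nat
  Amat :: "nat \<Rightarrow> real mat"
  Bmat :: "nat \<Rightarrow> real mat"
  Emat :: "nat \<Rightarrow> real mat"
  Qmat :: "nat \<Rightarrow> real mat"
  Rmat :: "nat \<Rightarrow> real mat"

definition valid_system :: "lq_system \<Rightarrow> bool" where
  "valid_system S \<longleftrightarrow>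
     1 \<le> horizon S \<and>
     (\<forall>k < horizon S.
        Amat S k \<in> carrier_mat (state_dim S) (state_dim S) \<and>
        Bmat S k \<in> carrier_mat (state_dim S) (input_dim S) \<and>
        Emat S k \<in> carrier_mat (state_dim S) (state_dim S) \<and>
        invertible_mat (Emat S k)) \<and>
     (\<forall>k \<le> horizon S.
        Qmat S k \<in> carrier_mat (state_dim S) (state_dim S) \<and> positive_definite (Qmat S k) \<and>
        Rmat S k \<in> carrier_mat (input_dim S) (input_dim S) \<and> positive_definite (Rmat S k))"

abbreviation xdim :: "lq_system \<Rightarrow> nat" where
  "xdim S \<equiv> state_dim S * (horizon S + 1)"

abbreviation udim :: "lq_system \<Rightarrow> nat" where
  "udim S \<equiv> input_dim S * (horizon S + 1)"

abbreviation wdim :: "lq_system \<Rightarrow> nat" where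
  "wdim S \<equiv> state_dim S * horizon S"

primrec state :: "lq_system \<Rightarrow> real vec \<Rightarrow> real vec \<Rightarrow> real vec \<Rightarrow> nat \<Rightarrow> real vec" where
  "state S x0 u w 0 = x0"
| "state S x0 u w (Suc k) =
     Amat S k *\<^sub>v state S x0 u w k + Bmat S k *\<^sub>v vblock (input_dim S) k u
       + Emat S k *\<^sub>v vblock (state_dim S) k w"

definition stacked_state :: "lq_system \<Rightarrow> real vec \<Rightarrow> real vec \<Rightarrow> real vec \<Rightarrow> real vec" where
  "stacked_state S x0 u w =
     vec (xdim S) (\<lambda>i. state S x0 u w (i div state_dim S) $ (i mod state_dim S))"

definition Qcal :: "lq_system \<Rightarrow> real mat" where
  "Qcal S = diag_block_mat (map (Qmat S) [0..<horizon S + 1])"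

definition Rcal :: "lq_system \<Rightarrow> real mat" where
  "Rcal S = diag_block_mat (map (Rmat S) [0..<horizon S + 1])"

definition cost :: "lq_system \<Rightarrow> real vec \<Rightarrow> real vec \<Rightarrow> real vec \<Rightarrow> real" where
  "cost S x0 u w =
     scalar_prod (stacked_state S x0 u w) (Qcal S *\<^sub>v stacked_state S x0 u w)
       + scalar_prod u (Rcal S *\<^sub>v u)"

definition cost_value :: "lq_system \<Rightarrow> real vec \<Rightarrow> real vec \<Rightarrow> real \<Rightarrow> bool" where
  "cost_value S x0 w v \<longleftrightarrow> (\<exists>u \<in> carrier_vec (udim S). v = cost S x0 u w)"

text \<open>Minima and maxima are rendered by \<open>LEAST\<close> and \<open>GREATEST\<close>, which denote attained extrema;
  the predicate \<open>extrema_attained\<close> at the end of this theory says that all of them exist.\<close>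

definition optimal_cost :: "lq_system \<Rightarrow> real vec \<Rightarrow> real vec \<Rightarrow> real" where
  "optimal_cost S x0 w = (LEAST v. cost_value S x0 w v)"

definition causal_controller :: "lq_system \<Rightarrow> real mat \<Rightarrow> bool" where
  "causal_controller S K \<longleftrightarrow>
     K \<in> carrier_mat (udim S) (xdim S) \<and>
     block_lower_triangular (input_dim S) (state_dim S) K"

definition closed_loop :: "lq_system \<Rightarrow> real mat \<Rightarrow> real vec \<Rightarrow> real vec \<Rightarrow> real vec \<Rightarrow> bool" where
  "closed_loop S K x0 w u \<longleftrightarrow>
     u \<in> carrier_vec (udim S) \<and> u = K *\<^sub>v stacked_state S x0 u w"

definition dynamic_regret :: "lq_system \<Rightarrow> real vec \<Rightarrow> real vec \<Rightarrow> real vec \<Rightarrow> real" where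
  "dynamic_regret S x0 u w = cost S x0 u w - optimal_cost S x0 w"

definition disturbance_set :: "lq_system \<Rightarrow> real mat \<Rightarrow> real vec set" where
  "disturbance_set S P = {w \<in> carrier_vec (state_dim S). scalar_prod w (P *\<^sub>v w) \<le> 1}"

definition disturbance_sequences :: "lq_system \<Rightarrow> real mat \<Rightarrow> real vec set" where
  "disturbance_sequences S P =
     {w \<in> carrier_vec (wdim S). \<forall>k < horizon S. vblock (state_dim S) k w \<in> disturbance_set S P}"

definition regret_value :: "lq_system \<Rightarrow> real mat \<Rightarrow> real vec \<Rightarrow> real mat \<Rightarrow> real \<Rightarrow> bool" where
  "regret_value S P x0 K r \<longleftrightarrow>
     (\<exists>w \<in> disturbance_sequences S P. \<exists>u. closed_loop S K x0 w u \<and> r = dynamic_regret S x0 u w)"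

definition worst_case_regret :: "lq_system \<Rightarrow> real mat \<Rightarrow> real vec \<Rightarrow> real mat \<Rightarrow> real" where
  "worst_case_regret S P x0 K = (GREATEST r. regret_value S P x0 K r)"

definition minimax_value :: "lq_system \<Rightarrow> real mat \<Rightarrow> real vec \<Rightarrow> real \<Rightarrow> bool" where
  "minimax_value S P x0 r \<longleftrightarrow> (\<exists>K. causal_controller S K \<and> r = worst_case_regret S P x0 K)"

definition regret_PWB :: "lq_system \<Rightarrow> real mat \<Rightarrow> real vec \<Rightarrow> real" where
  "regret_PWB S P x0 = (LEAST r. minimax_value S P x0 r)"

definition Acal :: "lq_system \<Rightarrow> real mat" where
  "Acal S = diag_block_mat (map (Amat S) [0..<horizon S] @ [0\<^sub>m (state_dim S) (state_dim S)])"

definition Bcal :: "lq_system \<Rightarrow> real mat" where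
  "Bcal S = diag_block_mat (map (Bmat S) [0..<horizon S] @ [0\<^sub>m (state_dim S) (input_dim S)])"

definition Ecal :: "lq_system \<Rightarrow> real mat" where
  "Ecal S = diag_block_mat (1\<^sub>m (state_dim S) # map (Emat S) [0..<horizon S])"

definition Zcal :: "lq_system \<Rightarrow> real mat" where
  "Zcal S = mat (xdim S) (xdim S) (\<lambda>(i, j). if i = j + state_dim S then 1 else 0)"

definition Ccal :: "lq_system \<Rightarrow> real mat" where
  "Ccal S = diag_block_mat [Qcal S, Rcal S]"

definition Fop :: "lq_system \<Rightarrow> real mat" where
  "Fop S = minv (1\<^sub>m (xdim S) - Zcal S * Acal S) * (Zcal S * Bcal S)"

definition Gop :: "lq_system \<Rightarrow> real mat" where
  "Gop S = minv (1\<^sub>m (xdim S) - Zcal S * Acal S) * Ecal S"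

definition Omat :: "lq_system \<Rightarrow> real mat" where
  "Omat S = (Gop S)\<^sup>T * minv (minv (Qcal S) + Fop S * minv (Rcal S) * (Fop S)\<^sup>T) * Gop S"

definition O1 :: "lq_system \<Rightarrow> real mat" where
  "O1 S = submat 0 0 (state_dim S) (state_dim S) (Omat S)"

definition O2 :: "lq_system \<Rightarrow> real mat" where
  "O2 S = submat (state_dim S) 0 (wdim S) (state_dim S) (Omat S)"

definition O3 :: "lq_system \<Rightarrow> real mat" where
  "O3 S = submat (state_dim S) (state_dim S) (wdim S) (wdim S) (Omat S)"

definition Phi_x :: "lq_system \<Rightarrow> real mat \<Rightarrow> real mat" where
  "Phi_x S \<Phi> = submat 0 0 (xdim S) (xdim S) \<Phi>"

definition Phi_u :: "lq_system \<Rightarrow> real mat \<Rightarrow> real mat" where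
  "Phi_u S \<Phi> = submat (xdim S) 0 (udim S) (xdim S) \<Phi>"

definition Phi_0 :: "lq_system \<Rightarrow> real mat \<Rightarrow> real mat" where
  "Phi_0 S \<Phi> = submat 0 0 (xdim S + udim S) (state_dim S) \<Phi>"

definition Phi_w :: "lq_system \<Rightarrow> real mat \<Rightarrow> real mat" where
  "Phi_w S \<Phi> = submat 0 (state_dim S) (xdim S + udim S) (wdim S) \<Phi>"

definition causal_responses :: "lq_system \<Rightarrow> real mat set" where
  "causal_responses S =
     {\<Phi> \<in> carrier_mat (xdim S + udim S) (xdim S).
        block_lower_triangular (state_dim S) (state_dim S) (Phi_x S \<Phi>) \<and>
        block_lower_triangular (input_dim S) (state_dim S) (Phi_u S \<Phi>)}"

definition achievability_map :: "lq_system \<Rightarrow> real mat \<Rightarrow> real mat" where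
  "achievability_map S \<Phi> =
     append_cols (1\<^sub>m (xdim S) - Zcal S * Acal S) (- (Zcal S * Bcal S)) * \<Phi>"

text \<open>The matrix inequality common to both programs: \<open>c\<close> is the scalar added to
  \<open>x\<^sub>0\<^sup>T O\<^sub>1 x\<^sub>0\<close> and \<open>D\<close> the matrix added to \<open>O\<^sub>3\<close>.
  The vector \<open>x\<^sub>0\<close> enters as a one-column matrix.\<close>

definition lmi_matrix :: "lq_system \<Rightarrow> real vec \<Rightarrow> real mat \<Rightarrow> real \<Rightarrow> real mat \<Rightarrow> real mat" where
  "lmi_matrix S x0 \<Phi> c D =
     (let X = mat_of_cols (state_dim S) [x0] in
      block3_mat
        (X\<^sup>T * O1 S * X + c \<cdot>\<^sub>m 1\<^sub>m 1)  (X\<^sup>T * (O2 S)\<^sup>T)  (X\<^sup>T * (Phi_0 S \<Phi>)\<^sup>T)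
        (O2 S * X)                 (O3 S + D)       ((Phi_w S \<Phi>)\<^sup>T)
        (Phi_0 S \<Phi> * X)            (Phi_w S \<Phi>)      (minv (Ccal S)))"

text \<open>\<open>Pcal S P i\<close> carries \<open>P\<close> at the diagonal block position \<open>i\<close>, counted from 1.\<close>

definition Pcal :: "lq_system \<Rightarrow> real mat \<Rightarrow> nat \<Rightarrow> real mat" where
  "Pcal S P i =
     diag_block_mat
       (map (\<lambda>j. if j = i then P else 0\<^sub>m (state_dim S) (state_dim S)) [1..<horizon S + 1])"

definition weighted_Pcal :: "lq_system \<Rightarrow> real mat \<Rightarrow> real vec \<Rightarrow> real mat" where
  "weighted_Pcal S P l =
     mat (wdim S) (wdim S) (\<lambda>(a, b). \<Sum>i<horizon S. l $ i * Pcal S P (i + 1) $$ (a, b))"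

definition pwb_lmi :: "lq_system \<Rightarrow> real mat \<Rightarrow> real vec \<Rightarrow> real mat \<Rightarrow> real vec \<Rightarrow> real mat" where
  "pwb_lmi S P x0 \<Phi> l = lmi_matrix S x0 \<Phi> (l $ horizon S) (weighted_Pcal S P l)"

definition pwb_feasible :: "lq_system \<Rightarrow> real mat \<Rightarrow> real vec \<Rightarrow> real mat \<Rightarrow> real vec \<Rightarrow> bool" where
  "pwb_feasible S P x0 \<Phi> l \<longleftrightarrow>
     \<Phi> \<in> causal_responses S \<and> l \<in> carrier_vec (horizon S + 1) \<and>
     (\<forall>i \<le> horizon S. 0 \<le> l $ i) \<and>
     achievability_map S \<Phi> = Ecal S \<and>
     positive_semidefinite (pwb_lmi S P x0 \<Phi> l)"

definition pwb_objective :: "lq_system \<Rightarrow> real vec \<Rightarrow> real" where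
  "pwb_objective S l = (\<Sum>i\<le>horizon S. l $ i)"

definition pwb_value :: "lq_system \<Rightarrow> real mat \<Rightarrow> real vec \<Rightarrow> real \<Rightarrow> bool" where
  "pwb_value S P x0 g \<longleftrightarrow> (\<exists>\<Phi> l. pwb_feasible S P x0 \<Phi> l \<and> g = pwb_objective S l)"

definition gamma_bar :: "lq_system \<Rightarrow> real mat \<Rightarrow> real vec \<Rightarrow> real" where
  "gamma_bar S P x0 = (LEAST g. pwb_value S P x0 g)"

definition pwb_optimal :: "lq_system \<Rightarrow> real mat \<Rightarrow> real vec \<Rightarrow> real mat \<Rightarrow> real vec \<Rightarrow> bool" where
  "pwb_optimal S P x0 \<Phi> l \<longleftrightarrow>
     pwb_feasible S P x0 \<Phi> l \<and>
     (\<forall>\<Phi>' l'. pwb_feasible S P x0 \<Phi>' l' \<longrightarrow> pwb_objective S l \<le> pwb_objective S l')"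

definition energy_feasible ::
  "lq_system \<Rightarrow> real vec \<Rightarrow> real \<Rightarrow> real \<Rightarrow> real \<Rightarrow> real mat \<Rightarrow> bool" where
  "energy_feasible S x0 \<omega> \<gamma> l \<Phi> \<longleftrightarrow>
     \<Phi> \<in> causal_responses S \<and> 0 \<le> l \<and>
     achievability_map S \<Phi> = Ecal S \<and>
     positive_semidefinite (lmi_matrix S x0 \<Phi> (- l * \<omega> + \<gamma>) (l \<cdot>\<^sub>m 1\<^sub>m (wdim S)))"

definition energy_value :: "lq_system \<Rightarrow> real vec \<Rightarrow> real \<Rightarrow> real \<Rightarrow> bool" where
  "energy_value S x0 \<omega> \<gamma> \<longleftrightarrow> (\<exists>l \<Phi>. energy_feasible S x0 \<omega> \<gamma> l \<Phi>)"

definition gamma_star :: "lq_system \<Rightarrow> real vec \<Rightarrow> real \<Rightarrow> real" where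
  "gamma_star S x0 \<omega> = (LEAST \<gamma>. energy_value S x0 \<omega> \<gamma>)"

text \<open>Linearity of the constraints in the decision variables, in the usual (affine) sense: the
  decision space, the equality constraint and the matrix inequality respect affine combinations.\<close>

definition pwb_constraints_linear :: "lq_system \<Rightarrow> real mat \<Rightarrow> real vec \<Rightarrow> bool" where
  "pwb_constraints_linear S P x0 \<longleftrightarrow>
     (\<forall>\<Phi> \<in> causal_responses S. \<forall>\<Phi>' \<in> causal_responses S.
      \<forall>l \<in> carrier_vec (horizon S + 1). \<forall>l' \<in> carrier_vec (horizon S + 1). \<forall>t.
        t \<cdot>\<^sub>m \<Phi> + (1 - t) \<cdot>\<^sub>m \<Phi>' \<in> causal_responses S \<and>
        achievability_map S (t \<cdot>\<^sub>m \<Phi> + (1 - t) \<cdot>\<^sub>m \<Phi>') =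
          t \<cdot>\<^sub>m achievability_map S \<Phi> + (1 - t) \<cdot>\<^sub>m achievability_map S \<Phi>' \<and>
        pwb_lmi S P x0 (t \<cdot>\<^sub>m \<Phi> + (1 - t) \<cdot>\<^sub>m \<Phi>') (t \<cdot>\<^sub>v l + (1 - t) \<cdot>\<^sub>v l') =
          t \<cdot>\<^sub>m pwb_lmi S P x0 \<Phi> l + (1 - t) \<cdot>\<^sub>m pwb_lmi S P x0 \<Phi>' l')"

definition has_least :: "(real \<Rightarrow> bool) \<Rightarrow> bool" where
  "has_least p \<longleftrightarrow> (\<exists>v. p v \<and> (\<forall>y. p y \<longrightarrow> v \<le> y))"

definition has_greatest :: "(real \<Rightarrow> bool) \<Rightarrow> bool" where
  "has_greatest p \<longleftrightarrow> (\<exists>v. p v \<and> (\<forall>y. p y \<longrightarrow> y \<le> v))"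

definition extrema_attained :: "lq_system \<Rightarrow> real mat \<Rightarrow> real vec \<Rightarrow> real \<Rightarrow> bool" where
  "extrema_attained S P x0 \<omega> \<longleftrightarrow>
     (\<forall>w \<in> carrier_vec (wdim S). has_least (cost_value S x0 w)) \<and>
     (\<forall>K. causal_controller S K \<longrightarrow>
        (\<forall>w \<in> carrier_vec (wdim S). \<exists>!u. closed_loop S K x0 w u) \<and>
        has_greatest (regret_value S P x0 K)) \<and>
     has_least (minimax_value S P x0) \<and>
     has_least (pwb_value S P x0) \<and>
     has_least (energy_value S x0 \<omega>)"

end

theory Submission
  imports "HOL-Probability.Probability" "Jordan_Normal_Form.Determinant" Defs
begin

text \<open>
  A causal controller is described by its response \<open>U\<close>, that is \<open>u = U \<delta>\<close> with \<open>\<delta> = (x0, w)\<close>; every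
  block lower triangular \<open>U\<close> occurs. Completing the square, the regret is a positive definite form of
  \<open>(U - H) \<delta>\<close>, where \<open>H\<close> is the response of the non-causal optimum, and by a Schur complement the
  matrix inequalities say that at \<open>\<delta> = (t x0, w)\<close> this form is at most \<open>c t\<^sup>2 + w\<^sup>T D w\<close>. So multipliers
  bound the regret, and a multiplier \<open>\<lambda>\<close> of the energy-bounded program yields the multipliers
  \<open>\<lambda> \<omega> / T\<close> and \<open>\<gamma> - \<lambda> \<omega>\<close> of the other one, because \<open>T\<close> copies of a vector \<open>p\<close> with \<open>p\<^sup>T P p = 1\<close> are an
  admissible disturbance, whence \<open>T |p|\<^sup>2 \<le> \<omega>\<close>.

  For the lower bound, take coordinates in which \<open>P\<close> is the identity. By a theorem of the alternative,
  multipliers with sum \<open>\<pi>/2 R\<close> exist unless there are vectors \<open>x\<^sub>1, \<dots>, x\<^sub>m\<close> whose block norms satisfy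
  \<open>\<Sum>\<^sub>k |x\<^sub>k|\<^sup>2 \<le> 1\<close> and whose regret values add up to more than \<open>\<pi>/2 R\<close>. With independent standard
  Gaussians \<open>g\<^sub>k\<close>, each coordinate of \<open>G = \<Sum>\<^sub>k g\<^sub>k x\<^sub>k\<close> is rounded to its standard deviation times its
  sign. The rounded vector is admissible, and on average its regret is at least \<open>2/\<pi>\<close> times the sum,
  hence larger than \<open>R\<close> for some outcome. The minima are attained by compactness.
\<close>

text \<open>The lower bound needs a converse to weak duality, and with several quadratic constraints
  such a converse has a gap: the points \<open>(q x - \<kappa> * p i x)\<close> indexed by
  \<open>i\<close>, for single vectors \<open>x\<close>, need not form a convex set. Sums over lists
  of vectors do form a convex cone, at the price that a violation is witnessed by several vectors at
  once. Rounding condenses these into one vector and costs the square of the mean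
  \<open>sqrt (2 / pi)\<close> of the modulus of a standard Gaussian.

  Since \<open>x0\<close> is fixed, the regret is inhomogeneous in \<open>w\<close>. A scalar
  \<open>t\<close> in front of \<open>x0\<close> makes it a quadratic form, and
  \<open>t\<^sup>2 \<le> 1\<close> joins the \<open>T\<close> disturbance constraints; hence
  \<open>T + 1\<close> multipliers.

  \<open>LEAST\<close> and \<open>GREATEST\<close> carry information only when the extrema are
  attained, so attainment comes before every inequality about them. The obstacle is that a bound on
  the regret need not bound the response: its first \<open>n\<close> columns matter only through
  their product with \<open>x0\<close>. Compactness is therefore applied to a normal form with the
  same regret.\<close>

unbundle no vec_syntax and no inner_syntax
hide_type (open) Finite_Cartesian_Product.vec
hide_const (open) Determinants.det Finite_Cartesian_Product.mat

subsection \<open>A theorem of the alternative for cones\<close>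

text \<open>The induction merges the last two coordinates into one convex combination. Each vector whose other
  coordinates are positive excludes an interval of weights, which contains only one end of \<open>[0, 1]\<close>;
  if these intervals covered \<open>[0, 1]\<close>, two of them would overlap and a combination of the two vectors
  would be positive.\<close>

lemma cone_alternative:
  fixes D :: "(nat \<Rightarrow> real) set"
  assumes "\<And>d e. d \<in> D \<Longrightarrow> e \<in> D \<Longrightarrow> (\<lambda>i. d i + e i) \<in> D"
    and "\<And>c d. 0 < c \<Longrightarrow> d \<in> D \<Longrightarrow> (\<lambda>i. c * d i) \<in> D"
    and "\<not> (\<exists>d \<in> D. \<forall>i \<le> n. 0 < d i)"
  shows "\<exists>l. (\<forall>i \<le> n. 0 \<le> l i) \<and> (\<Sum>i\<le>n. l i) = 1 \<and> (\<forall>d \<in> D. (\<Sum>i\<le>n. l i * d i) \<le> 0)"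
  using assms
proof (induction n arbitrary: D)
  case 0
  then show ?case by (intro exI[of _ "\<lambda>_. 1"]) (auto simp: not_less)
next
  case (Suc n)
  note add = Suc.prems(1) and scale = Suc.prems(2) and nopos = Suc.prems(3)
  define E where "E = {d \<in> D. \<forall>i < n. 0 < d i}"
  have both: "d n \<le> 0 \<or> d (Suc n) \<le> 0" if "d \<in> E" for d
  proof (rule ccontr)
    assume "\<not> ?thesis"
    then have "\<forall>i \<le> Suc n. 0 < d i" using that
      by (auto simp: E_def le_Suc_eq less_Suc_eq_le[symmetric] less_Suc_eq)
    with nopos that show False by (auto simp: E_def)
  qed
  define U where "U = {d \<in> E. d n \<le> 0 \<and> 0 < d (Suc n)}"
  define V where "V = {d \<in> E. d (Suc n) \<le> 0 \<and> 0 < d n}"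
  \<comment> \<open>The weight at which \<open>t * d n + (1 - t) * d (Suc n)\<close> vanishes: on
    \<open>U\<close> this combination is nonpositive exactly for \<open>t\<close> at or above
    \<open>th d\<close>, on \<open>V\<close> exactly for \<open>t\<close> at or below it.\<close>
  define th where "th d = d (Suc n) / (d (Suc n) - d n)" for d :: "nat \<Rightarrow> real"
  have thU: "0 \<le> th d \<and> th d \<le> 1" if "d \<in> U" for d
    using that by (auto simp: U_def th_def divide_simps)
  have thV: "0 \<le> th d \<and> th d \<le> 1" if "d \<in> V" for d
    using that by (auto simp: V_def th_def divide_simps)
  have thUV: "th d \<le> th e" if d: "d \<in> U" and e: "e \<in> V" for d e
  proof (rule ccontr)
    assume "\<not> th d \<le> th e"
    then have lt: "th e < th d" by simp
    define a b a' b' where ab: "a = d n" "b = d (Suc n)" "a' = e n" "b' = e (Suc n)"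
    have s: "a \<le> 0" "0 < b" "b' \<le> 0" "0 < a'" using d e by (auto simp: U_def V_def ab)
    have "(-b') / (a' - b') < b / (b - a)"
      using lt unfolding th_def ab[symmetric] by (metis minus_diff_eq minus_divide_divide)
    then have key: "0 < a' * b - a * b'"
      using s by (simp add: divide_simps) (simp add: algebra_simps)
    \<comment> \<open>This factor equalizes the last two coordinates of \<open>e + c * d\<close>;
      their common value is \<open>(a' * b - a * b') / (b - a)\<close>, so one sign decides
      both.\<close>
    define c where "c = (a' - b') / (b - a)"
    have c: "0 < c" using s by (auto simp: c_def)
    have "(\<lambda>i. e i + c * d i) \<in> D" using d e c
      by (intro add scale) (auto simp: U_def V_def E_def)
    moreover have "0 < e i + c * d i" if "i < n" for i
      using that d e c by (auto simp: U_def V_def E_def intro!: add_pos_pos)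
    moreover have "0 < a' + c * a"
    proof -
      have "a' + c * a = (a' * b - a * b') / (b - a)"
        using s by (simp add: c_def field_simps)
      then show ?thesis using key s by auto
    qed
    moreover have "0 < b' + c * b"
    proof -
      have "b' + c * b = (a' * b - a * b') / (b - a)"
        using s by (simp add: c_def field_simps)
      then show ?thesis using key s by auto
    qed
    ultimately show False using both[of "\<lambda>i. e i + c * d i"]
      by (auto simp: E_def ab)
  qed
  \<comment> \<open>With \<open>U\<close> empty only the upper bounds \<open>th e\<close> remain,
    and all of them are nonnegative, so 0 will do.\<close>
  define t where "t = (if U = {} then 0 else (SUP d\<in>U. th d))"
  have bdd: "bdd_above (th ` U)" using thU by (auto intro!: bdd_aboveI2)
  have t_ge: "th d \<le> t" if "d \<in> U" for d
    using that bdd by (auto simp: t_def intro!: cSUP_upper)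
  have t_le: "t \<le> th e" if "e \<in> V" for e
    using thUV[OF _ that] thV[OF that] by (auto simp: t_def intro!: cSUP_least)
  have t01: "0 \<le> t" "t \<le> 1"
  proof -
    show "t \<le> 1" using thU by (auto simp: t_def intro!: cSUP_least)
    show "0 \<le> t"
    proof (cases "U = {}")
      case True
      then show ?thesis by (simp add: t_def)
    next
      case False
      then obtain d where "d \<in> U" by blast
      then show ?thesis using thU[of d] t_ge[of d] by linarith
    qed
  qed
  have comb: "t * d n + (1 - t) * d (Suc n) \<le> 0" if dE: "d \<in> E" for d
  proof -
    have "d n \<le> 0 \<and> d (Suc n) \<le> 0 \<or> d \<in> U \<or> d \<in> V"
      using both[OF dE] dE by (auto simp: U_def V_def)
    then consider "d n \<le> 0" "d (Suc n) \<le> 0" | "d \<in> U" | "d \<in> V" by blast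
    then show ?thesis
    proof cases
      case 1
      then show ?thesis using t01 by (intro add_nonpos_nonpos mult_nonneg_nonpos) auto
    next
      case 2
      then have "0 < d (Suc n) - d n" by (auto simp: U_def)
      then have "d (Suc n) \<le> t * (d (Suc n) - d n)"
        using t_ge[OF 2] by (simp add: th_def divide_simps)
      then show ?thesis by (simp add: algebra_simps)
    next
      case 3
      then have "d (Suc n) - d n < 0" by (auto simp: V_def)
      then have "t * (d (Suc n) - d n) \<ge> d (Suc n)"
        using t_le[OF 3] by (simp add: th_def divide_simps)
      then show ?thesis by (simp add: algebra_simps)
    qed
  qed
  define D' where "D' = (\<lambda>d. d(n := t * d n + (1 - t) * d (Suc n))) ` D"
  have "\<exists>l. (\<forall>i \<le> n. 0 \<le> l i) \<and> (\<Sum>i\<le>n. l i) = 1 \<and> (\<forall>d \<in> D'. (\<Sum>i\<le>n. l i * d i) \<le> 0)"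
  proof (rule Suc.IH)
    fix d e assume "d \<in> D'" "e \<in> D'"
    then obtain d0 e0 where "d0 \<in> D" "e0 \<in> D" and
      de: "d = d0(n := t * d0 n + (1 - t) * d0 (Suc n))" "e = e0(n := t * e0 n + (1 - t) * e0 (Suc n))"
      by (auto simp: D'_def)
    then have "(\<lambda>i. d0 i + e0 i) \<in> D" by (intro add)
    then show "(\<lambda>i. d i + e i) \<in> D'" unfolding D'_def
      by (rule rev_image_eqI) (auto simp: de fun_eq_iff algebra_simps)
  next
    fix c :: real and d assume c: "0 < c" and "d \<in> D'"
    then obtain d0 where "d0 \<in> D" and de: "d = d0(n := t * d0 n + (1 - t) * d0 (Suc n))"
      by (auto simp: D'_def)
    then have "(\<lambda>i. c * d0 i) \<in> D" using c by (intro scale)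
    then show "(\<lambda>i. c * d i) \<in> D'" unfolding D'_def
      by (rule rev_image_eqI) (auto simp: de fun_eq_iff algebra_simps)
  next
    show "\<not> (\<exists>d \<in> D'. \<forall>i \<le> n. 0 < d i)"
    proof
      assume "\<exists>d \<in> D'. \<forall>i \<le> n. 0 < d i"
      then obtain d where d: "d \<in> D" "\<forall>i \<le> n. 0 < (d(n := t * d n + (1 - t) * d (Suc n))) i"
        by (auto simp: D'_def)
      have "0 < d i" if "i < n" for i using d(2) that by (auto dest!: spec[of _ i])
      then have "d \<in> E" using d by (auto simp: E_def)
      from comb[OF this] d(2)[rule_format, of n] show False by simp
    qed
  qed
  then obtain l where l: "\<And>i. i \<le> n \<Longrightarrow> 0 \<le> l i" "(\<Sum>i\<le>n. l i) = 1"
    "\<And>d. d \<in> D' \<Longrightarrow> (\<Sum>i\<le>n. l i * d i) \<le> 0" by blast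
  define l' where "l' i = (if i < n then l i else if i = n then t * l n else (1 - t) * l n)" for i
  have split: "(\<Sum>i\<le>Suc n. l' i * f i) =
      (\<Sum>i\<le>n. l i * (f(n := t * f n + (1 - t) * f (Suc n))) i)" for f :: "nat \<Rightarrow> real"
  proof -
    have "(\<Sum>i\<le>Suc n. l' i * f i) = (\<Sum>i<n. l i * f i) + t * l n * f n + (1 - t) * l n * f (Suc n)"
      by (simp add: lessThan_Suc_atMost[symmetric] l'_def)
    then show ?thesis
      by (simp add: lessThan_Suc_atMost[symmetric] algebra_simps)
  qed
  show ?case
  proof (intro exI[of _ l'] conjI allI impI ballI)
    fix i assume "i \<le> Suc n"
    then show "0 \<le> l' i" using l(1) t01 by (auto simp: l'_def)
  next
    have "(\<lambda>_. 1)(n := t * 1 + (1 - t) * 1) = (\<lambda>_::nat. 1::real)" by (auto simp: fun_eq_iff)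
    then show "(\<Sum>i\<le>Suc n. l' i) = 1"
      using split[of "\<lambda>_. 1"] l(2) by simp
  next
    fix d assume "d \<in> D"
    then show "(\<Sum>i\<le>Suc n. l' i * d i) \<le> 0"
      unfolding split D'_def[symmetric] by (intro l(3)) (unfold D'_def, rule imageI)
  qed
qed

subsection \<open>Compactness for finitely many real coordinates\<close>

text \<open>Induction on the index set, with a further subsequence for each new coordinate. Points
  are functions of which only the values on \<open>I\<close> count, so matrices and vectors of any
  dimension can be encoded.\<close>

lemma bounded_coords_convergent_subseq:
  fixes f :: "nat \<Rightarrow> 'i \<Rightarrow> real"
  assumes "finite I" "\<And>n i. i \<in> I \<Longrightarrow> \<bar>f n i\<bar> \<le> B i"
  shows "\<exists>l r. strict_mono r \<and> (\<forall>i \<in> I. (\<lambda>n. f (r n) i) \<longlonglongrightarrow> l i)"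
  using assms
proof (induction I rule: finite_induct)
  case empty
  then show ?case by (auto intro!: exI[of _ id] simp: strict_mono_def)
next
  case (insert a I)
  then obtain l r where r: "strict_mono r" and l: "\<forall>i \<in> I. (\<lambda>n. f (r n) i) \<longlonglongrightarrow> l i"
    by (metis insertCI)
  have "bounded (range (\<lambda>n. f (r n) a))"
    using insert.prems[of a] by (auto simp: bounded_iff)
  then obtain x s where s: "strict_mono s" and x: "((\<lambda>n. f (r n) a) \<circ> s) \<longlonglongrightarrow> x"
    using bounded_imp_convergent_subsequence by blast
  show ?case
  proof (intro exI[of _ "l(a := x)"] exI[of _ "r \<circ> s"] conjI ballI)
    show "strict_mono (r \<circ> s)" using r s by (rule strict_mono_o)
    fix i assume "i \<in> insert a I"
    then show "(\<lambda>n. f ((r \<circ> s) n) i) \<longlonglongrightarrow> (l(a := x)) i"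
    proof (cases "i = a")
      case True
      then show ?thesis using x by (simp add: o_def)
    next
      case False
      then have "(\<lambda>n. f (r n) i) \<longlonglongrightarrow> l i" using l \<open>i \<in> insert a I\<close> by auto
      from LIMSEQ_subseq_LIMSEQ[OF this s] show ?thesis using False by (simp add: o_def)
    qed
  qed
qed

text \<open>Weierstrass: a minimizing sequence, moved into the box \<open>B\<close>, has a
  convergent subsequence, and \<open>closed\<close> puts the limit into \<open>C\<close>. The
  premise \<open>bounded\<close> asks only for some representative of the same value in the box,
  because the feasible sets themselves can be unbounded.\<close>

lemma has_least_of_compact:
  fixes C :: "real \<Rightarrow> ('i \<Rightarrow> real) \<Rightarrow> bool"
  assumes fin: "finite I" and ex: "C r0 f0"
    and lower: "\<And>r f. C r f \<Longrightarrow> b \<le> r"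
    and bounded: "\<And>r f. C r f \<Longrightarrow> r \<le> r0 \<Longrightarrow> \<exists>g. C r g \<and> (\<forall>i \<in> I. \<bar>g i\<bar> \<le> B i)"
    and closed: "\<And>rs fs r f. (\<And>n. C (rs n) (fs n)) \<Longrightarrow> rs \<longlonglongrightarrow> r \<Longrightarrow>
       (\<And>i. i \<in> I \<Longrightarrow> (\<lambda>n. fs n i) \<longlonglongrightarrow> f i) \<Longrightarrow> C r f"
  shows "has_least (\<lambda>r. \<exists>f. C r f)"
proof -
  define A where "A = {r. r \<le> r0 \<and> (\<exists>f. C r f)}"
  have A: "A \<noteq> {}" "bdd_below A" using ex lower by (auto simp: A_def intro!: bdd_belowI)
  have "\<exists>r g. C r g \<and> (\<forall>i \<in> I. \<bar>g i\<bar> \<le> B i) \<and> r < Inf A + inverse (real (Suc n)) \<and> Inf A \<le> r" for n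
  proof -
    have "Inf A < Inf A + inverse (real (Suc n))" by simp
    from cInf_lessD[OF A(1) this] obtain r where r: "r \<in> A" "r < Inf A + inverse (real (Suc n))"
      by blast
    then obtain f where "C r f" "r \<le> r0" by (auto simp: A_def)
    from bounded[OF this] show ?thesis using r(2) cInf_lower[OF r(1) A(2)] by blast
  qed
  then obtain rs gs where rg: "\<And>n. C (rs n) (gs n)" "\<And>n i. i \<in> I \<Longrightarrow> \<bar>gs n i\<bar> \<le> B i"
    "\<And>n. rs n < Inf A + inverse (real (Suc n))" "\<And>n. Inf A \<le> rs n" by metis
  have "rs \<longlonglongrightarrow> Inf A"
  proof (rule tendsto_sandwich[of "\<lambda>_. Inf A" _ _ "\<lambda>n. Inf A + inverse (real (Suc n))"])
    show "(\<lambda>n. Inf A + inverse (real (Suc n))) \<longlonglongrightarrow> Inf A"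
      using LIMSEQ_inverse_real_of_nat_add by simp
  qed (use rg in \<open>auto intro!: always_eventually less_imp_le\<close>)
  then have lim: "(\<lambda>n. rs (s n)) \<longlonglongrightarrow> Inf A" if "strict_mono s" for s
    using LIMSEQ_subseq_LIMSEQ[OF _ that] by (auto simp: o_def)
  obtain l s where s: "strict_mono s" and l: "\<forall>i \<in> I. (\<lambda>n. gs (s n) i) \<longlonglongrightarrow> l i"
    using bounded_coords_convergent_subseq[of I gs B, OF fin rg(2)] by blast
  have "C (Inf A) l"
    by (rule closed[OF rg(1) lim[OF s]]) (use l in blast)
  moreover have "Inf A \<le> r" if "C r f" for r f
  proof (cases "r \<le> r0")
    case True
    then show ?thesis using that A by (intro cInf_lower) (auto simp: A_def)
  next
    case False
    have "Inf A \<le> r0" using A ex by (intro cInf_lower) (auto simp: A_def)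
    then show ?thesis using False by simp
  qed
  ultimately show ?thesis unfolding has_least_def by blast
qed

subsection \<open>Gaussian rounding\<close>

definition std_gauss :: "'k set \<Rightarrow> ('k \<Rightarrow> real) measure" where
  "std_gauss I = PiM I (\<lambda>_. density lborel std_normal_density)"

lemma prob_space_std_gauss: "prob_space (std_gauss I)"
  unfolding std_gauss_def
  by (intro prob_space_PiM prob_space_normal_density) simp

text \<open>The first absolute moment is the source of the factor \<open>2 / pi\<close> in the final
  bound.\<close>

lemma std_normal_abs_moments:
  assumes "prob_space M" "distributed M lborel Y std_normal_density"
  shows "integrable M (\<lambda>x. \<bar>Y x\<bar>)" "(LINT x|M. \<bar>Y x\<bar>) = sqrt (2 / pi)"
    "integrable M (\<lambda>x. (Y x)\<^sup>2)" "(LINT x|M. (Y x)\<^sup>2) = 1"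
proof -
  interpret prob_space M by fact
  note d = assms(2)
  show "integrable M (\<lambda>x. \<bar>Y x\<bar>)"
    using integrable_std_normal_moment_abs[of 1]
    by (subst distributed_integrable[OF d, symmetric]) auto
  show "integrable M (\<lambda>x. (Y x)\<^sup>2)"
    using integrable_std_normal_moment[of 2]
    by (subst distributed_integrable[OF d, symmetric]) auto
  show "(LINT x|M. \<bar>Y x\<bar>) = sqrt (2 / pi)"
    using integral_std_normal_moment_abs_odd[of 0]
    by (subst distributed_integral[OF d, symmetric]) auto
  show "(LINT x|M. (Y x)\<^sup>2) = 1"
    using integral_std_normal_moment_even[of 1]
    by (subst distributed_integral[OF d, symmetric]) auto
qed

lemma std_gauss_functional_distributed:
  assumes I: "finite I" "I \<noteq> {}" "\<And>k. k \<in> I \<Longrightarrow> a k \<noteq> 0" "I \<subseteq> J" "finite J"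
  shows "distributed (std_gauss J) lborel (\<lambda>g. \<Sum>k\<in>I. a k * g k)
           (normal_density 0 (sqrt (\<Sum>k\<in>I. (a k)\<^sup>2)))"
proof -
  interpret prob_space "std_gauss J" by (rule prob_space_std_gauss)
  let ?N = "density lborel std_normal_density"
  interpret P: product_prob_space "\<lambda>_. ?N" J
    by (rule product_prob_spaceI) (simp add: prob_space_normal_density)
  have "indep_vars (\<lambda>_. borel) (\<lambda>k g. a k * g k) J"
  proof -
    have "indep_vars (\<lambda>_. ?N) (\<lambda>k g. g k) J"
    proof (subst indep_vars_iff_distr_eq_PiM')
      show "J \<noteq> {}" using I by auto
      show "random_variable ?N (\<lambda>g. g k)" if "k \<in> J" for k
        unfolding std_gauss_def using that by simp
      \<comment> \<open>Points of the product space are undefined off \<open>J\<close>, so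
        restriction to \<open>J\<close> is the identity on it.\<close>
      have "distr (std_gauss J) (PiM J (\<lambda>_. ?N)) (\<lambda>x. \<lambda>i\<in>J. x i) = distr (std_gauss J) (PiM J (\<lambda>_. ?N)) (\<lambda>x. x)"
        by (rule distr_cong) (auto simp: std_gauss_def space_PiM)
      also have "\<dots> = PiM J (\<lambda>_. ?N)" by (simp add: std_gauss_def distr_id2)
      also have "\<dots> = PiM J (\<lambda>i. distr (std_gauss J) ?N (\<lambda>g. g i))"
        by (rule PiM_cong) (simp_all add: std_gauss_def P.PiM_component)
      finally show "distr (std_gauss J) (PiM J (\<lambda>_. ?N)) (\<lambda>x. \<lambda>i\<in>J. x i) =
        PiM J (\<lambda>i. distr (std_gauss J) ?N (\<lambda>g. g i))" .
    qed
    then have "indep_vars (\<lambda>_. borel) (\<lambda>k. (\<lambda>z. a k * z) \<circ> (\<lambda>g. g k)) J"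
      by (intro indep_vars_compose) auto
    then show ?thesis by (simp add: o_def)
  qed
  then have ind: "indep_vars (\<lambda>_. borel) (\<lambda>k g. a k * g k) I"
    using indep_vars_subset I by blast
  have "distributed (std_gauss J) lborel (\<lambda>g. a k * g k) (normal_density 0 \<bar>a k\<bar>)" if k: "k \<in> I" for k
  proof -
    have "distr (std_gauss J) lborel (\<lambda>g. g k) = distr (std_gauss J) ?N (\<lambda>g. g k)"
      by (rule distr_cong) auto
    also have "\<dots> = ?N"
      unfolding std_gauss_def using k I by (intro P.PiM_component) auto
    finally have "distributed (std_gauss J) lborel (\<lambda>g. g k) std_normal_density"
      using k I by (auto simp: distributed_def std_gauss_def)
    from normal_density_affine[OF this, of "a k" 0] k I show ?thesis by simp
  qed
  from sum_indep_normal[OF I(1,2) ind _ this] I show ?thesis by simp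
qed

text \<open>After removal of the zero coefficients, division by the deviation
  \<open>\<sigma>\<close> reduces everything to the standard normal moments. If no coefficient
  remains, the functional is zero.\<close>

lemma std_gauss_functional:
  assumes J: "finite J"
  shows "integrable (std_gauss J) (\<lambda>g. \<bar>\<Sum>k\<in>J. a k * g k\<bar>)"
    "(LINT g|std_gauss J. \<bar>\<Sum>k\<in>J. a k * g k\<bar>) = sqrt (2 / pi) * sqrt (\<Sum>k\<in>J. (a k)\<^sup>2)"
    "integrable (std_gauss J) (\<lambda>g. (\<Sum>k\<in>J. a k * g k)\<^sup>2)"
    "(LINT g|std_gauss J. (\<Sum>k\<in>J. a k * g k)\<^sup>2) = (\<Sum>k\<in>J. (a k)\<^sup>2)"
proof -
  define I where "I = {k \<in> J. a k \<noteq> 0}"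
  have I: "finite I" "I \<subseteq> J" "\<And>k. k \<in> I \<Longrightarrow> a k \<noteq> 0" using J by (auto simp: I_def)
  have s: "(\<Sum>k\<in>J. a k * g k) = (\<Sum>k\<in>I. a k * g k)" for g
    using J by (intro sum.mono_neutral_right) (auto simp: I_def)
  have s2: "(\<Sum>k\<in>J. (a k)\<^sup>2) = (\<Sum>k\<in>I. (a k)\<^sup>2)"
    using J by (intro sum.mono_neutral_right) (auto simp: I_def)
  define \<sigma> where "\<sigma> = sqrt (\<Sum>k\<in>I. (a k)\<^sup>2)"
  let ?X = "\<lambda>g. \<Sum>k\<in>I. a k * g k"
  have *: "integrable (std_gauss J) (\<lambda>g. \<bar>?X g\<bar>) \<and> (LINT g|std_gauss J. \<bar>?X g\<bar>) = sqrt (2 / pi) * \<sigma> \<and>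
    integrable (std_gauss J) (\<lambda>g. (?X g)\<^sup>2) \<and> (LINT g|std_gauss J. (?X g)\<^sup>2) = \<sigma>\<^sup>2"
  proof (cases "I = {}")
    case True
    then show ?thesis by (simp add: \<sigma>_def)
  next
    case False
    interpret prob_space "std_gauss J" by (rule prob_space_std_gauss)
    have "0 < (\<Sum>k\<in>I. (a k)\<^sup>2)" using I False by (intro sum_pos) auto
    then have \<sigma>: "0 < \<sigma>" by (simp add: \<sigma>_def)
    have "distributed (std_gauss J) lborel (\<lambda>g. (?X g - 0) / \<sigma>) std_normal_density"
      using std_gauss_functional_distributed[OF I(1) False I(3,2) J] \<sigma>
        normal_standard_normal_convert[of \<sigma> ?X 0]
      by (simp add: \<sigma>_def)
    from std_normal_abs_moments[OF prob_space_axioms this]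
    have m: "integrable (std_gauss J) (\<lambda>g. \<bar>?X g / \<sigma>\<bar>)" "(LINT g|std_gauss J. \<bar>?X g / \<sigma>\<bar>) = sqrt (2 / pi)"
      "integrable (std_gauss J) (\<lambda>g. (?X g / \<sigma>)\<^sup>2)" "(LINT g|std_gauss J. (?X g / \<sigma>)\<^sup>2) = 1" by simp_all
    have e: "\<bar>?X g\<bar> = \<sigma> * \<bar>?X g / \<sigma>\<bar>" "(?X g)\<^sup>2 = \<sigma>\<^sup>2 * (?X g / \<sigma>)\<^sup>2" for g
      using \<sigma> by (simp_all add: abs_divide power_divide)
    show ?thesis unfolding e
      using m by (auto simp del: abs_divide simp: power_divide[symmetric] simp del: power_divide)
  qed
  have "0 \<le> (\<Sum>k\<in>I. (a k)\<^sup>2)" by (simp add: sum_nonneg)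
  then show "integrable (std_gauss J) (\<lambda>g. \<bar>\<Sum>k\<in>J. a k * g k\<bar>)"
    "(LINT g|std_gauss J. \<bar>\<Sum>k\<in>J. a k * g k\<bar>) = sqrt (2 / pi) * sqrt (\<Sum>k\<in>J. (a k)\<^sup>2)"
    "integrable (std_gauss J) (\<lambda>g. (\<Sum>k\<in>J. a k * g k)\<^sup>2)"
    "(LINT g|std_gauss J. (\<Sum>k\<in>J. a k * g k)\<^sup>2) = (\<Sum>k\<in>J. (a k)\<^sup>2)"
    unfolding s s2 using * by (simp_all add: \<sigma>_def)
qed

lemma std_gauss_functional_measurable [measurable]:
  "(\<lambda>g. \<Sum>k\<in>J. a k * g k) \<in> borel_measurable (std_gauss J)"
proof -
  have "(\<lambda>g. g k) \<in> borel_measurable (std_gauss J)" if "k \<in> J" for k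
    using measurable_component_singleton[OF that, of "\<lambda>_. density lborel std_normal_density"]
    by (simp add: std_gauss_def measurable_def)
  then show ?thesis by (intro borel_measurable_sum borel_measurable_times) auto
qed

text \<open>Polarization of the second moment.\<close>

lemma std_gauss_functional_mult:
  assumes "finite J"
  shows "has_bochner_integral (std_gauss J)
    (\<lambda>g. (\<Sum>k\<in>J. u k * g k) * (\<Sum>k\<in>J. v k * g k)) (\<Sum>k\<in>J. u k * v k)"
proof -
  let ?L = "\<lambda>a g. \<Sum>k\<in>J. a k * g k"
  have b: "has_bochner_integral (std_gauss J) (\<lambda>g. (?L a g)\<^sup>2) (\<Sum>k\<in>J. (a k)\<^sup>2)" for a :: "'a \<Rightarrow> real"
    using std_gauss_functional(3,4)[OF assms, of a] by (simp add: has_bochner_integral_iff)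
  have "has_bochner_integral (std_gauss J)
     (\<lambda>g. ((?L (\<lambda>k. u k + v k) g)\<^sup>2 - (?L u g)\<^sup>2 - (?L v g)\<^sup>2) / 2)
     (((\<Sum>k\<in>J. (u k + v k)\<^sup>2) - (\<Sum>k\<in>J. (u k)\<^sup>2) - (\<Sum>k\<in>J. (v k)\<^sup>2)) / 2)"
    by (intro has_bochner_integral_divide_zero has_bochner_integral_diff b)
  moreover have "((?L (\<lambda>k. u k + v k) g)\<^sup>2 - (?L u g)\<^sup>2 - (?L v g)\<^sup>2) / 2 = ?L u g * ?L v g" for g
  proof -
    have "?L (\<lambda>k. u k + v k) g = ?L u g + ?L v g"
      by (simp add: distrib_right sum.distrib)
    then show ?thesis by (simp add: power2_sum)
  qed
  moreover have "((\<Sum>k\<in>J. (u k + v k)\<^sup>2) - (\<Sum>k\<in>J. (u k)\<^sup>2) - (\<Sum>k\<in>J. (v k)\<^sup>2)) / 2 = (\<Sum>k\<in>J. u k * v k)"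
    by (simp add: power2_sum sum.distrib sum_distrib_left[symmetric] mult.assoc)
  ultimately show ?thesis by simp
qed

text \<open>The function \<open>t \<mapsto> E |\<langle>u + t v, g\<rangle>| - t E (sgn \<langle>u, g\<rangle> \<langle>v, g\<rangle>)\<close> is minimal at \<open>t = 0\<close>, so its
  derivative vanishes there.\<close>

lemma std_gauss_sign_mult:
  fixes u v :: "'k \<Rightarrow> real"
  assumes J: "finite J" and pos: "0 < (\<Sum>k\<in>J. (u k)\<^sup>2)"
  shows "has_bochner_integral (std_gauss J)
    (\<lambda>g. sgn (\<Sum>k\<in>J. u k * g k) * (\<Sum>k\<in>J. v k * g k))
    (sqrt (2 / pi) * (\<Sum>k\<in>J. u k * v k) / sqrt (\<Sum>k\<in>J. (u k)\<^sup>2))"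
proof -
  let ?L = "\<lambda>a g. \<Sum>k\<in>J. a k * g k"
  let ?M = "std_gauss J"
  define c where "c = sqrt (2 / pi)"
  define e where "e = (LINT g|?M. sgn (?L u g) * ?L v g)"
  have int: "integrable ?M (\<lambda>g. sgn (?L u g) * ?L v g)"
  proof (rule Bochner_Integration.integrable_bound[OF std_gauss_functional(1)[OF J, of v]])
    show "(\<lambda>g. sgn (?L u g) * ?L v g) \<in> borel_measurable ?M" by measurable
    show "AE g in ?M. norm (sgn (?L u g) * ?L v g) \<le> norm \<bar>?L v g\<bar>"
      by (intro AE_I2) (auto simp: abs_mult sgn_real_def)
  qed
  define A B C where ABC: "A = (\<Sum>k\<in>J. (u k)\<^sup>2)" "B = (\<Sum>k\<in>J. u k * v k)" "C = (\<Sum>k\<in>J. (v k)\<^sup>2)"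
  have A: "0 < A" using pos by (simp add: ABC)
  have sq: "(\<Sum>k\<in>J. (u k + t * v k)\<^sup>2) = A + 2 * t * B + t\<^sup>2 * C" for t
    by (simp add: ABC power2_sum sum.distrib sum_distrib_left power_mult_distrib algebra_simps)
  \<comment> \<open>Subgradient inequality for the modulus:
    \<open>|a| + t * (sgn a * b) \<le> |a + t * b|\<close> holds pointwise, also at
    \<open>a = 0\<close>, where \<open>sgn a = 0\<close>. After integration it is tight at
    \<open>t = 0\<close>.\<close>
  have ge: "c * sqrt A + t * e \<le> c * sqrt (A + 2 * t * B + t\<^sup>2 * C)" for t
  proof -
    have "c * sqrt A + t * e = (LINT g|?M. \<bar>?L u g\<bar> + t * (sgn (?L u g) * ?L v g))"
      using int std_gauss_functional(1,2)[OF J, of u] by (simp add: c_def e_def ABC)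
    also have "\<dots> \<le> (LINT g|?M. \<bar>?L (\<lambda>k. u k + t * v k) g\<bar>)"
    proof (rule integral_mono)
      fix g
      have "?L (\<lambda>k. u k + t * v k) g = ?L u g + t * ?L v g"
        by (simp add: distrib_right sum.distrib sum_distrib_left mult.assoc)
      then show "\<bar>?L u g\<bar> + t * (sgn (?L u g) * ?L v g) \<le> \<bar>?L (\<lambda>k. u k + t * v k) g\<bar>"
        by (auto simp: sgn_real_def abs_if)
    qed (use int std_gauss_functional(1)[OF J] in auto)
    also have "\<dots> = c * sqrt (A + 2 * t * B + t\<^sup>2 * C)"
      using std_gauss_functional(2)[OF J] by (simp add: c_def sq)
    finally show ?thesis .
  qed
  let ?f = "\<lambda>t. c * sqrt (A + 2 * t * B + t\<^sup>2 * C) - t * e"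
  \<comment> \<open>Since \<open>A > 0\<close>, the square root is differentiable at
    \<open>t = 0\<close>; the stationarity condition is then solved for \<open>e\<close>.\<close>
  have "(?f has_real_derivative (c * (2 * B * (inverse (sqrt A) / 2)) - e)) (at 0)"
    using A by (auto intro!: derivative_eq_intros)
  from DERIV_local_min[OF this, of 1] have "c * (2 * B * (inverse (sqrt A) / 2)) - e = 0"
    using ge by (auto simp: le_diff_eq add.commute)
  then have "e = c * B / sqrt A" by (simp add: field_simps)
  then show ?thesis using int by (simp add: has_bochner_integral_iff e_def c_def ABC)
qed

text \<open>Rietz's argument: with \<open>c = sqrt (2 / pi)\<close> one has \<open>E (h\<^sub>i G\<^sub>j) = c E (G\<^sub>i G\<^sub>j)\<close> for the rounding \<open>h\<close> of \<open>G\<close>,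
  so taking expectations of the form at \<open>h - c G\<close> bounds the form at \<open>h\<close> from below.\<close>

lemma psd_gaussian_rounding:
  fixes W :: "nat \<Rightarrow> nat \<Rightarrow> real" and x :: "'k \<Rightarrow> nat \<Rightarrow> real"
  assumes J: "finite J" and psd: "\<And>y. 0 \<le> (\<Sum>i<N. \<Sum>j<N. W i j * (y i * y j))"
  shows "\<exists>y. (\<forall>i. (y i)\<^sup>2 \<le> (\<Sum>k\<in>J. (x k i)\<^sup>2)) \<and>
    2 / pi * (\<Sum>k\<in>J. \<Sum>i<N. \<Sum>j<N. W i j * (x k i * x k j)) \<le> (\<Sum>i<N. \<Sum>j<N. W i j * (y i * y j))"
proof -
  let ?M = "std_gauss J"
  interpret prob_space ?M by (rule prob_space_std_gauss)
  define G where "G i g = (\<Sum>k\<in>J. x k i * g k)" for i g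
  define \<sigma> where "\<sigma> i = sqrt (\<Sum>k\<in>J. (x k i)\<^sup>2)" for i
  define h where "h i g = \<sigma> i * sgn (G i g)" for i g
  define c where "c = sqrt (2 / pi)"
  define X where "X i j = (\<Sum>k\<in>J. x k i * x k j)" for i j
  have c2: "c * c = 2 / pi" by (simp add: c_def)
  have Gm [measurable]: "G i \<in> borel_measurable ?M" for i
    unfolding G_def by (rule std_gauss_functional_measurable)
  have \<sigma>: "0 \<le> \<sigma> i" "(\<sigma> i)\<^sup>2 = (\<Sum>k\<in>J. (x k i)\<^sup>2)" for i
    by (simp_all add: \<sigma>_def sum_nonneg)
  have GG: "has_bochner_integral ?M (\<lambda>g. G i g * G j g) (X i j)" for i j
    unfolding G_def X_def by (rule std_gauss_functional_mult[OF J])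
  \<comment> \<open>If \<open>\<sigma> i = 0\<close> the sign formula does not apply, but then
    \<open>h i\<close> and \<open>X i j\<close> both vanish.\<close>
  have hG: "has_bochner_integral ?M (\<lambda>g. h i g * G j g) (c * X i j)" for i j
  proof (cases "\<sigma> i = 0")
    case True
    then have "(\<Sum>k\<in>J. (x k i)\<^sup>2) = 0" using \<sigma>(2)[of i] by simp
    then have "X i j = 0" using J by (simp add: X_def sum_nonneg_eq_0_iff)
    then show ?thesis using True by (simp add: h_def has_bochner_integral_zero)
  next
    case False
    then have "0 < \<sigma> i" using \<sigma>(1)[of i] by simp
    then have "0 < (\<Sum>k\<in>J. (x k i)\<^sup>2)" by (simp add: \<sigma>_def)
    have "has_bochner_integral ?M (\<lambda>g. \<sigma> i * (sgn (G i g) * G j g)) (\<sigma> i * (c * X i j / \<sigma> i))"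
      unfolding G_def X_def c_def \<sigma>_def
      by (rule has_bochner_integral_mult_right[OF std_gauss_sign_mult[OF J \<open>0 < (\<Sum>k\<in>J. (x k i)\<^sup>2)\<close>]])
    moreover have "\<sigma> i * (c * X i j / \<sigma> i) = c * X i j" using False by simp
    ultimately show ?thesis by (simp add: h_def mult.assoc)
  qed
  define Eh where "Eh i j = (LINT g|?M. h i g * h j g)" for i j
  have hm [measurable]: "h i \<in> borel_measurable ?M" for i
    unfolding h_def by measurable
  have hh: "has_bochner_integral ?M (\<lambda>g. h i g * h j g) (Eh i j)" for i j
  proof -
    have "integrable ?M (\<lambda>g. h i g * h j g)"
      by (rule integrable_const_bound[of _ "\<sigma> i * \<sigma> j"])
        (auto simp: h_def abs_mult sgn_real_def \<sigma>(1))
    then show ?thesis by (simp add: Eh_def has_bochner_integral_iff)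
  qed
  have cm: "has_bochner_integral ?M (\<lambda>g. a * f g) (a * z)" if "has_bochner_integral ?M f z" for a z :: real and f
    by (rule has_bochner_integral_mult_right) (rule that)
  have "has_bochner_integral ?M
      (\<lambda>g. h i g * h j g - c * (h i g * G j g) - c * (h j g * G i g) + c * c * (G i g * G j g))
      (Eh i j - c * (c * X i j) - c * (c * X j i) + c * c * X i j)" for i j
    using has_bochner_integral_add[OF has_bochner_integral_diff[OF has_bochner_integral_diff[OF hh[of i j]
      cm[OF hG[of i j], of c]] cm[OF hG[of j i], of c]] cm[OF GG[of i j], of "c * c"]] by simp
  then have F: "has_bochner_integral ?M
      (\<lambda>g. \<Sum>i<N. \<Sum>j<N. W i j * (h i g * h j g - c * (h i g * G j g) - c * (h j g * G i g) + c * c * (G i g * G j g)))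
      (\<Sum>i<N. \<Sum>j<N. W i j * (Eh i j - c * (c * X i j) - c * (c * X j i) + c * c * X i j))" (is "has_bochner_integral _ ?F ?I")
    by (intro has_bochner_integral_sum cm)
  have F_nonneg: "0 \<le> ?F g" for g
  proof -
    have "?F g = (\<Sum>i<N. \<Sum>j<N. W i j * ((h i g - c * G i g) * (h j g - c * G j g)))"
      by (rule sum.cong[OF refl], rule sum.cong[OF refl], rule arg_cong[where f = "\<lambda>z. W _ _ * z"])
        (simp add: algebra_simps)
    also have "0 \<le> \<dots>" by (rule psd)
    finally show ?thesis .
  qed
  have "?I = integral\<^sup>L ?M ?F" using has_bochner_integral_integral_eq[OF F] by (rule sym)
  also have "0 \<le> \<dots>" by (rule integral_nonneg_AE) (rule AE_I2, rule F_nonneg)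
  finally have "0 \<le> ?I" .
  \<comment> \<open>Each of the two cross terms contributes \<open>- c * c * X i j\<close> and the
    last term \<open>+ c * c * X i j\<close>; the symmetry of \<open>X\<close> merges them.\<close>
  also have "?I = (\<Sum>i<N. \<Sum>j<N. W i j * Eh i j - c * c * (W i j * X i j))"
  proof (intro sum.cong refl)
    fix i j
    have "X j i = X i j" by (simp add: X_def mult.commute)
    then show "W i j * (Eh i j - c * (c * X i j) - c * (c * X j i) + c * c * X i j) =
        W i j * Eh i j - c * c * (W i j * X i j)" by (simp add: algebra_simps)
  qed
  also have "\<dots> = (\<Sum>i<N. \<Sum>j<N. W i j * Eh i j) - c * c * (\<Sum>i<N. \<Sum>j<N. W i j * X i j)"
    by (simp add: sum_subtractf sum_distrib_left)
  finally have "2 / pi * (\<Sum>i<N. \<Sum>j<N. W i j * X i j) \<le> (\<Sum>i<N. \<Sum>j<N. W i j * Eh i j)"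
    unfolding c2 by linarith
  moreover have "(\<Sum>k\<in>J. \<Sum>i<N. \<Sum>j<N. W i j * (x k i * x k j)) = (\<Sum>i<N. \<Sum>j<N. W i j * X i j)"
  proof -
    have "(\<Sum>k\<in>J. \<Sum>i<N. \<Sum>j<N. W i j * (x k i * x k j)) =
        (\<Sum>i<N. \<Sum>k\<in>J. \<Sum>j<N. W i j * (x k i * x k j))" by (rule sum.swap)
    also have "\<dots> = (\<Sum>i<N. \<Sum>j<N. \<Sum>k\<in>J. W i j * (x k i * x k j))"
      by (rule sum.cong[OF refl], rule sum.swap)
    finally show ?thesis by (simp add: X_def sum_distrib_left)
  qed
  moreover have hhs: "has_bochner_integral ?M (\<lambda>g. \<Sum>i<N. \<Sum>j<N. W i j * (h i g * h j g)) (\<Sum>i<N. \<Sum>j<N. W i j * Eh i j)"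
    by (intro has_bochner_integral_sum cm hh)
  ultimately have le: "2 / pi * (\<Sum>k\<in>J. \<Sum>i<N. \<Sum>j<N. W i j * (x k i * x k j)) \<le>
      expectation (\<lambda>g. \<Sum>i<N. \<Sum>j<N. W i j * (h i g * h j g))"
    using has_bochner_integral_integral_eq[OF hhs] by simp
  \<comment> \<open>At least one outcome does as well as the average.\<close>
  have "\<exists>g. 2 / pi * (\<Sum>k\<in>J. \<Sum>i<N. \<Sum>j<N. W i j * (x k i * x k j)) \<le> (\<Sum>i<N. \<Sum>j<N. W i j * (h i g * h j g))"
  proof (rule ccontr)
    assume "\<not> ?thesis"
    then have "expectation (\<lambda>g. \<Sum>i<N. \<Sum>j<N. W i j * (h i g * h j g)) <
       2 / pi * (\<Sum>k\<in>J. \<Sum>i<N. \<Sum>j<N. W i j * (x k i * x k j))"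
      using integrable.intros[OF hhs] by (intro expectation_less AE_I2) (simp_all add: not_le)
    with le show False by simp
  qed
  then obtain g where g: "2 / pi * (\<Sum>k\<in>J. \<Sum>i<N. \<Sum>j<N. W i j * (x k i * x k j)) \<le>
      (\<Sum>i<N. \<Sum>j<N. W i j * (h i g * h j g))" ..
  moreover have "(h i g)\<^sup>2 \<le> (\<Sum>k\<in>J. (x k i)\<^sup>2)" for i
    unfolding \<sigma>(2)[symmetric] by (auto simp: h_def sgn_real_def)
  ultimately show ?thesis by (intro exI[of _ "\<lambda>i. h i g"] conjI allI)
qed

text \<open>Nesterov's \<open>pi / 2\<close> bound in dual form, for a product of balls:
  \<open>p i\<close> is the squared norm of the coordinates in block \<open>i\<close>. A bound known
  on the product of unit balls becomes, up to the factor \<open>pi / 2\<close>, a certificate valid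
  on the whole space.\<close>

lemma psd_block_domination:
  fixes W :: "nat \<Rightarrow> nat \<Rightarrow> real" and b :: "nat \<Rightarrow> nat" and N :: nat
  defines "q \<equiv> \<lambda>y. \<Sum>i<N. \<Sum>j<N. W i j * (y i * y j)"
    and "p \<equiv> \<lambda>i y. \<Sum>j | j < N \<and> b j = i. (y j)\<^sup>2"
  assumes psd: "\<And>y. 0 \<le> q y" and b: "\<And>j. j < N \<Longrightarrow> b j \<le> T"
    and bnd: "\<And>y. (\<And>i. i \<le> T \<Longrightarrow> p i y \<le> 1) \<Longrightarrow> q y \<le> R"
  shows "\<exists>l. (\<forall>i \<le> T. 0 \<le> l i) \<and> (\<Sum>i\<le>T. l i) = pi / 2 * R \<and> (\<forall>y. q y \<le> (\<Sum>i\<le>T. l i * p i y))"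
proof -
  define \<kappa> where "\<kappa> = pi / 2 * R"
  have "q (\<lambda>_. 0) \<le> R" by (rule bnd) (simp add: p_def)
  then have R: "0 \<le> R" by (simp add: q_def)
  then have \<kappa>: "0 \<le> \<kappa>" by (simp add: \<kappa>_def)
  have q_scale: "q (\<lambda>j. c * y j) = c\<^sup>2 * q y" for c y
    by (simp add: q_def sum_distrib_left power2_eq_square mult_ac)
  have p_scale: "p i (\<lambda>j. c * y j) = c\<^sup>2 * p i y" for c y i
    by (simp add: p_def sum_distrib_left power_mult_distrib)
  have p_nn: "0 \<le> p i y" for i y by (simp add: p_def sum_nonneg)
  \<comment> \<open>By homogeneity the bound on the unit balls scales to squared radius
    \<open>s\<close>. For \<open>s = 0\<close> no scaling is possible, but then all coordinates
    vanish, because \<open>b\<close> sends each of them to one of the blocks up to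
    \<open>T\<close>.\<close>
  have homog: "q y \<le> s * R" if s: "0 \<le> s" and y: "\<And>i. i \<le> T \<Longrightarrow> p i y \<le> s" for s y
  proof (cases "s = 0")
    case True
    have "y j = 0" if j: "j < N" for j
    proof -
      have "p (b j) y = 0" using y[OF b[OF j]] p_nn[of "b j" y] True by simp
      then show ?thesis using j by (auto simp: p_def sum_nonneg_eq_0_iff)
    qed
    then have "q y = 0" by (simp add: q_def)
    then show ?thesis using True by simp
  next
    case False
    then have s: "0 < s" using s by simp
    define c where "c = 1 / sqrt s"
    have c2: "c\<^sup>2 = 1 / s" using s by (simp add: c_def power_divide)
    have "q (\<lambda>j. c * y j) \<le> R"
    proof (rule bnd)
      show "p i (\<lambda>j. c * y j) \<le> 1" if "i \<le> T" for i
        using y[OF that] s by (simp add: p_scale c2 divide_le_eq)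
    qed
    then have "q y / s \<le> R" by (simp add: q_scale c2)
    then show ?thesis using s by (simp add: divide_le_eq mult.commute)
  qed
  \<comment> \<open>Lists give closure under addition, which single vectors \<open>x\<close> need
    not provide. Multiplication by \<open>c\<close> is realized by rescaling every \<open>x\<close>
    with \<open>sqrt c\<close>.\<close>
  define D where "D = {d. \<exists>xs. d = (\<lambda>i. sum_list (map (\<lambda>x. q x - \<kappa> * p i x) xs))}"
  have "\<exists>l. (\<forall>i \<le> T. 0 \<le> l i) \<and> (\<Sum>i\<le>T. l i) = 1 \<and> (\<forall>d \<in> D. (\<Sum>i\<le>T. l i * d i) \<le> 0)"
  proof (rule cone_alternative)
    fix d e assume "d \<in> D" "e \<in> D"
    then obtain xs ys where "d = (\<lambda>i. sum_list (map (\<lambda>x. q x - \<kappa> * p i x) xs))"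
      "e = (\<lambda>i. sum_list (map (\<lambda>x. q x - \<kappa> * p i x) ys))" by (auto simp: D_def)
    then show "(\<lambda>i. d i + e i) \<in> D" unfolding D_def
      by (intro CollectI exI[of _ "xs @ ys"]) simp
  next
    fix c :: real and d assume c: "0 < c" and "d \<in> D"
    then obtain xs where d: "d = (\<lambda>i. sum_list (map (\<lambda>x. q x - \<kappa> * p i x) xs))"
      by (auto simp: D_def)
    have "q (\<lambda>j. sqrt c * x j) - \<kappa> * p i (\<lambda>j. sqrt c * x j) = c * (q x - \<kappa> * p i x)" for i x
      using c unfolding q_scale p_scale by (simp add: algebra_simps)
    then show "(\<lambda>i. c * d i) \<in> D" unfolding D_def
      by (intro CollectI exI[of _ "map (\<lambda>x j. sqrt c * x j) xs"])
        (simp add: d o_def sum_list_const_mult)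
  next
    show "\<not> (\<exists>d \<in> D. \<forall>i \<le> T. 0 < d i)"
    proof
      assume "\<exists>d \<in> D. \<forall>i \<le> T. 0 < d i"
      then obtain xs where xs: "\<And>i. i \<le> T \<Longrightarrow> 0 < sum_list (map (\<lambda>x. q x - \<kappa> * p i x) xs)"
        by (auto simp: D_def)
      let ?J = "{..<length xs}"
      have sl: "sum_list (map f xs) = (\<Sum>k\<in>?J. f (xs ! k))" for f :: "(nat \<Rightarrow> real) \<Rightarrow> real"
        by (simp add: sum_list_sum_nth atLeast0LessThan)
      define P where "P i = (\<Sum>k\<in>?J. p i (xs ! k))" for i
      define Qs where "Qs = (\<Sum>k\<in>?J. q (xs ! k))"
      have lt: "\<kappa> * P i < Qs" if "i \<le> T" for i
        using xs[OF that] by (simp add: sl P_def Qs_def sum_subtractf sum_distrib_left)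
      obtain y where y: "\<And>j. (y j)\<^sup>2 \<le> (\<Sum>k\<in>?J. (xs ! k) j ^ 2)" "2 / pi * Qs \<le> q y"
        using psd_gaussian_rounding[where J = ?J and N = N and W = W and x = "\<lambda>k. xs ! k"] psd unfolding q_def Qs_def by auto
      have py: "p i y \<le> P i" for i
      proof -
        have "p i y \<le> (\<Sum>j | j < N \<and> b j = i. \<Sum>k\<in>?J. (xs ! k) j ^ 2)"
          unfolding p_def by (intro sum_mono y)
        also have "\<dots> = P i" unfolding P_def p_def by (rule sum.swap)
        finally show ?thesis .
      qed
      \<comment> \<open>The largest total serves as squared radius for all blocks, and the
        contradiction appears at the index where it is attained.\<close>
      define s where "s = Max (P ` {..T})"
      have s_ge: "P i \<le> s" if "i \<le> T" for i using that by (auto simp: s_def)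
      have "s \<in> P ` {..T}" unfolding s_def by (intro Max_in) auto
      then obtain i0 where i0: "i0 \<le> T" "P i0 = s" by auto
      have "0 \<le> P 0" by (auto simp: P_def p_nn intro!: sum_nonneg)
      then have "0 \<le> s" using s_ge[of 0] by simp
      then have "q y \<le> s * R" using py s_ge by (intro homog) (auto intro: order_trans)
      then have "2 / pi * Qs \<le> s * R" using y(2) by simp
      then have "Qs \<le> \<kappa> * s" by (simp add: \<kappa>_def field_simps)
      with lt[OF i0(1)] i0(2) show False by simp
    qed
  qed
  then obtain l where l: "\<And>i. i \<le> T \<Longrightarrow> 0 \<le> l i" "(\<Sum>i\<le>T. l i) = 1"
    "\<And>d. d \<in> D \<Longrightarrow> (\<Sum>i\<le>T. l i * d i) \<le> 0" by blast
  show ?thesis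
  proof (intro exI[of _ "\<lambda>i. \<kappa> * l i"] conjI allI impI)
    show "0 \<le> \<kappa> * l i" if "i \<le> T" for i using l(1)[OF that] \<kappa> by simp
    show "(\<Sum>i\<le>T. \<kappa> * l i) = pi / 2 * R"
      unfolding sum_distrib_left[symmetric] l(2) by (simp add: \<kappa>_def)
    fix y
    have "(\<lambda>i. q y - \<kappa> * p i y) \<in> D" unfolding D_def
      by (intro CollectI exI[of _ "[y]"]) simp
    then have "(\<Sum>i\<le>T. l i * (q y - \<kappa> * p i y)) \<le> 0" by (rule l(3))
    moreover have "(\<Sum>i\<le>T. l i * (q y - \<kappa> * p i y)) = (\<Sum>i\<le>T. l i) * q y - (\<Sum>i\<le>T. \<kappa> * l i * p i y)"
      by (simp add: right_diff_distrib sum_subtractf sum_distrib_right mult.assoc mult.left_commute)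
    ultimately show "q y \<le> (\<Sum>i\<le>T. \<kappa> * l i * p i y)" using l(2) by simp
  qed
qed

subsection \<open>Inverses and quadratic forms\<close>

lemma minv_inverse:
  assumes A: "A \<in> carrier_mat n n" and d: "det A \<noteq> 0"
  shows "minv A \<in> carrier_mat n n" "A * minv A = 1\<^sub>m n" "minv A * A = 1\<^sub>m n"
proof -
  have "A \<in> Units (ring_mat TYPE(real) n ())" by (rule det_non_zero_imp_unit[OF A d])
  then obtain B where "mat_inverse A = Some B" using mat_inverse(1)[OF A, of "()"] by (cases "mat_inverse A") auto
  then show "minv A \<in> carrier_mat n n" "A * minv A = 1\<^sub>m n" "minv A * A = 1\<^sub>m n"
    using mat_inverse(2)[OF A, of B] by (auto simp: minv_def)
qed

lemma invertible_iff_det: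
  assumes A: "(A :: real mat) \<in> carrier_mat n n"
  shows "invertible_mat A \<longleftrightarrow> det A \<noteq> 0"
proof
  assume "invertible_mat A"
  then obtain B where B: "A * B = 1\<^sub>m n" "B * A = 1\<^sub>m (dim_row B)"
    using A by (auto simp: invertible_mat_def inverts_mat_def)
  have "B \<in> carrier_mat n n"
    using arg_cong[OF B(1), of dim_col] arg_cong[OF B(2), of dim_col] A by (intro carrier_matI) auto
  then have "det A * det B = 1" using det_mult[OF A, of B] B(1) by simp
  then show "det A \<noteq> 0" by auto
next
  assume "det A \<noteq> 0"
  from minv_inverse[OF A this] A show "invertible_mat A"
    by (auto simp: invertible_mat_def inverts_mat_def intro!: exI[of _ "minv A"])
qed

lemma minv_unique:
  assumes A: "A \<in> carrier_mat n n" and B: "B \<in> carrier_mat n n" and AB: "A * B = 1\<^sub>m n"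
  shows "det A \<noteq> 0" "minv A = B"
proof -
  have "det A * det B = 1" using det_mult[OF A B] AB by simp
  then show d: "det A \<noteq> 0" by auto
  note i = minv_inverse[OF A d]
  have "minv A = minv A * (A * B)" using AB i by simp
  also have "\<dots> = (minv A * A) * B" by (rule assoc_mult_mat[symmetric, OF i(1) A B])
  also have "\<dots> = B" using i B by simp
  finally show "minv A = B" .
qed

lemma minv_mult_vec:
  assumes A: "A \<in> carrier_mat n n" and d: "det A \<noteq> 0" and v: "v \<in> carrier_vec n"
  shows "A *\<^sub>v (minv A *\<^sub>v v) = v" "minv A *\<^sub>v (A *\<^sub>v v) = v"
  using minv_inverse[OF A d] A v
  by (simp_all flip: assoc_mult_mat_vec[of _ n n _ n])

definition qform :: "real mat \<Rightarrow> real vec \<Rightarrow> real" where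
  "qform M v = scalar_prod v (M *\<^sub>v v)"

lemma qform_sum:
  assumes "M \<in> carrier_mat n n" "v \<in> carrier_vec n"
  shows "qform M v = (\<Sum>i<n. \<Sum>j<n. M $$ (i, j) * (v $ i * v $ j))"
  using assms unfolding qform_def scalar_prod_def
  by (auto simp: sum_distrib_left mult_ac atLeast0LessThan scalar_prod_def intro!: sum.cong)

lemma posdef_carrierD:
  assumes "positive_definite M" "M \<in> carrier_mat n n"
  shows "M\<^sup>T = M" "\<And>v. v \<in> carrier_vec n \<Longrightarrow> v \<noteq> 0\<^sub>v n \<Longrightarrow> 0 < qform M v"
    "\<And>v. v \<in> carrier_vec n \<Longrightarrow> 0 \<le> qform M v" "det M \<noteq> 0"
proof -
  show "M\<^sup>T = M" and pos: "\<And>v. v \<in> carrier_vec n \<Longrightarrow> v \<noteq> 0\<^sub>v n \<Longrightarrow> 0 < qform M v"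
    using assms by (auto simp: positive_definite_def qform_def)
  show "0 \<le> qform M v" if "v \<in> carrier_vec n" for v
    using pos[OF that] assms(2) by (cases "v = 0\<^sub>v n") (auto simp: qform_def)
  show "det M \<noteq> 0"
  proof
    assume "det M = 0"
    then obtain v where "v \<in> carrier_vec n" "v \<noteq> 0\<^sub>v n" "M *\<^sub>v v = 0\<^sub>v n"
      using det_0_iff_vec_prod_zero[OF assms(2)] by auto
    with pos[of v] show False by (simp add: qform_def)
  qed
qed

lemma posdefI:
  assumes "M \<in> carrier_mat n n" "M\<^sup>T = M"
    "\<And>v. v \<in> carrier_vec n \<Longrightarrow> v \<noteq> 0\<^sub>v n \<Longrightarrow> 0 < qform M v"
  shows "positive_definite M"
  using assms by (auto simp: positive_definite_def qform_def)

lemma sym_scalar_prod: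
  assumes "(M :: real mat) \<in> carrier_mat n n" "M\<^sup>T = M" "x \<in> carrier_vec n" "y \<in> carrier_vec n"
  shows "(M *\<^sub>v x) \<bullet> y = x \<bullet> (M *\<^sub>v y)"
  using transpose_vec_mult_scalar[OF assms(1,4,3)] assms(2) by simp

lemma qform_add:
  assumes M: "M \<in> carrier_mat n n" "M\<^sup>T = M" and x: "x \<in> carrier_vec n" and y: "y \<in> carrier_vec n"
  shows "qform M (x + y) = qform M x + 2 * (x \<bullet> (M *\<^sub>v y)) + qform M y"
proof -
  have 1: "M *\<^sub>v x \<in> carrier_vec n" "M *\<^sub>v y \<in> carrier_vec n"
    using mult_mat_vec_carrier[OF M(1)] x y by auto
  have "y \<bullet> (M *\<^sub>v x) = x \<bullet> (M *\<^sub>v y)"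
    using sym_scalar_prod[OF M x y] comm_scalar_prod[OF y 1(1)] by simp
  then show ?thesis using M x y 1
    by (simp add: qform_def mult_add_distrib_mat_vec[of _ n n] scalar_prod_add_distrib[of _ n]
        add_scalar_prod_distrib[of _ n])
qed

lemma qform_smult:
  assumes "M \<in> carrier_mat n n" "x \<in> carrier_vec n"
  shows "qform M (c \<cdot>\<^sub>v x) = c\<^sup>2 * qform M x"
  using assms by (simp add: qform_def mult_mat_vec[of _ n n] power2_eq_square)

lemma qform_transform:
  assumes "M \<in> carrier_mat n n" "L \<in> carrier_mat n k" "x \<in> carrier_vec k"
  shows "qform (L\<^sup>T * M * L) x = qform M (L *\<^sub>v x)"
proof -
  have "qform (L\<^sup>T * M * L) x = x \<bullet> (L\<^sup>T *\<^sub>v (M *\<^sub>v (L *\<^sub>v x)))"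
  proof -
    have "(L\<^sup>T * M * L) *\<^sub>v x = (L\<^sup>T * M) *\<^sub>v (L *\<^sub>v x)"
      using assms by (intro assoc_mult_mat_vec[of _ k n _ k]) auto
    also have "\<dots> = L\<^sup>T *\<^sub>v (M *\<^sub>v (L *\<^sub>v x))"
      using assms by (intro assoc_mult_mat_vec[of _ k n _ n]) auto
    finally show ?thesis by (simp add: qform_def)
  qed
  also have "\<dots> = (L\<^sup>T *\<^sub>v (M *\<^sub>v (L *\<^sub>v x))) \<bullet> x"
    using assms by (intro comm_scalar_prod[of _ k]) auto
  also have "\<dots> = (M *\<^sub>v (L *\<^sub>v x)) \<bullet> (L *\<^sub>v x)"
    using assms by (intro transpose_vec_mult_scalar) auto
  also have "\<dots> = qform M (L *\<^sub>v x)" unfolding qform_def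
    using assms by (intro comm_scalar_prod[of _ n]) auto
  finally show ?thesis .
qed

lemma posdef_minv:
  assumes M: "M \<in> carrier_mat n n" "positive_definite M"
  shows "minv M \<in> carrier_mat n n" "(minv M)\<^sup>T = minv M" "positive_definite (minv M)"
proof -
  note p = posdef_carrierD[OF M(2,1)] and i = minv_inverse[OF M(1) posdef_carrierD(4)[OF M(2,1)]]
  show "minv M \<in> carrier_mat n n" by (rule i)
  have "M * (minv M)\<^sup>T = (minv M * M)\<^sup>T"
    using transpose_mult[OF i(1) M(1)] p(1) by simp
  also have "\<dots> = 1\<^sub>m n" using i by simp
  finally show s: "(minv M)\<^sup>T = minv M" using minv_unique(2)[OF M(1), of "(minv M)\<^sup>T"] i by simp
  show "positive_definite (minv M)"
  proof (rule posdefI[OF i(1) s])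
    fix v :: "real vec" assume v: "v \<in> carrier_vec n" "v \<noteq> 0\<^sub>v n"
    let ?y = "minv M *\<^sub>v v"
    have y: "?y \<in> carrier_vec n" "M *\<^sub>v ?y = v"
      using i v minv_mult_vec[OF M(1) p(4) v(1)] by auto
    have "M *\<^sub>v 0\<^sub>v n = 0\<^sub>v n" using M by auto
    with y v have "?y \<noteq> 0\<^sub>v n" by metis
    then have "0 < qform M ?y" by (rule p(2)[OF y(1)])
    also have "\<dots> = qform (minv M) v"
      unfolding qform_def y(2) using y v by (intro comm_scalar_prod[of _ n]) auto
    finally show "0 < qform (minv M) v" .
  qed
qed

text \<open>Cauchy-Schwarz in the inner product of \<open>M\<close>, between \<open>v\<close> and
  \<open>minv M\<close> applied to a unit vector, read off a nonnegative quadratic in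
  \<open>c\<close>. In this way the regret controls the coordinates of an input deviation.\<close>

lemma posdef_coord_bound:
  assumes M: "M \<in> carrier_mat n n" "positive_definite M" and v: "v \<in> carrier_vec n" and i: "i < n"
  shows "(v $ i)\<^sup>2 \<le> minv M $$ (i, i) * qform M v"
proof -
  note p = posdef_carrierD[OF M(2,1)] and m = posdef_minv[OF M]
  let ?e = "unit_vec n i" let ?z = "minv M *\<^sub>v ?e"
  have z: "?z \<in> carrier_vec n" "M *\<^sub>v ?z = ?e" using m minv_mult_vec[OF M(1) p(4), of ?e] by auto
  define a where "a = minv M $$ (i, i)"
  have za: "?z \<bullet> ?e = a" using i m by (simp add: a_def)
  have vz: "v \<bullet> (M *\<^sub>v ?z) = v $ i" using z v i by simp
  have "0 \<le> qform M (v + c \<cdot>\<^sub>v ?z)" for c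
    using v z by (intro p(3)) auto
  moreover have "qform M (v + c \<cdot>\<^sub>v ?z) = qform M v + 2 * c * v $ i + c\<^sup>2 * a" for c
  proof -
    have "qform M ?z = a" by (simp only: qform_def z(2) za)
    moreover have "v \<bullet> (M *\<^sub>v (c \<cdot>\<^sub>v ?z)) = c * v $ i"
      using M z(1) v vz by (simp add: mult_mat_vec[of _ n n])
    ultimately show ?thesis using z v
      by (simp add: qform_add[OF M(1) p(1)] qform_smult[OF M(1)])
  qed
  ultimately have ge: "0 \<le> qform M v + 2 * c * v $ i + c\<^sup>2 * a" for c by metis
  have a: "0 < a"
  proof -
    have "?e \<noteq> 0\<^sub>v n" using i by (metis index_unit_vec(1) index_zero_vec(1) zero_neq_one)
    then have "0 < qform (minv M) ?e" by (intro posdef_carrierD(2)[OF m(3,1)]) auto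
    also have "\<dots> = a" using za m unfolding qform_def by (subst comm_scalar_prod[of _ n]) auto
    finally show ?thesis .
  qed
  \<comment> \<open>\<open>- (v $ i) / a\<close> is the minimizer of the quadratic.\<close>
  have "0 \<le> qform M v - (v $ i)\<^sup>2 / a"
    using ge[of "- (v $ i) / a"] a by (simp add: power2_eq_square field_simps)
  then show ?thesis using a by (simp add: a_def[symmetric] field_simps)
qed

text \<open>Serves twice, with the two weights exchanged: for the matrix inverted inside
  \<open>Omat\<close> and for the quadratic part of the cost in the input.\<close>

lemma posdef_add_congruence:
  assumes M: "M \<in> carrier_mat n n" "positive_definite M"
    and N: "N \<in> carrier_mat k k" "positive_definite N" and L: "L \<in> carrier_mat n k"
  shows "positive_definite (M + L * N * L\<^sup>T)"
proof (rule posdefI)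
  note pM = posdef_carrierD[OF M(2,1)] and pN = posdef_carrierD[OF N(2,1)]
  have LNL: "L * N * L\<^sup>T \<in> carrier_mat n n" using L N by auto
  show "M + L * N * L\<^sup>T \<in> carrier_mat n n" using LNL M by auto
  have "(L * N * L\<^sup>T)\<^sup>T = L * (N\<^sup>T * L\<^sup>T)"
    using transpose_mult[of "L * N" n k "L\<^sup>T" n] transpose_mult[OF L N(1)] L N by simp
  also have "\<dots> = L * N * L\<^sup>T" using L N pN by simp
  finally show "(M + L * N * L\<^sup>T)\<^sup>T = M + L * N * L\<^sup>T"
    using pM M LNL by (simp add: transpose_add[of _ n n])
  fix v :: "real vec" assume v: "v \<in> carrier_vec n" "v \<noteq> 0\<^sub>v n"
  have "qform (M + L * N * L\<^sup>T) v = qform M v + qform (L * N * L\<^sup>T) v"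
    unfolding qform_def using v M LNL
    by (simp add: add_mult_distrib_mat_vec[of _ n n] scalar_prod_add_distrib[of _ n])
  also have "qform (L * N * L\<^sup>T) v = qform N (L\<^sup>T *\<^sub>v v)"
    using qform_transform[OF N(1), of "L\<^sup>T" n v] L v by simp
  finally show "0 < qform (M + L * N * L\<^sup>T) v"
    using pM(2)[OF v] pN(3)[of "L\<^sup>T *\<^sub>v v"] L v by auto
qed

subsection \<open>Cholesky coordinates\<close>

text \<open>Elimination of the last variable: \<open>P'\<close> is the Schur complement of the pivot
  \<open>P n n\<close>, and completing the square in \<open>y n\<close> leaves the form of
  \<open>P'\<close> plus one square.\<close>

lemma cholesky_form:
  fixes P :: "nat \<Rightarrow> nat \<Rightarrow> real"
  assumes "\<And>i j. P i j = P j i"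
    and "\<And>y. \<exists>i<n. y i \<noteq> 0 \<Longrightarrow> 0 < (\<Sum>i<n. \<Sum>j<n. P i j * (y i * y j))"
  shows "\<exists>L. \<forall>y. (\<Sum>i<n. \<Sum>j<n. P i j * (y i * y j)) = (\<Sum>k<n. (\<Sum>i<n. L k i * y i)\<^sup>2)"
  using assms
proof (induction n arbitrary: P)
  case 0
  then show ?case by simp
next
  case (Suc n)
  define p where "p = P n n"
  have "0 < (\<Sum>i<Suc n. \<Sum>j<Suc n. P i j * ((if i = n then 1 else 0) * (if j = n then 1 else 0)))"
    by (rule Suc.prems(2)) (auto intro!: exI[of _ n])
  then have p: "0 < p" by (simp add: p_def)
  define P' where "P' i j = P i j - P i n * P j n / p" for i j
  have split: "(\<Sum>i<Suc n. \<Sum>j<Suc n. P i j * (y i * y j)) =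
      (\<Sum>i<n. \<Sum>j<n. P' i j * (y i * y j)) + ((\<Sum>i<n. P i n * y i) + p * y n)\<^sup>2 / p" for y
  proof -
    define s where "s = (\<Sum>i<n. P i n * y i)"
    have "(\<Sum>i<Suc n. \<Sum>j<Suc n. P i j * (y i * y j)) =
        (\<Sum>i<n. \<Sum>j<n. P i j * (y i * y j)) + 2 * y n * s + p * (y n)\<^sup>2"
    proof -
      have "(\<Sum>i<n. P i n * (y i * y n)) = y n * s"
        unfolding s_def sum_distrib_left by (rule sum.cong) auto
      moreover have "(\<Sum>j<n. P n j * (y n * y j)) = y n * s"
        unfolding s_def sum_distrib_left Suc.prems(1)[of n] by (rule sum.cong) auto
      ultimately show ?thesis
        by (simp add: p_def sum.distrib power2_eq_square)
    qed
    moreover have "(\<Sum>i<n. \<Sum>j<n. P' i j * (y i * y j)) = (\<Sum>i<n. \<Sum>j<n. P i j * (y i * y j)) - s\<^sup>2 / p"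
    proof -
      have "s\<^sup>2 / p = (\<Sum>i<n. \<Sum>j<n. P i n * P j n / p * (y i * y j))"
        unfolding s_def power2_eq_square sum_product sum_divide_distrib
        by (intro sum.cong refl) simp
      then show ?thesis by (simp add: P'_def left_diff_distrib sum_subtractf)
    qed
    ultimately show ?thesis unfolding s_def[symmetric] using p
      by (simp add: power2_eq_square field_simps)
  qed
  have "\<exists>L. \<forall>y. (\<Sum>i<n. \<Sum>j<n. P' i j * (y i * y j)) = (\<Sum>k<n. (\<Sum>i<n. L k i * y i)\<^sup>2)"
  proof (rule Suc.IH)
    show "P' i j = P' j i" for i j
      using Suc.prems(1)[of i j] by (simp add: P'_def mult.commute)
    fix y :: "nat \<Rightarrow> real" assume "\<exists>i<n. y i \<noteq> 0"
    then obtain i where i: "i < n" "y i \<noteq> 0" by blast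
    \<comment> \<open>The last coordinate makes the completed square vanish, which transfers
      positivity from \<open>P\<close> to \<open>P'\<close>.\<close>
    define z where "z = y(n := - (\<Sum>i<n. P i n * y i) / p)"
    have "0 < (\<Sum>i<Suc n. \<Sum>j<Suc n. P i j * (z i * z j))"
      using i by (intro Suc.prems(2)) (auto simp: z_def intro!: exI[of _ i])
    then show "0 < (\<Sum>i<n. \<Sum>j<n. P' i j * (y i * y j))"
      unfolding split using p by (simp add: z_def)
  qed
  then obtain L where L: "\<And>y. (\<Sum>i<n. \<Sum>j<n. P' i j * (y i * y j)) = (\<Sum>k<n. (\<Sum>i<n. L k i * y i)\<^sup>2)"
    by blast
  define L' where "L' k i = (if k < n then if i < n then L k i else 0 else if i < n then P i n / sqrt p else sqrt p)" for k i
  show ?case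
  proof (intro exI[of _ L'] allI)
    fix y :: "nat \<Rightarrow> real"
    have "(\<Sum>i<n. P i n * y i) + p * y n = sqrt p * ((\<Sum>i<n. P i n / sqrt p * y i) + sqrt p * y n)"
      using p by (simp add: distrib_left sum_distrib_left mult.assoc[symmetric])
    then have "((\<Sum>i<n. P i n * y i) + p * y n)\<^sup>2 / p = ((\<Sum>i<n. P i n / sqrt p * y i) + sqrt p * y n)\<^sup>2"
      using p by (simp add: power_mult_distrib)
    then show "(\<Sum>i<Suc n. \<Sum>j<Suc n. P i j * (y i * y j)) = (\<Sum>k<Suc n. (\<Sum>i<Suc n. L' k i * y i)\<^sup>2)"
      unfolding split L by (simp add: L'_def)
  qed
qed

text \<open>\<open>V\<close> is the inverse of the Cholesky factor \<open>M\<close>. The latter is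
  invertible because \<open>qform P\<close> would vanish on a kernel vector.\<close>

lemma posdef_orthonormal_coordinates:
  assumes P: "P \<in> carrier_mat n n" "positive_definite P"
  shows "\<exists>V \<in> carrier_mat n n. det V \<noteq> 0 \<and> (\<forall>z \<in> carrier_vec n. qform P (V *\<^sub>v z) = (\<Sum>k<n. (z $ k)\<^sup>2))"
proof -
  note p = posdef_carrierD[OF P(2,1)]
  have sum: "(\<Sum>i<n. \<Sum>j<n. P $$ (i, j) * (y i * y j)) = qform P (vec n y)" for y
    using P by (subst qform_sum) auto
  \<comment> \<open>Cut off outside the dimension, since \<open>cholesky_form\<close> asks for
    symmetry at all indices.\<close>
  define P' where "P' i j = (if i < n \<and> j < n then P $$ (i, j) else 0)" for i j
  have P': "(\<Sum>i<n. \<Sum>j<n. P' i j * (y i * y j)) = qform P (vec n y)" for y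
    unfolding sum[symmetric] by (intro sum.cong refl) (auto simp: P'_def)
  have "\<exists>L. \<forall>y. (\<Sum>i<n. \<Sum>j<n. P' i j * (y i * y j)) = (\<Sum>k<n. (\<Sum>i<n. L k i * y i)\<^sup>2)"
  proof (rule cholesky_form)
    fix i j show "P' i j = P' j i"
      using p(1) P(1) by (auto simp: P'_def) (metis carrier_matD index_transpose_mat(1))
  next
    fix y :: "nat \<Rightarrow> real" assume "\<exists>i<n. y i \<noteq> 0"
    then have "vec n y \<noteq> 0\<^sub>v n" by (metis index_vec index_zero_vec(1))
    then show "0 < (\<Sum>i<n. \<Sum>j<n. P' i j * (y i * y j))" unfolding P' by (intro p) auto
  qed
  then obtain L where L: "\<And>y. qform P (vec n y) = (\<Sum>k<n. (\<Sum>i<n. L k i * y i)\<^sup>2)"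
    unfolding P' by blast
  define M where "M = Matrix.mat n n (\<lambda>(k, i). L k i)"
  have M: "M \<in> carrier_mat n n" by (simp add: M_def)
  have qM: "qform P v = (\<Sum>k<n. ((M *\<^sub>v v) $ k)\<^sup>2)" if "v \<in> carrier_vec n" for v
  proof -
    have "v = vec n (\<lambda>i. v $ i)" using that by auto
    then have "qform P v = (\<Sum>k<n. (\<Sum>i<n. L k i * v $ i)\<^sup>2)" using L by metis
    also have "\<dots> = (\<Sum>k<n. ((M *\<^sub>v v) $ k)\<^sup>2)"
      using that by (intro sum.cong) (auto simp: M_def scalar_prod_def atLeast0LessThan)
    finally show ?thesis .
  qed
  have d: "det M \<noteq> 0"
  proof
    assume "det M = 0"
    then obtain v where v: "v \<in> carrier_vec n" "v \<noteq> 0\<^sub>v n" "M *\<^sub>v v = 0\<^sub>v n"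
      using det_0_iff_vec_prod_zero[OF M] by auto
    then have "qform P v = 0" using qM[OF v(1)] by simp
    with p(2)[OF v(1,2)] show False by simp
  qed
  note i = minv_inverse[OF M d]
  have "det (minv M) \<noteq> 0" using minv_unique(1)[OF i(1) M i(3)] .
  then show ?thesis using i qM minv_mult_vec[OF M d] by (intro bexI[of _ "minv M"]) auto
qed

subsection \<open>Block structure\<close>

lemma div_mod_block:
  fixes p :: nat
  assumes "i < p"
  shows "(k * p + i) div p = k" "(k * p + i) mod p = i"
  using assms by (simp_all add: div_mult_self3)

lemma block_index_less:
  fixes p :: nat
  assumes "k < K" "i < p"
  shows "k * p + i < p * K"
proof -
  have "k * p + i < Suc k * p" using assms by simp
  also have "\<dots> \<le> K * p" using assms by (intro mult_right_mono) auto
  finally show ?thesis by (simp add: mult.commute)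
qed

lemma div_less_of_less_mult:
  fixes i p :: nat
  assumes "i < p * K"
  shows "i div p < K" "i mod p < p"
  using assms less_mult_imp_div_less[of i K p] by (auto simp: mult.commute) (metis mod_less_divisor mult_0_right not_gr_zero not_less_zero)

text \<open>For blocks of equal size the position of an entry is read off by \<open>div\<close> and
  \<open>mod\<close>, the addressing that \<open>block_lower_triangular\<close> uses too.\<close>

lemma diag_block_mat_map:
  assumes "\<And>k. k < K \<Longrightarrow> M k \<in> carrier_mat p q"
  shows "diag_block_mat (map M [0..<K]) = Matrix.mat (p * K) (q * K)
    (\<lambda>(i, j). if i div p = j div q then M (i div p) $$ (i mod p, j mod q) else 0)"
  using assms
proof (induction K)
  case 0
  then show ?case by auto
next
  case (Suc K)
  have IH: "diag_block_mat (map M [0..<K]) = Matrix.mat (p * K) (q * K)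
    (\<lambda>(i, j). if i div p = j div q then M (i div p) $$ (i mod p, j mod q) else 0)" (is "_ = ?B")
    using Suc.prems by (intro Suc.IH) auto
  have MK: "M K \<in> carrier_mat p q" using Suc.prems by auto
  have hi: "i div r = K \<and> i mod r = i - r * K" if "\<not> i < r * K" "i < r * Suc K" for i r :: nat
  proof -
    have "i div r = K" using that by (intro div_nat_eqI) auto
    then show ?thesis using minus_mult_div_eq_mod[of i r] by simp
  qed
  have lo: "i div r < K" if "i < r * K" for i r :: nat using div_less_of_less_mult[OF that] by simp
  have "diag_block_mat (map M [0..<Suc K]) = four_block_mat ?B (0\<^sub>m (p * K) q) (0\<^sub>m p (q * K)) (M K)"
    using MK by (simp add: diag_block_mat_last IH Let_def)
  also have "\<dots> = Matrix.mat (p * Suc K) (q * Suc K)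
    (\<lambda>(i, j). if i div p = j div q then M (i div p) $$ (i mod p, j mod q) else 0)"
  proof (rule eq_matI)
    fix i j assume "i < dim_row (Matrix.mat (p * Suc K) (q * Suc K)
      (\<lambda>(i, j). if i div p = j div q then M (i div p) $$ (i mod p, j mod q) else 0))"
      "j < dim_col (Matrix.mat (p * Suc K) (q * Suc K)
      (\<lambda>(i, j). if i div p = j div q then M (i div p) $$ (i mod p, j mod q) else 0))"
    then have ij: "i < p * Suc K" "j < q * Suc K" by auto
    show "four_block_mat ?B (0\<^sub>m (p * K) q) (0\<^sub>m p (q * K)) (M K) $$ (i, j) =
      Matrix.mat (p * Suc K) (q * Suc K)
      (\<lambda>(i, j). if i div p = j div q then M (i div p) $$ (i mod p, j mod q) else 0) $$ (i, j)"
      using ij MK hi[of i p] hi[of j q] lo[of i p] lo[of j q]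
      by (cases "i < p * K"; cases "j < q * K") (auto simp: four_block_mat_def Let_def)
  qed (use MK in auto)
  finally show ?case .
qed

lemma diag_block_mat_map_carrier [intro]:
  assumes "\<And>k. k < K \<Longrightarrow> M k \<in> carrier_mat p q"
  shows "diag_block_mat (map M [0..<K]) \<in> carrier_mat (p * K) (q * K)"
  by (subst diag_block_mat_map[OF assms]) auto

lemma sum_single_block:
  fixes f :: "nat \<Rightarrow> real"
  assumes "k < K"
  shows "(\<Sum>j<q * K. if k = j div q then f j else 0) = (\<Sum>c<q. f (k * q + c))"
proof -
  have "(\<Sum>j<q * K. if k = j div q then f j else 0) = (\<Sum>j\<in>(\<lambda>c. k * q + c) ` {..<q}. f j)"
  proof (rule sum.mono_neutral_cong_right)
    show "(\<lambda>c. k * q + c) ` {..<q} \<subseteq> {..<q * K}" using block_index_less[OF assms] by auto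
    show "\<forall>i\<in>{..<q * K} - (\<lambda>c. k * q + c) ` {..<q}. (if k = i div q then f i else 0) = 0"
    proof (intro ballI)
      fix i assume i: "i \<in> {..<q * K} - (\<lambda>c. k * q + c) ` {..<q}"
      then have "i mod q < q" using div_less_of_less_mult[of i q K] by auto
      moreover have "i = i div q * q + i mod q" by simp
      ultimately show "(if k = i div q then f i else 0) = 0" using i by force
    qed
  qed (auto simp: div_mod_block)
  also have "\<dots> = (\<Sum>c<q. f (k * q + c))" by (subst sum.reindex) (auto simp: inj_on_def)
  finally show ?thesis .
qed

lemma vblock_carrier [simp]: "vblock p k v \<in> carrier_vec p" "dim_vec (vblock p k v) = p"
  by (auto simp: vblock_def)

lemma vblock_index: "i < p \<Longrightarrow> vblock p k v $ i = v $ (k * p + i)"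
  by (simp add: vblock_def)

lemma vblock_eqI:
  assumes "v \<in> carrier_vec (p * K)" "w \<in> carrier_vec (p * K)" "\<And>k. k < K \<Longrightarrow> vblock p k v = vblock p k w"
  shows "v = w"
proof (rule eq_vecI)
  fix i assume "i < dim_vec w"
  then have i: "i < p * K" using assms by auto
  note d = div_less_of_less_mult[OF i]
  have "vblock p (i div p) v $ (i mod p) = vblock p (i div p) w $ (i mod p)"
    using assms(3)[OF d(1)] by simp
  then show "v $ i = w $ i" using d by (simp add: vblock_index)
qed (use assms in auto)

lemma vblock_zero: "k < K \<Longrightarrow> vblock p k (0\<^sub>v (p * K)) = 0\<^sub>v p"
  using block_index_less[of k K] by (intro eq_vecI) (auto simp: vblock_def)

lemma vblock_add:
  assumes "v \<in> carrier_vec (p * K)" "w \<in> carrier_vec (p * K)" "k < K"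
  shows "vblock p k (v + w) = vblock p k v + vblock p k w"
    "vblock p k (v - w) = vblock p k v - vblock p k w"
  using assms block_index_less[OF assms(3)] by (auto simp: vblock_def)

lemma vblock_smult:
  assumes "v \<in> carrier_vec (p * K)" "k < K"
  shows "vblock p k (c \<cdot>\<^sub>v v) = c \<cdot>\<^sub>v vblock p k v"
  using assms block_index_less[OF assms(2)] by (auto simp: vblock_def)

lemma vblock_diag_mult:
  assumes M: "\<And>k. k < K \<Longrightarrow> M k \<in> carrier_mat p q" and v: "v \<in> carrier_vec (q * K)" and k: "k < K"
  shows "vblock p k (diag_block_mat (map M [0..<K]) *\<^sub>v v) = M k *\<^sub>v vblock q k v"
proof (rule eq_vecI)
  let ?D = "diag_block_mat (map M [0..<K])"
  have D: "?D \<in> carrier_mat (p * K) (q * K)" using M by auto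
  fix i assume "i < dim_vec (M k *\<^sub>v vblock q k v)"
  then have i: "i < p" using M[OF k] by auto
  note ki = block_index_less[OF k i]
  have "vblock p k (?D *\<^sub>v v) $ i = (\<Sum>j<q * K. ?D $$ (k * p + i, j) * v $ j)"
    using i ki D v by (auto simp: vblock_index scalar_prod_def atLeast0LessThan)
  also have "\<dots> = (\<Sum>j<q * K. if k = j div q then M k $$ (i, j mod q) * v $ j else 0)"
    using ki i by (intro sum.cong) (auto simp: diag_block_mat_map[of K M p q, OF M] div_mod_block)
  also have "\<dots> = (\<Sum>c<q. M k $$ (i, c) * v $ (k * q + c))"
    by (subst sum_single_block[OF k]) (auto simp: div_mod_block)
  also have "\<dots> = (M k *\<^sub>v vblock q k v) $ i"
    using M[OF k] i by (auto simp: scalar_prod_def vblock_index atLeast0LessThan)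
  finally show "vblock p k (?D *\<^sub>v v) $ i = (M k *\<^sub>v vblock q k v) $ i" .
qed (use M[OF k] in auto)

lemma scalar_prod_vblock:
  assumes "v \<in> carrier_vec (p * K)" "w \<in> carrier_vec (p * K)"
  shows "v \<bullet> w = (\<Sum>k<K. vblock p k v \<bullet> vblock p k w)"
proof -
  have "v \<bullet> w = (\<Sum>i<K * p. v $ i * w $ i)"
    using assms by (simp add: scalar_prod_def atLeast0LessThan mult.commute)
  also have "\<dots> = (\<Sum>k<K. \<Sum>i\<in>{k * p..<k * p + p}. v $ i * w $ i)"
    by (rule sum.nat_group[symmetric])
  also have "\<dots> = (\<Sum>k<K. vblock p k v \<bullet> vblock p k w)"
  proof (rule sum.cong[OF refl])
    fix k
    have "(\<Sum>i\<in>{k * p..<k * p + p}. v $ i * w $ i) = (\<Sum>c<p. v $ (k * p + c) * w $ (k * p + c))"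
      using sum.shift_bounds_nat_ivl[of "\<lambda>i. v $ i * w $ i" 0 "k * p" p]
      by (simp add: atLeast0LessThan add.commute)
    then show "(\<Sum>i\<in>{k * p..<k * p + p}. v $ i * w $ i) = vblock p k v \<bullet> vblock p k w"
      by (simp add: scalar_prod_def vblock_index atLeast0LessThan)
  qed
  finally show ?thesis .
qed

lemma qform_diag_block:
  assumes M: "\<And>k. k < K \<Longrightarrow> M k \<in> carrier_mat p p" and v: "v \<in> carrier_vec (p * K)"
  shows "qform (diag_block_mat (map M [0..<K])) v = (\<Sum>k<K. qform (M k) (vblock p k v))"
proof -
  have "diag_block_mat (map M [0..<K]) *\<^sub>v v \<in> carrier_vec (p * K)"
    by (rule mult_mat_vec_carrier[OF diag_block_mat_map_carrier v]) (rule M)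
  then show ?thesis unfolding qform_def
    using v by (subst scalar_prod_vblock) (auto simp: vblock_diag_mult[of K M p p v, OF M v])
qed

lemma posdef_diag_block:
  assumes M: "\<And>k. k < K \<Longrightarrow> M k \<in> carrier_mat p p" "\<And>k. k < K \<Longrightarrow> positive_definite (M k)"
  shows "positive_definite (diag_block_mat (map M [0..<K]))"
proof (rule posdefI)
  show D: "diag_block_mat (map M [0..<K]) \<in> carrier_mat (p * K) (p * K)" using M by auto
  have eq: "diag_block_mat (map M [0..<K]) = Matrix.mat (p * K) (p * K)
    (\<lambda>(i, j). if i div p = j div p then M (i div p) $$ (i mod p, j mod p) else 0)"
    by (rule diag_block_mat_map) (rule M(1))
  show "(diag_block_mat (map M [0..<K]))\<^sup>T = diag_block_mat (map M [0..<K])"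
  proof (rule eq_matI)
    fix i j assume "i < dim_row (diag_block_mat (map M [0..<K]))" "j < dim_col (diag_block_mat (map M [0..<K]))"
    then have ij: "i < p * K" "j < p * K" using D by auto
    note di = div_less_of_less_mult[OF ij(1)] and dj = div_less_of_less_mult[OF ij(2)]
    have "M (i div p) $$ (j mod p, i mod p) = (M (i div p))\<^sup>T $$ (i mod p, j mod p)"
      using M(1)[OF di(1)] di dj by simp
    also have "(M (i div p))\<^sup>T = M (i div p)"
      by (rule posdef_carrierD(1)[OF M(2)[OF di(1)] M(1)[OF di(1)]])
    finally have "M (i div p) $$ (j mod p, i mod p) = M (i div p) $$ (i mod p, j mod p)" .
    note sym = this
    have "(diag_block_mat (map M [0..<K]))\<^sup>T $$ (i, j) = diag_block_mat (map M [0..<K]) $$ (j, i)"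
      using D ij by simp
    also have "\<dots> = (if j div p = i div p then M (j div p) $$ (j mod p, i mod p) else 0)"
      unfolding eq using ij by simp
    also have "\<dots> = (if i div p = j div p then M (i div p) $$ (i mod p, j mod p) else 0)"
    proof -
      have "(if b = a then M b $$ (d, c) else 0) = (if a = b then M a $$ (c, d) else 0)"
        if "M a $$ (d, c) = M a $$ (c, d)" for a b c d
        using that by auto
      from this[OF sym] show ?thesis .
    qed
    also have "\<dots> = diag_block_mat (map M [0..<K]) $$ (i, j)"
      unfolding eq using ij by simp
    finally show "(diag_block_mat (map M [0..<K]))\<^sup>T $$ (i, j) = diag_block_mat (map M [0..<K]) $$ (i, j)" .
  qed (use D in auto)
  fix v :: "real vec" assume v: "v \<in> carrier_vec (p * K)" "v \<noteq> 0\<^sub>v (p * K)"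
  have "\<exists>k<K. vblock p k v \<noteq> 0\<^sub>v p"
  proof (rule ccontr)
    assume "\<not> ?thesis"
    then have nz: "vblock p k v = 0\<^sub>v p" if "k < K" for k using that by blast
    have "v = 0\<^sub>v (p * K)"
    proof (rule vblock_eqI[OF v(1) zero_carrier_vec])
      fix k assume k: "k < K"
      show "vblock p k v = vblock p k (0\<^sub>v (p * K))" unfolding vblock_zero[OF k] by (rule nz[OF k])
    qed
    with v show False by simp
  qed
  then obtain k where k: "k < K" "vblock p k v \<noteq> 0\<^sub>v p" by blast
  have "0 < (\<Sum>k<K. qform (M k) (vblock p k v))"
  proof (rule sum_pos2[of _ k])
    show "0 < qform (M k) (vblock p k v)"
      by (rule posdef_carrierD(2)[OF M(2)[OF k(1)] M(1)[OF k(1)] vblock_carrier(1) k(2)])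
    show "0 \<le> qform (M j) (vblock p j v)" if "j \<in> {..<K}" for j
      using that posdef_carrierD(3)[OF M(2) M(1) vblock_carrier(1), of j j] by simp
  qed (use k in auto)
  then show "0 < qform (diag_block_mat (map M [0..<K])) v"
    using qform_diag_block[of K M p v, OF M(1) v(1)] by simp
qed

section \<open>Block triangular matrices and their inverses\<close>

definition block_strictly_lower :: "nat \<Rightarrow> nat \<Rightarrow> real mat \<Rightarrow> bool" where
  "block_strictly_lower p q M \<longleftrightarrow>
     (\<forall>i < dim_row M. \<forall>j < dim_col M. i div p \<le> j div q \<longrightarrow> M $$ (i, j) = 0)"

lemma block_strictly_lower_imp_lower: "block_strictly_lower p q M \<Longrightarrow> block_lower_triangular p q M"
  by (auto simp: block_strictly_lower_def block_lower_triangular_def)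

lemma mat_mult_index_sum:
  assumes "A \<in> carrier_mat a b" "B \<in> carrier_mat b c" "i < a" "j < c"
  shows "(A * B) $$ (i, j) = (\<Sum>l<b. A $$ (i, l) * B $$ (l, j))"
  using assms by (auto simp: scalar_prod_def atLeast0LessThan)

text \<open>A nonzero term of the product needs an inner block index between those of the row and
  the column. One strict factor makes the product strict: a delay survives composition with causal
  maps.\<close>

lemma block_lower_mult:
  fixes A B :: "real mat"
  assumes A: "A \<in> carrier_mat a b" and B: "B \<in> carrier_mat b c"
  shows "block_lower_triangular p q A \<Longrightarrow> block_lower_triangular q r B \<Longrightarrow> block_lower_triangular p r (A * B)"
    and "block_strictly_lower p q A \<Longrightarrow> block_lower_triangular q r B \<Longrightarrow> block_strictly_lower p r (A * B)"
    and "block_lower_triangular p q A \<Longrightarrow> block_strictly_lower q r B \<Longrightarrow> block_strictly_lower p r (A * B)"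
proof -
  have *: "(A * B) $$ (i, j) = 0" if "i < a" "j < c" "\<And>l. l < b \<Longrightarrow> A $$ (i, l) = 0 \<or> B $$ (l, j) = 0" for i j
    unfolding mat_mult_index_sum[OF A B that(1,2)] using that(3) by (intro sum.neutral) auto
  have d: "dim_row A = a" "dim_col A = b" "dim_row B = b" "dim_col B = c" using A B by auto
  show "block_lower_triangular p r (A * B)" if 1: "block_lower_triangular p q A" and 2: "block_lower_triangular q r B"
    unfolding block_lower_triangular_def
  proof (intro allI impI)
    fix i j assume ij: "i < dim_row (A * B)" "j < dim_col (A * B)" "i div p < j div r"
    show "(A * B) $$ (i, j) = 0"
    proof (rule *)
      fix l assume l: "l < b"
      have "i div p < l div q \<or> l div q < j div r" using ij(3) by linarith
      then show "A $$ (i, l) = 0 \<or> B $$ (l, j) = 0"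
        using 1 2 ij l d unfolding block_lower_triangular_def by auto
    qed (use ij d in auto)
  qed
  show "block_strictly_lower p r (A * B)" if 1: "block_strictly_lower p q A" and 2: "block_lower_triangular q r B"
    unfolding block_strictly_lower_def
  proof (intro allI impI)
    fix i j assume ij: "i < dim_row (A * B)" "j < dim_col (A * B)" "i div p \<le> j div r"
    show "(A * B) $$ (i, j) = 0"
    proof (rule *)
      fix l assume l: "l < b"
      have "i div p \<le> l div q \<or> l div q < j div r" using ij(3) by linarith
      then show "A $$ (i, l) = 0 \<or> B $$ (l, j) = 0"
        using 1 2 ij l d unfolding block_lower_triangular_def block_strictly_lower_def by auto
    qed (use ij d in auto)
  qed
  show "block_strictly_lower p r (A * B)" if 1: "block_lower_triangular p q A" and 2: "block_strictly_lower q r B"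
    unfolding block_strictly_lower_def
  proof (intro allI impI)
    fix i j assume ij: "i < dim_row (A * B)" "j < dim_col (A * B)" "i div p \<le> j div r"
    show "(A * B) $$ (i, j) = 0"
    proof (rule *)
      fix l assume l: "l < b"
      have "i div p < l div q \<or> l div q \<le> j div r" using ij(3) by linarith
      then show "A $$ (i, l) = 0 \<or> B $$ (l, j) = 0"
        using 1 2 ij l d unfolding block_lower_triangular_def block_strictly_lower_def by auto
    qed (use ij d in auto)
  qed
qed

lemma block_lower_add:
  assumes "A \<in> carrier_mat a b" "B \<in> carrier_mat a b" "block_lower_triangular p q A" "block_lower_triangular p q B"
  shows "block_lower_triangular p q (A + B)" "block_lower_triangular p q (A - B)"
  using assms by (auto simp: block_lower_triangular_def)

lemma block_lower_smult:
  assumes "block_lower_triangular p q A"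
  shows "block_lower_triangular p q (c \<cdot>\<^sub>m A)"
  using assms by (auto simp: block_lower_triangular_def)

lemma block_lower_one: "block_lower_triangular p p (1\<^sub>m k)"
  by (auto simp: block_lower_triangular_def)

lemma block_lower_diag:
  assumes "\<And>k. k < K \<Longrightarrow> M k \<in> carrier_mat p q"
  shows "block_lower_triangular p q (diag_block_mat (map M [0..<K]))"
  by (subst diag_block_mat_map[OF assms]) (auto simp: block_lower_triangular_def)

text \<open>Since \<open>div\<close> is monotone, \<open>N\<close> is strictly lower triangular
  entry by entry, and \<open>1 - N\<close> has determinant 1. Its inverse satisfies
  \<open>Y = 1 + N * Y\<close>, where a row of \<open>Y\<close> is computed from rows in earlier
  blocks; this gives triangularity by induction on the row. The feedback loops below are well-posed
  for this reason.\<close>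

lemma block_unit_lower_inverse:
  assumes N: "N \<in> carrier_mat n n" "block_strictly_lower p p N"
  shows "det (1\<^sub>m n - N) \<noteq> 0" "block_lower_triangular p p (minv (1\<^sub>m n - N))"
proof -
  have I: "1\<^sub>m n - N \<in> carrier_mat n n" using N by auto
  have up: "N $$ (i, j) = 0" if "i \<le> j" "j < n" for i j
    using N that div_le_mono[OF that(1), of p] unfolding block_strictly_lower_def by auto
  have "det (1\<^sub>m n - N) = prod_list (diag_mat (1\<^sub>m n - N))"
    using N up by (intro det_lower_triangular[OF _ I]) auto
  also have "diag_mat (1\<^sub>m n - N) = map (\<lambda>_. 1) [0..<n]"
    using N up by (auto simp: diag_mat_def)
  also have "prod_list \<dots> = (1 :: real)" by (induction n) auto
  finally show d: "det (1\<^sub>m n - N) \<noteq> 0" by simp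
  define Y where "Y = minv (1\<^sub>m n - N)"
  note i = minv_inverse[OF I d, folded Y_def]
  have rec: "Y $$ (i, j) = (if i = j then 1 else 0) + (\<Sum>l<n. N $$ (i, l) * Y $$ (l, j))"
    if ij: "i < n" "j < n" for i j
  proof -
    have "(\<Sum>l<n. (1\<^sub>m n - N) $$ (i, l) * Y $$ (l, j)) = (if i = j then 1 else 0)"
      using mat_mult_index_sum[OF I i(1) ij] i(2) ij by simp
    moreover have "(\<Sum>l<n. (1\<^sub>m n - N) $$ (i, l) * Y $$ (l, j)) =
       (\<Sum>l<n. (if i = l then Y $$ (l, j) else 0) - N $$ (i, l) * Y $$ (l, j))"
      using ij N by (intro sum.cong) (auto simp: left_diff_distrib)
    ultimately show ?thesis using ij by (simp add: sum_subtractf)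
  qed
  have "Y $$ (i, j) = 0" if "i < n" "j < n" "i div p < j div p" for i j
    using that
  proof (induction i rule: less_induct)
    case (less i)
    have "N $$ (i, l) * Y $$ (l, j) = 0" if l: "l < n" for l
    proof (cases "i div p \<le> l div p")
      case True
      then show ?thesis using N l less.prems unfolding block_strictly_lower_def by auto
    next
      case False
      then have "l < i" by (metis div_le_mono not_le)
      then have "Y $$ (l, j) = 0" using False less.prems l by (intro less.IH) auto
      then show ?thesis by simp
    qed
    then have "(\<Sum>l<n. N $$ (i, l) * Y $$ (l, j)) = 0" by (intro sum.neutral) auto
    then show ?case using rec[OF less.prems(1,2)] less.prems(3) by auto
  qed
  then show "block_lower_triangular p p (minv (1\<^sub>m n - N))"
    using i unfolding Y_def[symmetric] block_lower_triangular_def by auto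
qed

text \<open>A block of \<open>?D *\<^sub>v v\<close> depends only on the same block of
  \<open>v\<close>, and injectively so. Hence the kernel is trivial, and a column of the inverse,
  being mapped to a unit vector, vanishes in every block but one.\<close>

lemma minv_diag_block_lower:
  assumes M: "\<And>k. k < K \<Longrightarrow> M k \<in> carrier_mat p p" "\<And>k. k < K \<Longrightarrow> det (M k) \<noteq> 0"
  shows "det (diag_block_mat (map M [0..<K])) \<noteq> 0"
    "block_lower_triangular p p (minv (diag_block_mat (map M [0..<K])))"
proof -
  let ?D = "diag_block_mat (map M [0..<K])"
  have D: "?D \<in> carrier_mat (p * K) (p * K)" using M by auto
  have inj: "vblock p k v = 0\<^sub>v p" if "v \<in> carrier_vec (p * K)" "k < K" "vblock p k (?D *\<^sub>v v) = 0\<^sub>v p" for v k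
  proof (rule ccontr)
    assume "vblock p k v \<noteq> 0\<^sub>v p"
    moreover have "M k *\<^sub>v vblock p k v = 0\<^sub>v p"
      using vblock_diag_mult[of K M p p v k, OF M(1) that(1,2)] that(3) by simp
    ultimately have "det (M k) = 0"
      using det_0_iff_vec_prod_zero[OF M(1)[OF that(2)]] by (auto intro!: exI[of _ "vblock p k v"])
    with M(2)[OF that(2)] show False by simp
  qed
  show d: "det ?D \<noteq> 0"
  proof
    assume "det ?D = 0"
    then obtain v where v: "v \<in> carrier_vec (p * K)" "v \<noteq> 0\<^sub>v (p * K)" "?D *\<^sub>v v = 0\<^sub>v (p * K)"
      using det_0_iff_vec_prod_zero[OF D] by auto
    have "v = 0\<^sub>v (p * K)"
    proof (rule vblock_eqI[OF v(1) zero_carrier_vec])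
      fix k assume k: "k < K"
      show "vblock p k v = vblock p k (0\<^sub>v (p * K))"
        unfolding vblock_zero[OF k] by (rule inj[OF v(1) k]) (simp only: v(3) vblock_zero[OF k])
    qed
    with v show False by simp
  qed
  define Y where "Y = minv ?D"
  note i = minv_inverse[OF D d, folded Y_def]
  show "block_lower_triangular p p (minv ?D)"
    unfolding Y_def[symmetric] block_lower_triangular_def
  proof (intro allI impI)
    fix a b assume ab: "a < dim_row Y" "b < dim_col Y" "a div p < b div p"
    then have ab': "a < p * K" "b < p * K" using i by auto
    note da = div_less_of_less_mult[OF ab'(1)]
    have c: "col Y b \<in> carrier_vec (p * K)" using i ab' by (intro carrier_vecI) simp
    have "?D *\<^sub>v col Y b = col (?D * Y) b" by (rule col_mult2[OF D i(1) ab'(2), symmetric])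
    also have "\<dots> = unit_vec (p * K) b" using i ab' by simp
    finally have u: "?D *\<^sub>v col Y b = unit_vec (p * K) b" .
    have "vblock p (a div p) (unit_vec (p * K) b) = 0\<^sub>v p"
    proof (rule eq_vecI)
      fix c assume "c < dim_vec (0\<^sub>v p)"
      then have c: "c < p" by simp
      have "a div p * p + c \<noteq> b" using div_mod_block(1)[OF c, of "a div p"] ab(3) by auto
      then show "vblock p (a div p) (unit_vec (p * K) b) $ c = 0\<^sub>v p $ c"
        using c block_index_less[OF da(1) c] ab' by (simp add: vblock_index)
    qed simp
    with u have "vblock p (a div p) (?D *\<^sub>v col Y b) = 0\<^sub>v p" by simp
    then have "vblock p (a div p) (col Y b) = 0\<^sub>v p" by (rule inj[OF c da(1)])
    then have "vblock p (a div p) (col Y b) $ (a mod p) = 0" using da by simp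
    then show "Y $$ (a, b) = 0" using da ab' i by (auto simp: vblock_index)
  qed
qed

subsection \<open>The system in operator form\<close>

locale lq =
  fixes S :: lq_system
  assumes valid: "valid_system S"
begin

text \<open>Keeps the dimensions \<open>n * (T + 1)\<close> in the form in which the definitions have them.\<close>

declare One_nat_def [simp del]

abbreviation "n \<equiv> state_dim S"
abbreviation "m \<equiv> input_dim S"
abbreviation "T \<equiv> horizon S"
abbreviation "N \<equiv> xdim S"
abbreviation "M \<equiv> udim S"

lemma blocks:
  "k < T \<Longrightarrow> Amat S k \<in> carrier_mat n n" "k < T \<Longrightarrow> Bmat S k \<in> carrier_mat n m"
  "k < T \<Longrightarrow> Emat S k \<in> carrier_mat n n" "k < T \<Longrightarrow> det (Emat S k) \<noteq> 0"
  "k < T + 1 \<Longrightarrow> Qmat S k \<in> carrier_mat n n" "k < T + 1 \<Longrightarrow> positive_definite (Qmat S k)"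
  "k < T + 1 \<Longrightarrow> Rmat S k \<in> carrier_mat m m" "k < T + 1 \<Longrightarrow> positive_definite (Rmat S k)"
  using valid by (auto simp: valid_system_def invertible_iff_det[of "Emat S k" n])

lemma T_pos: "1 \<le> T"
  using valid by (auto simp: valid_system_def)

text \<open>The closing zero blocks of \<open>Acal\<close> and \<open>Bcal\<close> and the leading
  identity of \<open>Ecal\<close> are absorbed into the families, so that all three become block
  diagonals over \<open>[0..<T + 1]\<close>. The shift in \<open>E'\<close> reflects that block 0 of
  the stacked disturbance is \<open>x0\<close>.\<close>

definition "A' k = (if k < T then Amat S k else 0\<^sub>m n n)"
definition "B' k = (if k < T then Bmat S k else 0\<^sub>m n m)"
definition "E' k = (if k = 0 then 1\<^sub>m n else Emat S (k - 1))"

lemma blocks':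
  "k < T + 1 \<Longrightarrow> A' k \<in> carrier_mat n n" "k < T + 1 \<Longrightarrow> B' k \<in> carrier_mat n m"
  "k < T + 1 \<Longrightarrow> E' k \<in> carrier_mat n n" "k < T + 1 \<Longrightarrow> det (E' k) \<noteq> 0"
  using blocks by (auto simp: A'_def B'_def E'_def)

lemma cal_eq:
  "Acal S = diag_block_mat (map A' [0..<T + 1])" "Bcal S = diag_block_mat (map B' [0..<T + 1])"
  "Ecal S = diag_block_mat (map E' [0..<T + 1])"
proof -
  have 1: "map A' [0..<T + 1] = map (Amat S) [0..<T] @ [0\<^sub>m n n]"
    "map B' [0..<T + 1] = map (Bmat S) [0..<T] @ [0\<^sub>m n m]"
    by (simp_all add: A'_def B'_def One_nat_def)
  have 2: "map E' [0..<T + 1] = 1\<^sub>m n # map (Emat S) [0..<T]"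
    by (simp add: E'_def upt_conv_Cons map_Suc_upt[symmetric] o_def One_nat_def del: upt_Suc)
  show "Acal S = diag_block_mat (map A' [0..<T + 1])" "Bcal S = diag_block_mat (map B' [0..<T + 1])"
    "Ecal S = diag_block_mat (map E' [0..<T + 1])"
    unfolding Acal_def Bcal_def Ecal_def 1 2 by (rule refl)+
qed

lemma cal_carrier [simp]:
  "Acal S \<in> carrier_mat N N" "Bcal S \<in> carrier_mat N M" "Ecal S \<in> carrier_mat N N" "Zcal S \<in> carrier_mat N N"
  "Qcal S \<in> carrier_mat N N" "Rcal S \<in> carrier_mat M M"
  unfolding cal_eq Qcal_def Rcal_def
  by (rule diag_block_mat_map_carrier, erule blocks')+
    (simp add: Zcal_def, (rule diag_block_mat_map_carrier, erule blocks)+)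

lemma cal_lower:
  "block_lower_triangular n n (Acal S)" "block_lower_triangular n m (Bcal S)" "block_lower_triangular n n (Ecal S)"
  unfolding cal_eq by (rule block_lower_diag, erule blocks')+

lemma Ecal_inverse: "det (Ecal S) \<noteq> 0" "block_lower_triangular n n (minv (Ecal S))"
  unfolding cal_eq by (rule minv_diag_block_lower, erule blocks', erule blocks')+

lemma QR_posdef: "positive_definite (Qcal S)" "positive_definite (Rcal S)"
  unfolding Qcal_def Rcal_def by (rule posdef_diag_block, erule blocks, erule blocks)+

lemma Zcal_strict: "block_strictly_lower n n (Zcal S)"
  unfolding block_strictly_lower_def
proof (intro allI impI)
  fix i j assume ij: "i < dim_row (Zcal S)" "j < dim_col (Zcal S)" "i div n \<le> j div n"
  have "i \<noteq> j + n"
  proof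
    assume "i = j + n"
    moreover have "0 < n" using ij by (cases "n = 0") (auto simp: Zcal_def)
    ultimately have "i div n = Suc (j div n)" by simp
    with ij show False by simp
  qed
  then show "Zcal S $$ (i, j) = 0" using ij by (auto simp: Zcal_def)
qed

section \<open>The operators from inputs and disturbances to states\<close>

definition "Y = 1\<^sub>m N - Zcal S * Acal S"

lemma Y: "Y \<in> carrier_mat N N" "det Y \<noteq> 0" "block_lower_triangular n n Y" "block_lower_triangular n n (minv Y)"
  "minv Y \<in> carrier_mat N N" "Y * minv Y = 1\<^sub>m N" "minv Y * Y = 1\<^sub>m N"
proof -
  have ZA: "Zcal S * Acal S \<in> carrier_mat N N" by (rule mult_carrier_mat[OF cal_carrier(4,1)])
  have s: "block_strictly_lower n n (Zcal S * Acal S)"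
    by (rule block_lower_mult(2)[OF cal_carrier(4,1) Zcal_strict cal_lower(1)])
  show Y: "Y \<in> carrier_mat N N" unfolding Y_def by (rule minus_carrier_mat[OF ZA])
  show d: "det Y \<noteq> 0" "block_lower_triangular n n (minv Y)"
    using block_unit_lower_inverse[OF ZA s] by (simp_all add: Y_def)
  show "block_lower_triangular n n Y" unfolding Y_def
    by (rule block_lower_add(2)[OF _ ZA block_lower_one block_strictly_lower_imp_lower[OF s]]) simp
  show "minv Y \<in> carrier_mat N N" "Y * minv Y = 1\<^sub>m N" "minv Y * Y = 1\<^sub>m N"
    by (rule minv_inverse[OF Y d(1)])+
qed

lemma ZB: "Zcal S * Bcal S \<in> carrier_mat N M" "block_strictly_lower n m (Zcal S * Bcal S)"
  by (rule mult_carrier_mat[OF cal_carrier(4,2)])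
    (rule block_lower_mult(2)[OF cal_carrier(4,2) Zcal_strict cal_lower(2)])

abbreviation "F \<equiv> Fop S"
abbreviation "G \<equiv> Gop S"

lemma F_eq: "F = minv Y * (Zcal S * Bcal S)" and G_eq: "G = minv Y * Ecal S"
  by (simp_all add: Fop_def Gop_def Y_def)

lemma FG_carrier [simp]: "F \<in> carrier_mat N M" "G \<in> carrier_mat N N"
  unfolding F_eq G_eq by (rule mult_carrier_mat[OF Y(5) ZB(1)], rule mult_carrier_mat[OF Y(5) cal_carrier(3)])

lemma F_strict: "block_strictly_lower n m F"
  unfolding F_eq by (rule block_lower_mult(3)[OF Y(5) ZB(1) Y(4) ZB(2)])

lemma G_lower: "block_lower_triangular n n G"
  unfolding G_eq by (rule block_lower_mult(1)[OF Y(5) cal_carrier(3) Y(4) cal_lower(3)])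

text \<open>The causal recovery of the stacked disturbance from the uncontrolled state, used to turn
  a response back into a controller.\<close>

definition "Ginv = minv (Ecal S) * Y"

lemma Ginv: "Ginv \<in> carrier_mat N N" "G * Ginv = 1\<^sub>m N" "Ginv * G = 1\<^sub>m N" "block_lower_triangular n n Ginv"
proof -
  note i = minv_inverse[OF cal_carrier(3) Ecal_inverse(1)]
  show c: "Ginv \<in> carrier_mat N N" unfolding Ginv_def by (rule mult_carrier_mat[OF i(1) Y(1)])
  have "G * Ginv = minv Y * (Ecal S * Ginv)"
    unfolding G_eq by (rule assoc_mult_mat[OF Y(5) cal_carrier(3) c])
  also have "Ecal S * Ginv = (Ecal S * minv (Ecal S)) * Y"
    unfolding Ginv_def by (rule assoc_mult_mat[symmetric, OF cal_carrier(3) i(1) Y(1)])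
  also have "\<dots> = Y" using i(2) Y(1) by simp
  finally show "G * Ginv = 1\<^sub>m N" using Y(7) by simp
  then show "Ginv * G = 1\<^sub>m N" by (rule mat_mult_left_right_inverse[OF FG_carrier(2) c])
  show "block_lower_triangular n n Ginv"
    unfolding Ginv_def by (rule block_lower_mult(1)[OF i(1) Y(1) Ecal_inverse(2) Y(3)])
qed

lemma Y_solve:
  assumes "x \<in> carrier_vec N" "u \<in> carrier_vec M" "d \<in> carrier_vec N"
  shows "Y *\<^sub>v x = (Zcal S * Bcal S) *\<^sub>v u + Ecal S *\<^sub>v d \<longleftrightarrow> x = F *\<^sub>v u + G *\<^sub>v d"
proof -
  have c: "(Zcal S * Bcal S) *\<^sub>v u \<in> carrier_vec N" "Ecal S *\<^sub>v d \<in> carrier_vec N"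
    by (rule mult_mat_vec_carrier[OF ZB(1) assms(2)], rule mult_mat_vec_carrier[OF cal_carrier(3) assms(3)])
  let ?r = "(Zcal S * Bcal S) *\<^sub>v u + Ecal S *\<^sub>v d"
  have r: "?r \<in> carrier_vec N" using c by simp
  have "minv Y *\<^sub>v ?r = minv Y *\<^sub>v ((Zcal S * Bcal S) *\<^sub>v u) + minv Y *\<^sub>v (Ecal S *\<^sub>v d)"
    by (rule mult_add_distrib_mat_vec[OF Y(5) c])
  also have "\<dots> = F *\<^sub>v u + G *\<^sub>v d"
    unfolding F_eq G_eq
    by (simp only: assoc_mult_mat_vec[OF Y(5) ZB(1) assms(2)] assoc_mult_mat_vec[OF Y(5) cal_carrier(3) assms(3)])
  finally have e: "minv Y *\<^sub>v ?r = F *\<^sub>v u + G *\<^sub>v d" .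
  show ?thesis
    using minv_mult_vec[OF Y(1,2) assms(1)] minv_mult_vec[OF Y(1,2) r] e by metis
qed

lemma vblock_Z:
  assumes "v \<in> carrier_vec N"
  shows "vblock n 0 (Zcal S *\<^sub>v v) = 0\<^sub>v n" "k < T \<Longrightarrow> vblock n (Suc k) (Zcal S *\<^sub>v v) = vblock n k v"
proof -
  have Z: "(Zcal S *\<^sub>v v) $ i = (if n \<le> i then v $ (i - n) else 0)" if i: "i < N" for i
  proof -
    have "(Zcal S *\<^sub>v v) $ i = (\<Sum>j<N. if i = j + n then v $ j else 0)"
      using i assms by (auto simp: Zcal_def scalar_prod_def atLeast0LessThan intro!: sum.cong)
    also have "\<dots> = (\<Sum>j<N. if j = i - n then (if n \<le> i then v $ j else 0) else 0)"
      by (rule sum.cong) auto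
    also have "\<dots> = (if n \<le> i then v $ (i - n) else 0)" using i by (simp add: sum.delta less_imp_diff_less)
    finally show ?thesis .
  qed
  show "vblock n 0 (Zcal S *\<^sub>v v) = 0\<^sub>v n"
  proof (rule eq_vecI)
    fix i assume "i < dim_vec (0\<^sub>v n :: real vec)"
    then have i: "i < n" by simp
    then have "i < N" using block_index_less[of 0 "T + 1" i n] by simp
    from Z[OF this] i show "vblock n 0 (Zcal S *\<^sub>v v) $ i = 0\<^sub>v n $ i" by (simp add: vblock_index)
  qed simp
  show "vblock n (Suc k) (Zcal S *\<^sub>v v) = vblock n k v" if k: "k < T"
  proof (rule eq_vecI)
    fix i assume "i < dim_vec (vblock n k v)"
    then have i: "i < n" by simp
    have "Suc k < T + 1" using k by simp
    from block_index_less[OF this i] have "Suc k * n + i < N" .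
    from Z[OF this] i show "vblock n (Suc k) (Zcal S *\<^sub>v v) $ i = vblock n k v $ i"
      by (simp add: vblock_index)
  qed simp
qed

lemma vblock_append:
  assumes "x \<in> carrier_vec n" "w \<in> carrier_vec (n * T)"
  shows "vblock n 0 (x @\<^sub>v w) = x" "k < T \<Longrightarrow> vblock n (Suc k) (x @\<^sub>v w) = vblock n k w"
proof -
  show "vblock n 0 (x @\<^sub>v w) = x"
    using assms by (intro eq_vecI) (auto simp: vblock_index)
  show "vblock n (Suc k) (x @\<^sub>v w) = vblock n k w" if "k < T"
  proof (rule eq_vecI)
    fix i assume "i < dim_vec (vblock n k w)"
    then have i: "i < n" by simp
    from block_index_less[OF that this] i
    show "vblock n (Suc k) (x @\<^sub>v w) $ i = vblock n k w $ i"
      using assms by (simp add: vblock_index)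
  qed simp
qed

lemma state_carrier:
  assumes "x0 \<in> carrier_vec n" "k \<le> T"
  shows "state S x0 u w k \<in> carrier_vec n"
  using assms(2)
proof (induction k)
  case (Suc k)
  then have "k < T" and "state S x0 u w k \<in> carrier_vec n" by simp_all
  with blocks(1,2,3)[OF this(1)] show ?case by (auto intro!: add_carrier_vec mult_mat_vec_carrier)
qed (simp add: assms(1))

lemma vblock_stacked_state:
  assumes "x0 \<in> carrier_vec n" "k \<le> T"
  shows "vblock n k (stacked_state S x0 u w) = state S x0 u w k"
proof (rule eq_vecI)
  show "dim_vec (vblock n k (stacked_state S x0 u w)) = dim_vec (state S x0 u w k)"
    using carrier_vecD[OF state_carrier[OF assms]] by simp
  fix i assume "i < dim_vec (state S x0 u w k)"
  then have i: "i < n" using carrier_vecD[OF state_carrier[OF assms]] by simp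
  have "k < T + 1" using assms(2) by simp
  from block_index_less[OF this i] show "vblock n k (stacked_state S x0 u w) $ i = state S x0 u w k $ i"
    using i by (simp add: vblock_index stacked_state_def div_mod_block)
qed

lemma delta_carrier:
  assumes "x0 \<in> carrier_vec n" "w \<in> carrier_vec (n * T)"
  shows "x0 @\<^sub>v w \<in> carrier_vec N"
  using append_carrier_vec[OF assms] by (simp add: distrib_left add.commute)

text \<open>Block \<open>k\<close> of the equation in \<open>Y_solve\<close> is the recursion that
  defines \<open>state\<close> at \<open>k\<close>; at \<open>k = 0\<close> the downshift yields
  zero blocks and only \<open>x0\<close> remains.\<close>

lemma stacked_state_eq:
  assumes x0: "x0 \<in> carrier_vec n" and u: "u \<in> carrier_vec M" and w: "w \<in> carrier_vec (n * T)"
  shows "stacked_state S x0 u w = F *\<^sub>v u + G *\<^sub>v (x0 @\<^sub>v w)"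
proof -
  let ?x = "stacked_state S x0 u w" let ?d = "x0 @\<^sub>v w"
  have x: "?x \<in> carrier_vec N" by (simp add: stacked_state_def)
  have d: "?d \<in> carrier_vec N" by (rule delta_carrier[OF x0 w])
  have Ax: "Acal S *\<^sub>v ?x \<in> carrier_vec N" by (rule mult_mat_vec_carrier[OF cal_carrier(1) x])
  have Bu: "Bcal S *\<^sub>v u \<in> carrier_vec N" by (rule mult_mat_vec_carrier[OF cal_carrier(2) u])
  have ZAx: "Zcal S *\<^sub>v (Acal S *\<^sub>v ?x) \<in> carrier_vec N" by (rule mult_mat_vec_carrier[OF cal_carrier(4) Ax])
  have ZBu: "Zcal S *\<^sub>v (Bcal S *\<^sub>v u) \<in> carrier_vec N" by (rule mult_mat_vec_carrier[OF cal_carrier(4) Bu])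
  have Ed: "Ecal S *\<^sub>v ?d \<in> carrier_vec N" by (rule mult_mat_vec_carrier[OF cal_carrier(3) d])
  have "Y *\<^sub>v ?x = ?x - Zcal S *\<^sub>v (Acal S *\<^sub>v ?x)"
    unfolding Y_def
    by (subst minus_mult_distrib_mat_vec[of _ N N])
      (use x in \<open>simp_all add: assoc_mult_mat_vec[OF cal_carrier(4,1) x] mult_carrier_mat[OF cal_carrier(4,1)]\<close>)
  also have "\<dots> = Zcal S *\<^sub>v (Bcal S *\<^sub>v u) + Ecal S *\<^sub>v ?d"
  proof (rule vblock_eqI[of _ n "T + 1"])
    fix k assume k: "k < T + 1"
    have A: "vblock n j (Acal S *\<^sub>v ?x) = A' j *\<^sub>v vblock n j ?x" if "j < T + 1" for j
      unfolding cal_eq by (rule vblock_diag_mult[of "T + 1" A' n n, OF _ x that]) (rule blocks')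
    have B: "vblock n j (Bcal S *\<^sub>v u) = B' j *\<^sub>v vblock m j u" if "j < T + 1" for j
      unfolding cal_eq by (rule vblock_diag_mult[of "T + 1" B' n m, OF _ u that]) (rule blocks')
    have E: "vblock n j (Ecal S *\<^sub>v ?d) = E' j *\<^sub>v vblock n j ?d" if "j < T + 1" for j
      unfolding cal_eq by (rule vblock_diag_mult[of "T + 1" E' n n, OF _ d that]) (rule blocks')
    show "vblock n k (?x - Zcal S *\<^sub>v (Acal S *\<^sub>v ?x)) = vblock n k (Zcal S *\<^sub>v (Bcal S *\<^sub>v u) + Ecal S *\<^sub>v ?d)"
      unfolding vblock_add(2)[OF x ZAx k] vblock_add(1)[OF ZBu Ed k]
    proof (cases k)
      case 0
      have "vblock n 0 ?x = x0" using vblock_stacked_state[OF x0, of 0 u w] by simp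
      moreover have "vblock n 0 (Ecal S *\<^sub>v ?d) = x0"
        using E[of 0] vblock_append(1)[OF x0 w] x0 by (simp add: E'_def)
      ultimately show "vblock n k ?x - vblock n k (Zcal S *\<^sub>v (Acal S *\<^sub>v ?x)) =
          vblock n k (Zcal S *\<^sub>v (Bcal S *\<^sub>v u)) + vblock n k (Ecal S *\<^sub>v ?d)"
        using x0 by (simp add: 0 vblock_Z(1)[OF Ax] vblock_Z(1)[OF Bu])
    next
      case (Suc j)
      then have j: "j < T" "j < T + 1" "Suc j < T + 1" using k by auto
      note bj = blocks(1,2,3)[OF j(1)]
      have s: "state S x0 u w j \<in> carrier_vec n" by (rule state_carrier[OF x0]) (use j in simp)
      have c: "Amat S j *\<^sub>v state S x0 u w j \<in> carrier_vec n" "Bmat S j *\<^sub>v vblock m j u \<in> carrier_vec n"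
        "Emat S j *\<^sub>v vblock n j w \<in> carrier_vec n"
        using bj s by (auto intro!: mult_mat_vec_carrier)
      have cancel: "a + (b + c) - a = b + c" if "a \<in> carrier_vec n" "b \<in> carrier_vec n" "c \<in> carrier_vec n"
        for a b c :: "real vec" using that by (intro eq_vecI) auto
      have "vblock n (Suc j) ?x = state S x0 u w (Suc j)"
        by (rule vblock_stacked_state[OF x0]) (use j in simp)
      moreover have "vblock n j ?x = state S x0 u w j"
        by (rule vblock_stacked_state[OF x0]) (use j in simp)
      moreover have "vblock n (Suc j) (Ecal S *\<^sub>v ?d) = Emat S j *\<^sub>v vblock n j w"
        using E[OF j(3)] vblock_append(2)[OF x0 w j(1)] by (simp add: E'_def)
      ultimately show "vblock n k ?x - vblock n k (Zcal S *\<^sub>v (Acal S *\<^sub>v ?x)) =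
          vblock n k (Zcal S *\<^sub>v (Bcal S *\<^sub>v u)) + vblock n k (Ecal S *\<^sub>v ?d)"
        using c j(1) by (simp add: Suc vblock_Z(2)[OF Ax j(1)] vblock_Z(2)[OF Bu j(1)] A[OF j(2)] B[OF j(2)] A'_def B'_def cancel)
    qed
  qed (use x ZAx ZBu Ed in auto)
  also have "Zcal S *\<^sub>v (Bcal S *\<^sub>v u) = (Zcal S * Bcal S) *\<^sub>v u"
    by (rule assoc_mult_mat_vec[symmetric, OF cal_carrier(4,2) u])
  finally show ?thesis using Y_solve[OF x u d] by simp
qed


subsection \<open>The non-causal optimum\<close>

text \<open>\<open>Sg\<close> is the matrix inverted inside \<open>Omat\<close>, and
  \<open>Wm\<close> is the quadratic part of the cost in the input. \<open>H\<close> is the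
  non-causal optimal response, written with \<open>Sg\<close> to match \<open>Omat\<close>; by the
  push-through identity it equals \<open>- (minv Wm * (F\<^sup>T * (Qcal S * G)))\<close>.\<close>

definition "Sg = minv (Qcal S) + F * minv (Rcal S) * F\<^sup>T"
definition "Wm = Rcal S + F\<^sup>T * Qcal S * F"
definition "H = - (minv (Rcal S) * (F\<^sup>T * (minv Sg * G)))"

lemma mult_mat_vec_uminus:
  assumes "(A :: real mat) \<in> carrier_mat a b" "v \<in> carrier_vec b"
  shows "A *\<^sub>v (- v) = - (A *\<^sub>v v)"
  using assms by (intro eq_vecI) auto

lemma FT_carrier [simp]: "F\<^sup>T \<in> carrier_mat M N"
  using FG_carrier by simp

lemma Q_inv: "minv (Qcal S) \<in> carrier_mat N N" "(minv (Qcal S))\<^sup>T = minv (Qcal S)" "positive_definite (minv (Qcal S))"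
  by (rule posdef_minv[OF cal_carrier(5) QR_posdef(1)])+

lemma R_inv: "minv (Rcal S) \<in> carrier_mat M M" "(minv (Rcal S))\<^sup>T = minv (Rcal S)" "positive_definite (minv (Rcal S))"
  by (rule posdef_minv[OF cal_carrier(6) QR_posdef(2)])+

lemma Sg: "Sg \<in> carrier_mat N N" "positive_definite Sg"
  unfolding Sg_def using posdef_add_congruence[OF Q_inv(1,3) R_inv(1,3) FG_carrier(1)] Q_inv(1)
  by (auto intro!: add_carrier_mat mult_carrier_mat[of _ N M _ N] mult_carrier_mat[OF _ R_inv(1)])

lemma Sg_inv: "minv Sg \<in> carrier_mat N N" "(minv Sg)\<^sup>T = minv Sg"
  by (rule posdef_minv[OF Sg])+

lemma Wm: "Wm \<in> carrier_mat M M" "positive_definite Wm"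
proof -
  have "F\<^sup>T * Qcal S * F \<in> carrier_mat M M"
    by (rule mult_carrier_mat[OF mult_carrier_mat[OF FT_carrier cal_carrier(5)] FG_carrier(1)])
  then show "Wm \<in> carrier_mat M M" unfolding Wm_def by (rule add_carrier_mat)
  show "positive_definite Wm"
    using posdef_add_congruence[OF cal_carrier(6) QR_posdef(2) cal_carrier(5) QR_posdef(1) FT_carrier]
    by (simp add: Wm_def)
qed

lemma qform_Wm:
  assumes v: "v \<in> carrier_vec M"
  shows "qform Wm v = qform (Rcal S) v + qform (Qcal S) (F *\<^sub>v v)"
proof -
  have c: "F\<^sup>T * Qcal S * F \<in> carrier_mat M M"
    by (rule mult_carrier_mat[OF mult_carrier_mat[OF FT_carrier cal_carrier(5)] FG_carrier(1)])
  have "qform Wm v = qform (Rcal S) v + qform (F\<^sup>T * Qcal S * F) v"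
    unfolding qform_def Wm_def add_mult_distrib_mat_vec[OF cal_carrier(6) c v]
    by (rule scalar_prod_add_distrib[OF v mult_mat_vec_carrier[OF cal_carrier(6) v] mult_mat_vec_carrier[OF c v]])
  then show ?thesis using qform_transform[OF cal_carrier(5) FG_carrier(1) v] by simp
qed

lemma H_carrier [simp]: "H \<in> carrier_mat M N"
  unfolding H_def
  by (intro uminus_carrier_mat mult_carrier_mat[OF R_inv(1)] mult_carrier_mat[OF FT_carrier]
      mult_carrier_mat[OF Sg_inv(1)] FG_carrier)

lemma O_carrier [simp]: "Omat S \<in> carrier_mat N N" "(Omat S)\<^sup>T = Omat S"
proof -
  have e: "Omat S = G\<^sup>T * minv Sg * G" by (simp add: Omat_def Sg_def)
  have GT: "G\<^sup>T \<in> carrier_mat N N" using FG_carrier by simp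
  have c: "G\<^sup>T * minv Sg \<in> carrier_mat N N" by (rule mult_carrier_mat[OF GT Sg_inv(1)])
  show "Omat S \<in> carrier_mat N N" unfolding e by (rule mult_carrier_mat[OF c FG_carrier(2)])
  have "(G\<^sup>T * minv Sg * G)\<^sup>T = G\<^sup>T * (minv Sg * G)"
    using transpose_mult[OF c FG_carrier(2)] transpose_mult[OF GT Sg_inv(1)] Sg_inv(2) by simp
  then show "(Omat S)\<^sup>T = Omat S"
    unfolding e by (simp only: assoc_mult_mat[OF GT Sg_inv(1) FG_carrier(2)])
qed

text \<open>The vector \<open>y\<close> plays the role of a Lagrange multiplier for
  \<open>x = F u + g\<close>: the optimal pair satisfies \<open>Q xs = y\<close> and
  \<open>R us = - f\<close> with \<open>f = F\<^sup>T y\<close>. In the expansion around this pair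
  the first-order terms are multiples of \<open>f \<bullet> v\<close> and
  \<open>- (f \<bullet> v)\<close> and cancel, which leaves the optimal value and the form of the
  deviation \<open>v\<close>.\<close>

lemma cost_square:
  assumes u: "u \<in> carrier_vec M" and d: "d \<in> carrier_vec N"
  shows "qform (Qcal S) (F *\<^sub>v u + G *\<^sub>v d) + qform (Rcal S) u =
    qform (Omat S) d + qform Wm (u - H *\<^sub>v d)"
proof -
  define g y f us xs v where "g = G *\<^sub>v d" and "y = minv Sg *\<^sub>v g" and "f = F\<^sup>T *\<^sub>v y"
    and "us = - (minv (Rcal S) *\<^sub>v f)" and "xs = minv (Qcal S) *\<^sub>v y" and "v = u - H *\<^sub>v d"
  note Rc = cal_carrier(6) and Qc = cal_carrier(5)
  note pQ = posdef_carrierD[OF QR_posdef(1) Qc] and pR = posdef_carrierD[OF QR_posdef(2) Rc]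
  have g: "g \<in> carrier_vec N" unfolding g_def by (rule mult_mat_vec_carrier[OF FG_carrier(2) d])
  have y: "y \<in> carrier_vec N" unfolding y_def by (rule mult_mat_vec_carrier[OF Sg_inv(1) g])
  have f: "f \<in> carrier_vec M" unfolding f_def by (rule mult_mat_vec_carrier[OF FT_carrier y])
  have rf: "minv (Rcal S) *\<^sub>v f \<in> carrier_vec M" by (rule mult_mat_vec_carrier[OF R_inv(1) f])
  have us: "us \<in> carrier_vec M" using rf by (simp add: us_def)
  have xs: "xs \<in> carrier_vec N" unfolding xs_def by (rule mult_mat_vec_carrier[OF Q_inv(1) y])
  have Hd: "H *\<^sub>v d = us"
  proof -
    note c1 = mult_carrier_mat[OF Sg_inv(1) FG_carrier(2)]
    note c2 = mult_carrier_mat[OF FT_carrier c1]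
    have "H *\<^sub>v d = - ((minv (Rcal S) * (F\<^sup>T * (minv Sg * G))) *\<^sub>v d)"
      unfolding H_def using mult_carrier_mat[OF R_inv(1) c2] d by (intro uminus_mult_mat_vec) auto
    then show ?thesis
      by (simp only: us_def f_def y_def g_def assoc_mult_mat_vec[OF R_inv(1) c2 d]
          assoc_mult_mat_vec[OF FT_carrier c1 d] assoc_mult_mat_vec[OF Sg_inv(1) FG_carrier(2) d])
  qed
  have v: "v \<in> carrier_vec M" unfolding v_def Hd using u us by simp
  have uv: "u = us + v" unfolding v_def Hd using u us by (intro eq_vecI) auto
  have Fus: "F *\<^sub>v us \<in> carrier_vec N" and Fv: "F *\<^sub>v v \<in> carrier_vec N"
    by (rule mult_mat_vec_carrier[OF FG_carrier(1) us], rule mult_mat_vec_carrier[OF FG_carrier(1) v])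
  have Qxs: "Qcal S *\<^sub>v xs = y" unfolding xs_def by (rule minv_mult_vec[OF Qc pQ(4) y])
  have Rus: "Rcal S *\<^sub>v us = - f"
    using minv_mult_vec(1)[OF Rc pR(4) f] by (simp add: us_def mult_mat_vec_uminus[OF Rc rf])
  have Fus_eq: "F *\<^sub>v us = - (F *\<^sub>v (minv (Rcal S) *\<^sub>v f))"
    unfolding us_def by (rule mult_mat_vec_uminus[OF FG_carrier(1) rf])
  have FRf: "F *\<^sub>v (minv (Rcal S) *\<^sub>v f) \<in> carrier_vec N"
    by (rule mult_mat_vec_carrier[OF FG_carrier(1) rf])
  have "g = Sg *\<^sub>v y"
    unfolding y_def by (rule minv_mult_vec(1)[symmetric, OF Sg(1) posdef_carrierD(4)[OF Sg(2,1)] g])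
  also have "\<dots> = xs + F *\<^sub>v (minv (Rcal S) *\<^sub>v f)"
  proof -
    have c: "F * minv (Rcal S) \<in> carrier_mat N M" "F * minv (Rcal S) * F\<^sup>T \<in> carrier_mat N N"
      by (rule mult_carrier_mat[OF FG_carrier(1) R_inv(1)],
          rule mult_carrier_mat[OF mult_carrier_mat[OF FG_carrier(1) R_inv(1)] FT_carrier])
    show ?thesis unfolding Sg_def
      by (simp only: add_mult_distrib_mat_vec[OF Q_inv(1) c(2) y] assoc_mult_mat_vec[OF c(1) FT_carrier y]
          assoc_mult_mat_vec[OF FG_carrier(1) R_inv(1) f] xs_def f_def[symmetric])
  qed
  finally have g_eq: "g = xs + F *\<^sub>v (minv (Rcal S) *\<^sub>v f)" .
  have "- a + (b + a) = b" if "a \<in> carrier_vec N" "b \<in> carrier_vec N" for a b :: "real vec"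
    using that by (intro eq_vecI) auto
  then have Fg: "F *\<^sub>v us + g = xs" unfolding Fus_eq g_eq using FRf xs by blast
  have "F *\<^sub>v u + g = xs + F *\<^sub>v v"
  proof -
    have "a + b + c = a + c + b" if "a \<in> carrier_vec N" "b \<in> carrier_vec N" "c \<in> carrier_vec N"
      for a b c :: "real vec" using that by (intro eq_vecI) auto
    then show ?thesis
      unfolding uv mult_add_distrib_mat_vec[OF FG_carrier(1) us v] Fg[symmetric] using Fus Fv g by blast
  qed
  then have 1: "qform (Qcal S) (F *\<^sub>v u + g) = qform (Qcal S) xs + 2 * (xs \<bullet> (Qcal S *\<^sub>v (F *\<^sub>v v))) + qform (Qcal S) (F *\<^sub>v v)"
    using qform_add[OF Qc pQ(1) xs Fv] by simp
  have 2: "qform (Rcal S) u = qform (Rcal S) us + 2 * (us \<bullet> (Rcal S *\<^sub>v v)) + qform (Rcal S) v"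
    unfolding uv by (rule qform_add[OF Rc pR(1) us v])
  have 3: "xs \<bullet> (Qcal S *\<^sub>v (F *\<^sub>v v)) = f \<bullet> v"
  proof -
    have "xs \<bullet> (Qcal S *\<^sub>v (F *\<^sub>v v)) = y \<bullet> (F *\<^sub>v v)"
      using sym_scalar_prod[OF Qc pQ(1) xs Fv] Qxs by simp
    also have "\<dots> = f \<bullet> v" unfolding f_def by (rule transpose_vec_mult_scalar[symmetric, OF FG_carrier(1) v y])
    finally show ?thesis .
  qed
  have 4: "us \<bullet> (Rcal S *\<^sub>v v) = - (f \<bullet> v)"
    using sym_scalar_prod[OF Rc pR(1) us v] Rus f v by simp
  \<comment> \<open>By \<open>R us = - f\<close> and transposition of \<open>F\<close>, the optimal
    value collapses to \<open>g \<bullet> y\<close>, which is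
    \<open>qform (minv Sg) g\<close>.\<close>
  have 5: "qform (Qcal S) xs + qform (Rcal S) us = qform (Omat S) d"
  proof -
    have "qform (Rcal S) us = - (us \<bullet> f)" using us f by (simp add: qform_def Rus)
    also have "us \<bullet> f = f \<bullet> us" by (rule comm_scalar_prod[OF us f])
    also have "f \<bullet> us = y \<bullet> (F *\<^sub>v us)" unfolding f_def by (rule transpose_vec_mult_scalar[OF FG_carrier(1) us y])
    also have "y \<bullet> (F *\<^sub>v us) = (F *\<^sub>v us) \<bullet> y" by (rule comm_scalar_prod[OF y Fus])
    finally have "qform (Qcal S) xs + qform (Rcal S) us = xs \<bullet> y - (F *\<^sub>v us) \<bullet> y"
      by (simp add: qform_def Qxs)
    also have "xs \<bullet> y = (F *\<^sub>v us) \<bullet> y + g \<bullet> y"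
      unfolding Fg[symmetric] by (rule add_scalar_prod_distrib[OF Fus g y])
    also have "(F *\<^sub>v us) \<bullet> y + g \<bullet> y - (F *\<^sub>v us) \<bullet> y = qform (minv Sg) g"
      by (simp add: qform_def y_def)
    also have "\<dots> = qform (Omat S) d"
      using qform_transform[OF Sg_inv(1) FG_carrier(2) d] by (simp add: Omat_def Sg_def g_def)
    finally show ?thesis .
  qed
  show ?thesis using 1 2 3 4 5 qform_Wm[OF v] by (simp add: g_def[symmetric] v_def[symmetric])
qed

lemma cost_eq:
  assumes x0: "x0 \<in> carrier_vec n" and u: "u \<in> carrier_vec M" and w: "w \<in> carrier_vec (n * T)"
  shows "cost S x0 u w = qform (Omat S) (x0 @\<^sub>v w) + qform Wm (u - H *\<^sub>v (x0 @\<^sub>v w))"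
  using cost_square[OF u delta_carrier[OF x0 w]] stacked_state_eq[OF x0 u w]
  by (simp add: cost_def qform_def)

lemma optimal_cost_eq:
  assumes x0: "x0 \<in> carrier_vec n" and w: "w \<in> carrier_vec (n * T)"
  shows "has_least (cost_value S x0 w)" "optimal_cost S x0 w = qform (Omat S) (x0 @\<^sub>v w)"
proof -
  let ?o = "qform (Omat S) (x0 @\<^sub>v w)" let ?u = "H *\<^sub>v (x0 @\<^sub>v w)"
  have u: "?u \<in> carrier_vec M" by (rule mult_mat_vec_carrier[OF H_carrier delta_carrier[OF x0 w]])
  have "qform Wm (?u - ?u) = 0" using u Wm(1) by (simp add: qform_def)
  then have a: "cost_value S x0 w ?o"
    unfolding cost_value_def using u cost_eq[OF x0 u w] by (intro bexI[of _ ?u]) auto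
  have b: "?o \<le> v" if "cost_value S x0 w v" for v
    using that posdef_carrierD(3)[OF Wm(2,1)] u cost_eq[OF x0 _ w] by (auto simp: cost_value_def)
  show "has_least (cost_value S x0 w)" unfolding has_least_def using a b by blast
  show "optimal_cost S x0 w = ?o" unfolding optimal_cost_def using a b by (rule Least_equality)
qed

lemma dynamic_regret_eq:
  assumes "x0 \<in> carrier_vec n" "u \<in> carrier_vec M" "w \<in> carrier_vec (n * T)"
  shows "dynamic_regret S x0 u w = qform Wm (u - H *\<^sub>v (x0 @\<^sub>v w))"
  using cost_eq[OF assms] optimal_cost_eq(2)[OF assms(1,3)] by (simp add: dynamic_regret_def)

subsection \<open>Controllers and input responses\<close>

text \<open>A causal matrix \<open>U\<close> is also read as the map from the stacked disturbance to the input.\<close>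

lemma causalD:
  assumes "causal_controller S U"
  shows "U \<in> carrier_mat M N" "block_lower_triangular m n U"
  using assms by (auto simp: causal_controller_def)

text \<open>Inserting \<open>x = F u + G \<delta>\<close> into \<open>u = K x\<close> gives
  \<open>(1 - K F) u = K G \<delta>\<close>. Since \<open>F\<close> is strict, so is
  \<open>K F\<close>; the loop has exactly one solution, and \<open>minv (1 - K F) * (K G)\<close>
  is again block lower triangular.\<close>

lemma closed_loop_response:
  assumes K: "causal_controller S K"
  shows "\<exists>U. causal_controller S U \<and> (\<forall>x0 \<in> carrier_vec n. \<forall>w \<in> carrier_vec (n * T). \<forall>u.
    closed_loop S K x0 w u \<longleftrightarrow> u = U *\<^sub>v (x0 @\<^sub>v w))"
proof -
  note Kc = causalD[OF K]
  have KF: "K * F \<in> carrier_mat M M" "block_strictly_lower m m (K * F)"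
    by (rule mult_carrier_mat[OF Kc(1) FG_carrier(1)],
        rule block_lower_mult(3)[OF Kc(1) FG_carrier(1) Kc(2) F_strict])
  have KG: "K * G \<in> carrier_mat M N" "block_lower_triangular m n (K * G)"
    by (rule mult_carrier_mat[OF Kc(1) FG_carrier(2)],
        rule block_lower_mult(1)[OF Kc(1) FG_carrier(2) Kc(2) G_lower])
  let ?I = "1\<^sub>m M - K * F"
  have I: "?I \<in> carrier_mat M M" by (rule minus_carrier_mat[OF KF(1)])
  note inv = block_unit_lower_inverse[OF KF]
  note mi = minv_inverse[OF I inv(1)]
  define U where "U = minv ?I * (K * G)"
  have U: "U \<in> carrier_mat M N" "block_lower_triangular m n U" unfolding U_def
    by (rule mult_carrier_mat[OF mi(1) KG(1)], rule block_lower_mult(1)[OF mi(1) KG(1) inv(2) KG(2)])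
  have "closed_loop S K x0 w u \<longleftrightarrow> u = U *\<^sub>v (x0 @\<^sub>v w)"
    if x0: "x0 \<in> carrier_vec n" and w: "w \<in> carrier_vec (n * T)" for x0 w u
  proof -
    let ?d = "x0 @\<^sub>v w"
    have d: "?d \<in> carrier_vec N" by (rule delta_carrier[OF x0 w])
    have Ud: "U *\<^sub>v ?d \<in> carrier_vec M" by (rule mult_mat_vec_carrier[OF U(1) d])
    have KGd: "(K * G) *\<^sub>v ?d \<in> carrier_vec M" by (rule mult_mat_vec_carrier[OF KG(1) d])
    have "u = K *\<^sub>v stacked_state S x0 u w \<longleftrightarrow> u = U *\<^sub>v ?d" if u: "u \<in> carrier_vec M"
    proof -
      have KFu: "(K * F) *\<^sub>v u \<in> carrier_vec M" by (rule mult_mat_vec_carrier[OF KF(1) u])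
      have "K *\<^sub>v stacked_state S x0 u w = K *\<^sub>v (F *\<^sub>v u) + K *\<^sub>v (G *\<^sub>v ?d)"
        unfolding stacked_state_eq[OF x0 u w]
        by (rule mult_add_distrib_mat_vec[OF Kc(1) mult_mat_vec_carrier[OF FG_carrier(1) u]
            mult_mat_vec_carrier[OF FG_carrier(2) d]])
      also have "\<dots> = (K * F) *\<^sub>v u + (K * G) *\<^sub>v ?d"
        by (simp only: assoc_mult_mat_vec[OF Kc(1) FG_carrier(1) u] assoc_mult_mat_vec[OF Kc(1) FG_carrier(2) d])
      finally have 1: "K *\<^sub>v stacked_state S x0 u w = (K * F) *\<^sub>v u + (K * G) *\<^sub>v ?d" .
      have 2: "?I *\<^sub>v u = u - (K * F) *\<^sub>v u"
        using u by (subst minus_mult_distrib_mat_vec[OF one_carrier_mat KF(1) u]) simp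
      have 3: "U *\<^sub>v ?d = minv ?I *\<^sub>v ((K * G) *\<^sub>v ?d)"
        unfolding U_def by (rule assoc_mult_mat_vec[OF mi(1) KG(1) d])
      have "u = (K * F) *\<^sub>v u + (K * G) *\<^sub>v ?d \<longleftrightarrow> u - (K * F) *\<^sub>v u = (K * G) *\<^sub>v ?d"
      proof -
        have "u = a + b \<longleftrightarrow> u - a = b" if "a \<in> carrier_vec M" "b \<in> carrier_vec M" for a b
        proof
          assume "u = a + b"
          then show "u - a = b" using that by (intro eq_vecI) auto
        next
          assume "u - a = b"
          then show "u = a + b" using that u by (intro eq_vecI) auto
        qed
        then show ?thesis using KFu KGd by blast
      qed
      also have "\<dots> \<longleftrightarrow> u = U *\<^sub>v ?d"
        using minv_mult_vec[OF I inv(1) u] minv_mult_vec[OF I inv(1) KGd] 2 3 by metis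
      finally show ?thesis using 1 by simp
    qed
    then show ?thesis using Ud by (auto simp: closed_loop_def)
  qed
  then show ?thesis using U by (intro exI[of _ U]) (auto simp: causal_controller_def)
qed

text \<open>Under \<open>u = U \<delta>\<close> the state is \<open>(G + F U) \<delta>\<close>, so a
  controller has to recover \<open>\<delta>\<close> causally from the state. This works because
  \<open>G + F U = G * (1 - L)\<close> with \<open>L\<close> strict, and both factors have block
  lower triangular inverses.\<close>

lemma response_controller:
  assumes U: "causal_controller S U"
  shows "G + F * U \<in> carrier_mat N N" "block_lower_triangular n n (G + F * U)"
    "invertible_mat (G + F * U)" "causal_controller S (U * minv (G + F * U))"
    "\<lbrakk>x0 \<in> carrier_vec n; w \<in> carrier_vec (n * T)\<rbrakk> \<Longrightarrow>
      closed_loop S (U * minv (G + F * U)) x0 w u \<longleftrightarrow> u = U *\<^sub>v (x0 @\<^sub>v w)"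
proof -
  note Uc = causalD[OF U]
  have FU: "F * U \<in> carrier_mat N N" "block_strictly_lower n n (F * U)"
    by (rule mult_carrier_mat[OF FG_carrier(1) Uc(1)], rule block_lower_mult(2)[OF FG_carrier(1) Uc(1) F_strict Uc(2)])
  let ?X = "G + F * U"
  show X: "?X \<in> carrier_mat N N" by (rule add_carrier_mat[OF FU(1)])
  show "block_lower_triangular n n ?X"
    by (rule block_lower_add(1)[OF FG_carrier(2) FU(1) G_lower block_strictly_lower_imp_lower[OF FU(2)]])
  define L where "L = - (Ginv * (F * U))"
  have GFU: "Ginv * (F * U) \<in> carrier_mat N N" "block_strictly_lower n n (Ginv * (F * U))"
    by (rule mult_carrier_mat[OF Ginv(1) FU(1)], rule block_lower_mult(3)[OF Ginv(1) FU(1) Ginv(4) FU(2)])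
  then have L: "L \<in> carrier_mat N N" "block_strictly_lower n n L"
    by (auto simp: L_def block_strictly_lower_def)
  let ?I = "1\<^sub>m N - L"
  have I: "?I \<in> carrier_mat N N" by (rule minus_carrier_mat[OF L(1)])
  note inv = block_unit_lower_inverse[OF L]
  note mi = minv_inverse[OF I inv(1)]
  have "?I = 1\<^sub>m N + Ginv * (F * U)" using GFU(1) by (intro eq_matI) (auto simp: L_def)
  then have "G * ?I = G + G * (Ginv * (F * U))"
    using mult_add_distrib_mat[OF FG_carrier(2) one_carrier_mat GFU(1)] right_mult_one_mat[OF FG_carrier(2)] by simp
  also have "G * (Ginv * (F * U)) = (G * Ginv) * (F * U)"
    by (rule assoc_mult_mat[symmetric, OF FG_carrier(2) Ginv(1) FU(1)])
  also have "\<dots> = F * U" unfolding Ginv(2) by (rule left_mult_one_mat[OF FU(1)])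
  finally have GI: "G * ?I = ?X" .
  let ?J = "minv ?I * Ginv"
  have J: "?J \<in> carrier_mat N N" "block_lower_triangular n n ?J"
    by (rule mult_carrier_mat[OF mi(1) Ginv(1)], rule block_lower_mult(1)[OF mi(1) Ginv(1) inv(2) Ginv(4)])
  have "?X * ?J = G * (?I * ?J)"
    unfolding GI[symmetric] by (rule assoc_mult_mat[OF FG_carrier(2) I J(1)])
  also have "?I * ?J = (?I * minv ?I) * Ginv" by (rule assoc_mult_mat[symmetric, OF I mi(1) Ginv(1)])
  also have "\<dots> = Ginv" using mi(2) Ginv(1) by simp
  finally have XJ: "?X * ?J = 1\<^sub>m N" using Ginv(2) by simp
  note un = minv_unique[OF X J(1) XJ]
  show "invertible_mat ?X" using un(1) invertible_iff_det[OF X] by simp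
  let ?K = "U * minv ?X"
  show K: "causal_controller S ?K"
    unfolding un(2) causal_controller_def
    by (intro conjI mult_carrier_mat[OF Uc(1) J(1)] block_lower_mult(1)[OF Uc(1) J(1) Uc(2) J(2)])
  note iX = minv_inverse[OF X un(1)]
  show "closed_loop S ?K x0 w u \<longleftrightarrow> u = U *\<^sub>v (x0 @\<^sub>v w)"
    if x0: "x0 \<in> carrier_vec n" and w: "w \<in> carrier_vec (n * T)"
  proof -
    let ?d = "x0 @\<^sub>v w"
    have d: "?d \<in> carrier_vec N" by (rule delta_carrier[OF x0 w])
    have Ud: "U *\<^sub>v ?d \<in> carrier_vec M" by (rule mult_mat_vec_carrier[OF Uc(1) d])
    have Gd: "G *\<^sub>v ?d \<in> carrier_vec N" by (rule mult_mat_vec_carrier[OF FG_carrier(2) d])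
    have FUd: "F *\<^sub>v (U *\<^sub>v ?d) \<in> carrier_vec N" by (rule mult_mat_vec_carrier[OF FG_carrier(1) Ud])
    have Xd: "?X *\<^sub>v ?d \<in> carrier_vec N" by (rule mult_mat_vec_carrier[OF X d])
    have "stacked_state S x0 (U *\<^sub>v ?d) w = G *\<^sub>v ?d + F *\<^sub>v (U *\<^sub>v ?d)"
      unfolding stacked_state_eq[OF x0 Ud w] by (rule comm_add_vec[OF FUd Gd])
    also have "\<dots> = ?X *\<^sub>v ?d"
      by (simp only: add_mult_distrib_mat_vec[OF FG_carrier(2) FU(1) d] assoc_mult_mat_vec[OF FG_carrier(1) Uc(1) d])
    finally have s: "stacked_state S x0 (U *\<^sub>v ?d) w = ?X *\<^sub>v ?d" .
    have "?K *\<^sub>v (?X *\<^sub>v ?d) = U *\<^sub>v (minv ?X *\<^sub>v (?X *\<^sub>v ?d))"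
      by (rule assoc_mult_mat_vec[OF Uc(1) iX(1) Xd])
    also have "\<dots> = U *\<^sub>v ?d" by (simp only: minv_mult_vec(2)[OF X un(1) d])
    finally have "closed_loop S ?K x0 w (U *\<^sub>v ?d)"
      using s Ud by (simp add: closed_loop_def)
    \<comment> \<open>The closed loop has only one solution, so it is enough to exhibit
      \<open>U \<delta>\<close> as one.\<close>
    moreover obtain V where "\<And>u. closed_loop S ?K x0 w u \<longleftrightarrow> u = V *\<^sub>v ?d"
      using closed_loop_response[OF K] x0 w by blast
    ultimately show ?thesis by metis
  qed
qed

end

subsection \<open>Block matrices and Schur complements\<close>

lemma append_vec_empty: "dim_vec u = 0 \<Longrightarrow> v @\<^sub>v u = v"
  by (intro eq_vecI) auto

lemma append_cols_carrier:
  assumes "A \<in> carrier_mat r a" "B \<in> carrier_mat r b"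
  shows "append_cols A B \<in> carrier_mat r (a + b)"
  using assms by (auto simp: append_cols_def)

lemma append_cols_mult_vec:
  assumes A: "A \<in> carrier_mat r a" and B: "B \<in> carrier_mat r b"
    and v: "v \<in> carrier_vec a" and w: "w \<in> carrier_vec b"
  shows "append_cols A B *\<^sub>v (v @\<^sub>v w) = A *\<^sub>v v + B *\<^sub>v w"
  using four_block_mat_mult_vec[OF A B zero_carrier_mat zero_carrier_mat v w, of 0] A B
  by (simp add: append_cols_def append_vec_empty)

lemma append_rows_mult_vec:
  assumes "A \<in> carrier_mat a c" "B \<in> carrier_mat b c" "v \<in> carrier_vec c"
  shows "(A @\<^sub>r B) *\<^sub>v v = A *\<^sub>v v @\<^sub>v B *\<^sub>v v"
  using assms by (intro mat_mult_append) auto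

lemma append_transpose:
  assumes "A \<in> carrier_mat r a" "B \<in> carrier_mat r b"
  shows "(append_cols A B)\<^sup>T = A\<^sup>T @\<^sub>r B\<^sup>T"
proof -
  have "A\<^sup>T @\<^sub>r B\<^sup>T \<in> carrier_mat (a + b) r" using assms by (intro carrier_append_rows) auto
  then show ?thesis using assms
    by (intro eq_matI) (auto simp: append_cols_def append_rows_def)
qed

lemma append_rows_transpose:
  assumes "A \<in> carrier_mat a c" "B \<in> carrier_mat b c"
  shows "(A @\<^sub>r B)\<^sup>T = append_cols (A\<^sup>T) (B\<^sup>T)"
  using append_transpose[of "A\<^sup>T" c a "B\<^sup>T" b] assms by (metis transpose_carrier_mat transpose_transpose)

lemma append_cols_mult_append_rows:
  assumes A: "A \<in> carrier_mat r a" and B: "B \<in> carrier_mat r b"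
    and X: "X \<in> carrier_mat a c" and V: "V \<in> carrier_mat b c"
  shows "append_cols A B * (X @\<^sub>r V) = A * X + B * V"
proof -
  have "append_cols A B * (X @\<^sub>r V) = four_block_mat (A * X + B * V) (A * 0\<^sub>m a 0 + B * 0\<^sub>m b 0)
     (0\<^sub>m 0 a * X + 0\<^sub>m 0 b * V) (0\<^sub>m 0 a * 0\<^sub>m a 0 + 0\<^sub>m 0 b * 0\<^sub>m b 0)"
    unfolding append_cols_def append_rows_def using A B X V
    by (simp only: carrier_matD) (rule mult_four_block_mat, auto)
  also have "\<dots> = A * X + B * V"
    using A B X V by (intro eq_matI) (auto simp: four_block_mat_def Let_def)
  finally show ?thesis .
qed

lemma block3_qform:
  fixes M11 M21 M22 M31 M32 M33 :: "real mat"
  assumes c: "M11 \<in> carrier_mat k1 k1" "M22 \<in> carrier_mat k2 k2" "M33 \<in> carrier_mat k3 k3"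
    "M21 \<in> carrier_mat k2 k1" "M31 \<in> carrier_mat k3 k1" "M32 \<in> carrier_mat k3 k2"
    and s: "M11\<^sup>T = M11" "M22\<^sup>T = M22" "M33\<^sup>T = M33"
  defines "B \<equiv> block3_mat M11 (M21\<^sup>T) (M31\<^sup>T) M21 M22 (M32\<^sup>T) M31 M32 M33"
  shows "B \<in> carrier_mat (k1 + (k2 + k3)) (k1 + (k2 + k3))" "B\<^sup>T = B"
    "\<lbrakk>a \<in> carrier_vec k1; b \<in> carrier_vec k2; z \<in> carrier_vec k3\<rbrakk> \<Longrightarrow>
      qform B (a @\<^sub>v (b @\<^sub>v z)) = qform M11 a + qform M22 b + qform M33 z +
        2 * (b \<bullet> (M21 *\<^sub>v a)) + 2 * (z \<bullet> (M31 *\<^sub>v a)) + 2 * (z \<bullet> (M32 *\<^sub>v b))"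
proof -
  let ?R = "append_cols (M21\<^sup>T) (M31\<^sup>T)" let ?L = "M21 @\<^sub>r M31" let ?D = "four_block_mat M22 (M32\<^sup>T) M32 M33"
  have t: "M21\<^sup>T \<in> carrier_mat k1 k2" "M31\<^sup>T \<in> carrier_mat k1 k3" "M32\<^sup>T \<in> carrier_mat k2 k3"
    using c by auto
  have R: "?R \<in> carrier_mat k1 (k2 + k3)" by (rule append_cols_carrier[OF t(1,2)])
  have L: "?L \<in> carrier_mat (k2 + k3) k1" by (rule carrier_append_rows[OF c(4,5)])
  have D: "?D \<in> carrier_mat (k2 + k3) (k2 + k3)" by (rule four_block_carrier_mat[OF c(2,3)])
  have B: "B = four_block_mat M11 ?R ?L ?D" by (simp add: B_def block3_mat_def)
  show "B \<in> carrier_mat (k1 + (k2 + k3)) (k1 + (k2 + k3))"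
    unfolding B by (rule four_block_carrier_mat[OF c(1) D])
  have "?D\<^sup>T = ?D"
    by (simp add: transpose_four_block_mat[OF c(2) t(3) c(6,3)] s)
  then show "B\<^sup>T = B"
    unfolding B transpose_four_block_mat[OF c(1) R L D] s append_transpose[OF t(1,2)]
      append_rows_transpose[OF c(4,5)] by simp
  assume v: "a \<in> carrier_vec k1" "b \<in> carrier_vec k2" "z \<in> carrier_vec k3"
  have bz: "b @\<^sub>v z \<in> carrier_vec (k2 + k3)" by (rule append_carrier_vec[OF v(2,3)])
  note mv = mult_mat_vec_carrier[OF c(1) v(1)] mult_mat_vec_carrier[OF t(1) v(2)] mult_mat_vec_carrier[OF t(2) v(3)]
    mult_mat_vec_carrier[OF c(4) v(1)] mult_mat_vec_carrier[OF c(5) v(1)] mult_mat_vec_carrier[OF c(2) v(2)]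
    mult_mat_vec_carrier[OF t(3) v(3)] mult_mat_vec_carrier[OF c(6) v(2)] mult_mat_vec_carrier[OF c(3) v(3)]
  have "B *\<^sub>v (a @\<^sub>v (b @\<^sub>v z)) = (M11 *\<^sub>v a + (M21\<^sup>T *\<^sub>v b + M31\<^sup>T *\<^sub>v z)) @\<^sub>v
     ((M21 *\<^sub>v a @\<^sub>v M31 *\<^sub>v a) + ((M22 *\<^sub>v b + M32\<^sup>T *\<^sub>v z) @\<^sub>v (M32 *\<^sub>v b + M33 *\<^sub>v z)))"
    unfolding B four_block_mat_mult_vec[OF c(1) R L D v(1) bz] append_cols_mult_vec[OF t(1,2) v(2,3)]
      append_rows_mult_vec[OF c(4,5) v(1)] four_block_mat_mult_vec[OF c(2) t(3) c(6,3) v(2,3)] by (rule refl)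
  also have "(M21 *\<^sub>v a @\<^sub>v M31 *\<^sub>v a) + ((M22 *\<^sub>v b + M32\<^sup>T *\<^sub>v z) @\<^sub>v (M32 *\<^sub>v b + M33 *\<^sub>v z)) =
     (M21 *\<^sub>v a + (M22 *\<^sub>v b + M32\<^sup>T *\<^sub>v z)) @\<^sub>v (M31 *\<^sub>v a + (M32 *\<^sub>v b + M33 *\<^sub>v z))"
    by (rule append_vec_add[of _ k2 _ _ k3]) (use mv in \<open>auto intro!: add_carrier_vec\<close>)
  finally have "qform B (a @\<^sub>v (b @\<^sub>v z)) = a \<bullet> (M11 *\<^sub>v a + (M21\<^sup>T *\<^sub>v b + M31\<^sup>T *\<^sub>v z)) +
      (b \<bullet> (M21 *\<^sub>v a + (M22 *\<^sub>v b + M32\<^sup>T *\<^sub>v z)) + z \<bullet> (M31 *\<^sub>v a + (M32 *\<^sub>v b + M33 *\<^sub>v z)))"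
    unfolding qform_def using mv v
    by (simp add: scalar_prod_append[of _ k1 _ "k2 + k3"] scalar_prod_append[of _ k2 _ k3] add_carrier_vec
        append_carrier_vec)
  moreover have "a \<bullet> (M21\<^sup>T *\<^sub>v b) = b \<bullet> (M21 *\<^sub>v a)" "a \<bullet> (M31\<^sup>T *\<^sub>v z) = z \<bullet> (M31 *\<^sub>v a)"
    "b \<bullet> (M32\<^sup>T *\<^sub>v z) = z \<bullet> (M32 *\<^sub>v b)"
    using transpose_vec_mult_scalar[OF c(4) v(1,2)] transpose_vec_mult_scalar[OF c(5) v(1,3)]
      transpose_vec_mult_scalar[OF c(6) v(2,3)] comm_scalar_prod[OF v(1) mv(2)] comm_scalar_prod[OF v(1) mv(3)]
      comm_scalar_prod[OF v(2) mv(7)] by simp_all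
  moreover have "x \<bullet> (p + (q + r)) = x \<bullet> p + x \<bullet> q + x \<bullet> r"
    if "x \<in> carrier_vec k" "p \<in> carrier_vec k" "q \<in> carrier_vec k" "r \<in> carrier_vec k" for x p q r :: "real vec" and k
    using that by (simp add: scalar_prod_add_distrib[of _ k])
  ultimately show "qform B (a @\<^sub>v (b @\<^sub>v z)) = qform M11 a + qform M22 b + qform M33 z +
        2 * (b \<bullet> (M21 *\<^sub>v a)) + 2 * (z \<bullet> (M31 *\<^sub>v a)) + 2 * (z \<bullet> (M32 *\<^sub>v b))"
    using mv v by (simp add: qform_def)
qed

text \<open>Completing the square in \<open>z\<close>: minimization over \<open>z\<close>, attained
  at \<open>- (C v)\<close>, removes the corner \<open>minv C\<close> and leaves
  \<open>- qform C v\<close>. This is the Schur complement step.\<close>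

lemma qform_minv_complete:
  assumes C: "C \<in> carrier_mat k k" "positive_definite C" and z: "z \<in> carrier_vec k" and v: "v \<in> carrier_vec k"
  shows "qform (minv C) (z + C *\<^sub>v v) = qform (minv C) z + 2 * (z \<bullet> v) + qform C v"
proof -
  note p = posdef_minv[OF C]
  have Cv: "C *\<^sub>v v \<in> carrier_vec k" by (rule mult_mat_vec_carrier[OF C(1) v])
  have i: "minv C *\<^sub>v (C *\<^sub>v v) = v" by (rule minv_mult_vec(2)[OF C(1) posdef_carrierD(4)[OF C(2,1)] v])
  have "qform (minv C) (C *\<^sub>v v) = (C *\<^sub>v v) \<bullet> v" by (simp add: qform_def i)
  also have "\<dots> = qform C v" unfolding qform_def by (rule comm_scalar_prod[OF Cv v])
  finally show ?thesis using qform_add[OF p(1,2) z Cv] i by simp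
qed

context lq begin

subsection \<open>System responses and the matrix inequality\<close>

definition "Psi U = (G + F * U) @\<^sub>r U"

lemma Phi_split:
  assumes "\<Phi> \<in> carrier_mat (N + M) N"
  shows "\<Phi> = Phi_x S \<Phi> @\<^sub>r Phi_u S \<Phi>"
  using assms
  by (intro eq_matI) (auto simp: append_rows_def Phi_x_def Phi_u_def submat_def)

lemma Phi_parts:
  assumes "X \<in> carrier_mat N N" "V \<in> carrier_mat M N"
  shows "Phi_x S (X @\<^sub>r V) = X" "Phi_u S (X @\<^sub>r V) = V"
  using assms by (auto simp: append_rows_def Phi_x_def Phi_u_def submat_def)

text \<open>The equality constraint amounts to \<open>Y X = E + Z B U\<close> and determines the
  state part \<open>X = G + F U\<close>, whose triangularity is then automatic. The feasible
  responses are thus parametrized by the causal matrices \<open>U\<close>.\<close>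

lemma feasible_response_iff:
  "\<Phi> \<in> causal_responses S \<and> achievability_map S \<Phi> = Ecal S \<longleftrightarrow> (\<exists>U. causal_controller S U \<and> \<Phi> = Psi U)"
proof -
  have ach: "achievability_map S (X @\<^sub>r U) = Ecal S \<longleftrightarrow> X = G + F * U"
    if X: "X \<in> carrier_mat N N" and U: "U \<in> carrier_mat M N" for X U
  proof -
    let ?ZB = "Zcal S * Bcal S"
    have ZBU: "?ZB * U \<in> carrier_mat N N" by (rule mult_carrier_mat[OF ZB(1) U])
    have YX: "Y * X \<in> carrier_mat N N" by (rule mult_carrier_mat[OF Y(1) X])
    have EZ: "Ecal S + ?ZB * U \<in> carrier_mat N N" by (rule add_carrier_mat[OF ZBU])
    have "achievability_map S (X @\<^sub>r U) = Y * X + (- ?ZB) * U"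
      unfolding achievability_map_def Y_def[symmetric]
      by (rule append_cols_mult_append_rows[OF Y(1) uminus_carrier_mat[OF ZB(1)] X U])
    also have "(- ?ZB) * U = - (?ZB * U)"
      using carrier_matD[OF ZB(1)] carrier_matD[OF U] by (intro uminus_mult_left_mat) simp
    finally have 1: "achievability_map S (X @\<^sub>r U) = Y * X + - (?ZB * U)" .
    have "a + - b = e \<longleftrightarrow> a = e + b" if "a \<in> carrier_mat N N" "b \<in> carrier_mat N N" "e \<in> carrier_mat N N" for a b e :: "real mat"
    proof
      assume "a + - b = e"
      then show "a = e + b" using that by (intro eq_matI) auto
    next
      assume "a = e + b"
      then show "a + - b = e" using that by (intro eq_matI) auto
    qed
    from this[OF YX ZBU cal_carrier(3)]
    have 2: "achievability_map S (X @\<^sub>r U) = Ecal S \<longleftrightarrow> Y * X = Ecal S + ?ZB * U" unfolding 1 .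
    have "minv Y * (Ecal S + ?ZB * U) = minv Y * Ecal S + minv Y * (?ZB * U)"
      by (rule mult_add_distrib_mat[OF Y(5) cal_carrier(3) ZBU])
    also have "\<dots> = G + F * U"
      unfolding F_eq G_eq by (simp only: assoc_mult_mat[OF Y(5) ZB(1) U])
    finally have 3: "minv Y * (Ecal S + ?ZB * U) = G + F * U" .
    have "Y * (minv Y * (Ecal S + ?ZB * U)) = (Y * minv Y) * (Ecal S + ?ZB * U)"
      "minv Y * (Y * X) = (minv Y * Y) * X"
      by (rule assoc_mult_mat[symmetric, OF Y(1) Y(5) EZ], rule assoc_mult_mat[symmetric, OF Y(5) Y(1) X])
    then show ?thesis
      using 2 3 left_mult_one_mat[OF EZ] left_mult_one_mat[OF X] by (metis Y(6,7))
  qed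
  show ?thesis
  proof
    assume \<Phi>: "\<Phi> \<in> causal_responses S \<and> achievability_map S \<Phi> = Ecal S"
    then have c: "\<Phi> \<in> carrier_mat (N + M) N" and "block_lower_triangular m n (Phi_u S \<Phi>)"
      by (auto simp: causal_responses_def)
    then have U: "causal_controller S (Phi_u S \<Phi>)"
      by (simp add: causal_controller_def Phi_u_def submat_def)
    have X: "Phi_x S \<Phi> \<in> carrier_mat N N" by (simp add: Phi_x_def submat_def)
    have "Phi_x S \<Phi> = G + F * Phi_u S \<Phi>"
      using ach[OF X causalD(1)[OF U]] \<Phi> Phi_split[OF c] by simp
    then show "\<exists>U. causal_controller S U \<and> \<Phi> = Psi U"
      using U Phi_split[OF c] by (intro exI[of _ "Phi_u S \<Phi>"]) (simp add: Psi_def)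
  next
    assume "\<exists>U. causal_controller S U \<and> \<Phi> = Psi U"
    then obtain U where U: "causal_controller S U" and \<Phi>: "\<Phi> = Psi U" by blast
    note r = response_controller(1,2)[OF U] and u = causalD[OF U]
    show "\<Phi> \<in> causal_responses S \<and> achievability_map S \<Phi> = Ecal S"
      using ach[OF r(1) u(1)] r u Phi_parts[OF r(1) u(1)]
      by (simp add: \<Phi> Psi_def causal_responses_def)
  qed
qed

lemma Psi_carrier:
  assumes "causal_controller S U"
  shows "Psi U \<in> carrier_mat (N + M) N" "Phi_x S (Psi U) = G + F * U" "Phi_u S (Psi U) = U"
  using response_controller(1)[OF assms] causalD(1)[OF assms] Phi_parts
  by (auto simp: Psi_def)

lemma Ccal_eq: "Ccal S = four_block_mat (Qcal S) (0\<^sub>m N M) (0\<^sub>m M N) (Rcal S)"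
  unfolding Ccal_def diag_block_mat.simps(2)[of "Qcal S"] diag_block_mat_singleton Let_def
  using carrier_matD[OF cal_carrier(5)] carrier_matD[OF cal_carrier(6)] by simp

lemma Ccal_qform:
  assumes x: "x \<in> carrier_vec N" and u: "u \<in> carrier_vec M"
  shows "qform (Ccal S) (x @\<^sub>v u) = qform (Qcal S) x + qform (Rcal S) u"
proof -
  have Qx: "Qcal S *\<^sub>v x \<in> carrier_vec N" and Ru: "Rcal S *\<^sub>v u \<in> carrier_vec M"
    by (rule mult_mat_vec_carrier[OF cal_carrier(5) x], rule mult_mat_vec_carrier[OF cal_carrier(6) u])
  have "Ccal S *\<^sub>v (x @\<^sub>v u) = (Qcal S *\<^sub>v x + 0\<^sub>m N M *\<^sub>v u) @\<^sub>v (0\<^sub>m M N *\<^sub>v x + Rcal S *\<^sub>v u)"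
    unfolding Ccal_eq
    by (rule four_block_mat_mult_vec[OF cal_carrier(5) zero_carrier_mat zero_carrier_mat cal_carrier(6) x u])
  also have "\<dots> = Qcal S *\<^sub>v x @\<^sub>v Rcal S *\<^sub>v u"
  proof -
    have "0\<^sub>m N M *\<^sub>v u = 0\<^sub>v N" "0\<^sub>m M N *\<^sub>v x = 0\<^sub>v M" using u x by (auto intro!: eq_vecI)
    then show ?thesis using right_zero_vec[OF Qx] left_zero_vec[OF Ru] by simp
  qed
  finally show ?thesis unfolding qform_def using scalar_prod_append[OF x u Qx Ru] by simp
qed

lemma Ccal: "Ccal S \<in> carrier_mat (N + M) (N + M)" "positive_definite (Ccal S)"
proof -
  show C: "Ccal S \<in> carrier_mat (N + M) (N + M)"
    unfolding Ccal_eq by (rule four_block_carrier_mat[OF cal_carrier(5,6)])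
  note pQ = posdef_carrierD[OF QR_posdef(1) cal_carrier(5)] and pR = posdef_carrierD[OF QR_posdef(2) cal_carrier(6)]
  show "positive_definite (Ccal S)"
  proof (rule posdefI[OF C])
    show "(Ccal S)\<^sup>T = Ccal S"
      unfolding Ccal_eq transpose_four_block_mat[OF cal_carrier(5) zero_carrier_mat zero_carrier_mat cal_carrier(6)]
      by (simp add: pQ pR)
    fix v :: "real vec" assume v: "v \<in> carrier_vec (N + M)" "v \<noteq> 0\<^sub>v (N + M)"
    define x u where "x = vec_first v N" and "u = vec_last v M"
    have xu: "x \<in> carrier_vec N" "u \<in> carrier_vec M" "v = x @\<^sub>v u"
      using v by (simp_all add: x_def u_def)
    have "x \<noteq> 0\<^sub>v N \<or> u \<noteq> 0\<^sub>v M"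
    proof (rule ccontr)
      assume "\<not> ?thesis"
      then have "v = 0\<^sub>v (N + M)" unfolding xu(3) by (intro eq_vecI) auto
      with v show False by simp
    qed
    then show "0 < qform (Ccal S) v"
      using pQ(2,3)[OF xu(1)] pR(2,3)[OF xu(2)] unfolding xu(3) Ccal_qform[OF xu(1,2)] by force
  qed
qed

text \<open>By \<open>dynamic_regret_eq\<close> this is the regret of the response \<open>U\<close>.\<close>

definition "reg U d = qform Wm ((U - H) *\<^sub>v d)"

lemma UH_carrier: "U \<in> carrier_mat M N \<Longrightarrow> U - H \<in> carrier_mat M N"
  by (rule minus_carrier_mat) simp

lemma reg_nonneg: "U \<in> carrier_mat M N \<Longrightarrow> d \<in> carrier_vec N \<Longrightarrow> 0 \<le> reg U d"
  unfolding reg_def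
  by (rule posdef_carrierD(3)[OF Wm(2,1)]) (rule mult_mat_vec_carrier[OF UH_carrier])

lemma Psi_qform:
  assumes U: "causal_controller S U" and d: "d \<in> carrier_vec N"
  shows "Psi U *\<^sub>v d \<in> carrier_vec (N + M)" "qform (Ccal S) (Psi U *\<^sub>v d) = qform (Omat S) d + reg U d"
proof -
  note u = causalD(1)[OF U] and r = response_controller(1)[OF U]
  show "Psi U *\<^sub>v d \<in> carrier_vec (N + M)" by (rule mult_mat_vec_carrier[OF Psi_carrier(1)[OF U] d])
  have Ud: "U *\<^sub>v d \<in> carrier_vec M" by (rule mult_mat_vec_carrier[OF u d])
  have Hd: "H *\<^sub>v d \<in> carrier_vec M" by (rule mult_mat_vec_carrier[OF H_carrier d])
  have FU: "F * U \<in> carrier_mat N N" by (rule mult_carrier_mat[OF FG_carrier(1) u])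
  have rd: "(G + F * U) *\<^sub>v d \<in> carrier_vec N" by (rule mult_mat_vec_carrier[OF r d])
  have "(G + F * U) *\<^sub>v d = G *\<^sub>v d + F *\<^sub>v (U *\<^sub>v d)"
    by (simp only: add_mult_distrib_mat_vec[OF FG_carrier(2) FU d] assoc_mult_mat_vec[OF FG_carrier(1) u d])
  also have "\<dots> = F *\<^sub>v (U *\<^sub>v d) + G *\<^sub>v d"
    by (rule comm_add_vec[OF mult_mat_vec_carrier[OF FG_carrier(2) d] mult_mat_vec_carrier[OF FG_carrier(1) Ud]])
  finally have x: "(G + F * U) *\<^sub>v d = F *\<^sub>v (U *\<^sub>v d) + G *\<^sub>v d" .
  have "qform (Ccal S) (Psi U *\<^sub>v d) = qform (Qcal S) ((G + F * U) *\<^sub>v d) + qform (Rcal S) (U *\<^sub>v d)"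
    unfolding Psi_def append_rows_mult_vec[OF r u d] by (rule Ccal_qform[OF rd Ud])
  also have "\<dots> = qform (Omat S) d + qform Wm (U *\<^sub>v d - H *\<^sub>v d)"
    unfolding x by (rule cost_square[OF Ud d])
  also have "U *\<^sub>v d - H *\<^sub>v d = (U - H) *\<^sub>v d"
    by (rule minus_mult_distrib_mat_vec[symmetric, OF u H_carrier d])
  finally show "qform (Ccal S) (Psi U *\<^sub>v d) = qform (Omat S) d + reg U d" by (simp add: reg_def)
qed

lemma NT: "n + n * T = N"
  by (simp add: distrib_left add.commute)

text \<open>A test vector has the parts \<open>(t, w, z)\<close>. The matrix is built with
  \<open>x0\<close> in its first row and column, so \<open>t\<close> and \<open>w\<close> enter
  through \<open>\<delta> = (t x0, w)\<close>. Minimizing over \<open>z\<close> subtracts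
  \<open>qform C (Psi U \<delta>)\<close>, whose \<open>Omat\<close> part cancels against the blocks
  \<open>O1\<close>, \<open>O2\<close>, \<open>O3\<close> and leaves the regret.\<close>

lemma lmi_psd_iff:
  assumes U: "causal_controller S U" and x0: "x0 \<in> carrier_vec n"
    and D: "D \<in> carrier_mat (n * T) (n * T)" "D\<^sup>T = D"
  shows "positive_semidefinite (lmi_matrix S x0 (Psi U) c D) \<longleftrightarrow>
    (\<forall>t. \<forall>w \<in> carrier_vec (n * T). reg U (t \<cdot>\<^sub>v x0 @\<^sub>v w) \<le> c * t\<^sup>2 + qform D w)"
proof -
  define X \<Phi> where "X = mat_of_cols n [x0]" and "\<Phi> = Psi U"
  have \<Phi>: "\<Phi> \<in> carrier_mat (N + M) N" unfolding \<Phi>_def by (rule Psi_carrier(1)[OF U])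
  have X: "X \<in> carrier_mat n 1" using mat_of_cols_carrier(1)[of n "[x0]"] by (simp add: X_def One_nat_def)
  let ?C = "minv (Ccal S)"
  note pC = posdef_minv[OF Ccal]
  have O1: "O1 S \<in> carrier_mat n n" and O2: "O2 S \<in> carrier_mat (n * T) n" and O3: "O3 S \<in> carrier_mat (n * T) (n * T)"
    and P0: "Phi_0 S \<Phi> \<in> carrier_mat (N + M) n" and Pw: "Phi_w S \<Phi> \<in> carrier_mat (N + M) (n * T)"
    by (simp_all add: O1_def O2_def O3_def Phi_0_def Phi_w_def submat_def)
  have Osym: "Omat S $$ (i, j) = Omat S $$ (j, i)" if "i < N" "j < N" for i j
  proof -
    have "Omat S $$ (i, j) = (Omat S)\<^sup>T $$ (j, i)" using that carrier_matD[OF O_carrier(1)] by (subst index_transpose_mat) simp_all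
    then show ?thesis by simp
  qed
  have lt: "i < n * T \<Longrightarrow> n + i < N" "i < n \<Longrightarrow> i < N" for i using NT by linarith+
  have O1s: "(O1 S)\<^sup>T = O1 S" and O3s: "(O3 S)\<^sup>T = O3 S"
    by (rule eq_matI; simp add: O1_def O3_def submat_def lt Osym)+
  have Ofb: "Omat S = four_block_mat (O1 S) ((O2 S)\<^sup>T) (O2 S) (O3 S)"
    by (rule eq_matI) (use carrier_matD[OF O_carrier(1)] NT in \<open>auto simp: O1_def O2_def O3_def submat_def lt Osym\<close>)
  have Pac: "\<Phi> = append_cols (Phi_0 S \<Phi>) (Phi_w S \<Phi>)"
    by (rule eq_matI) (use \<Phi> NT in \<open>auto simp: append_cols_def Phi_0_def Phi_w_def submat_def\<close>)
  let ?M11 = "X\<^sup>T * O1 S * X + c \<cdot>\<^sub>m 1\<^sub>m 1" let ?M21 = "O2 S * X" let ?M31 = "Phi_0 S \<Phi> * X"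
  have XT: "X\<^sup>T \<in> carrier_mat 1 n" using X by simp
  have XO: "X\<^sup>T * O1 S \<in> carrier_mat 1 n" by (rule mult_carrier_mat[OF XT O1])
  have XOX: "X\<^sup>T * O1 S * X \<in> carrier_mat 1 1" by (rule mult_carrier_mat[OF XO X])
  have c11: "?M11 \<in> carrier_mat 1 1" by (rule add_carrier_mat) simp
  have c22: "O3 S + D \<in> carrier_mat (n * T) (n * T)" by (rule add_carrier_mat[OF D(1)])
  have c21: "?M21 \<in> carrier_mat (n * T) 1" by (rule mult_carrier_mat[OF O2 X])
  have c31: "?M31 \<in> carrier_mat (N + M) 1" by (rule mult_carrier_mat[OF P0 X])
  have s11: "?M11\<^sup>T = ?M11" using c11 by (intro eq_matI) auto
  have s22: "(O3 S + D)\<^sup>T = O3 S + D" using transpose_add[OF O3 D(1)] O3s D(2) by simp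
  define L where "L = lmi_matrix S x0 \<Phi> c D"
  have L: "L = block3_mat ?M11 (?M21\<^sup>T) (?M31\<^sup>T) ?M21 (O3 S + D) ((Phi_w S \<Phi>)\<^sup>T) ?M31 (Phi_w S \<Phi>) ?C"
    unfolding L_def lmi_matrix_def Let_def X_def[symmetric] transpose_mult[OF O2 X] transpose_mult[OF P0 X] by (rule refl)
  note B = block3_qform[OF c11 c22 pC(1) c21 c31 Pw s11 s22 pC(2), folded L]
  have delta: "t \<cdot>\<^sub>v x0 @\<^sub>v w \<in> carrier_vec N" if "w \<in> carrier_vec (n * T)" for t w
    using delta_carrier[of "t \<cdot>\<^sub>v x0" w] x0 that by simp
  have form: "qform L (a @\<^sub>v (w @\<^sub>v z)) = qform (Omat S) (t \<cdot>\<^sub>v x0 @\<^sub>v w) + c * t\<^sup>2 + qform D w +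
      2 * (z \<bullet> (\<Phi> *\<^sub>v (t \<cdot>\<^sub>v x0 @\<^sub>v w))) + qform ?C z"
    if a: "a \<in> carrier_vec 1" and t: "t = a $ 0" and w: "w \<in> carrier_vec (n * T)" and z: "z \<in> carrier_vec (N + M)" for a t w z
  proof -
    let ?x = "t \<cdot>\<^sub>v x0"
    have x: "?x \<in> carrier_vec n" using x0 by simp
    have Xa: "X *\<^sub>v a = ?x"
      using a x0 by (intro eq_vecI) (auto simp: X_def scalar_prod_def mat_of_cols_def t One_nat_def)
    have "qform ?M11 a = qform (X\<^sup>T * O1 S * X) a + qform (c \<cdot>\<^sub>m 1\<^sub>m 1) a"
      unfolding qform_def using a XOX
      by (subst add_mult_distrib_mat_vec[of _ 1 1]) (auto intro!: scalar_prod_add_distrib[of _ 1] mult_mat_vec_carrier)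
    also have "qform (X\<^sup>T * O1 S * X) a = qform (O1 S) ?x"
      using qform_transform[OF O1 X a] Xa by simp
    also have "qform (c \<cdot>\<^sub>m 1\<^sub>m 1) a = c * t\<^sup>2"
      using a by (simp add: qform_sum[of _ 1] One_nat_def t power2_eq_square)
    finally have f11: "qform ?M11 a = qform (O1 S) ?x + c * t\<^sup>2" .
    have f22: "qform (O3 S + D) w = qform (O3 S) w + qform D w"
      unfolding qform_def add_mult_distrib_mat_vec[OF O3 D(1) w]
      by (rule scalar_prod_add_distrib[OF w mult_mat_vec_carrier[OF O3 w] mult_mat_vec_carrier[OF D(1) w]])
    have f21: "?M21 *\<^sub>v a = O2 S *\<^sub>v ?x" using assoc_mult_mat_vec[OF O2 X a] Xa by simp
    have f31: "?M31 *\<^sub>v a = Phi_0 S \<Phi> *\<^sub>v ?x" using assoc_mult_mat_vec[OF P0 X a] Xa by simp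
    have fP: "z \<bullet> (\<Phi> *\<^sub>v (?x @\<^sub>v w)) = z \<bullet> (Phi_0 S \<Phi> *\<^sub>v ?x) + z \<bullet> (Phi_w S \<Phi> *\<^sub>v w)"
    proof -
      have "\<Phi> *\<^sub>v (?x @\<^sub>v w) = Phi_0 S \<Phi> *\<^sub>v ?x + Phi_w S \<Phi> *\<^sub>v w"
        using append_cols_mult_vec[OF P0 Pw x w] Pac by simp
      then show ?thesis
        using scalar_prod_add_distrib[OF z mult_mat_vec_carrier[OF P0 x] mult_mat_vec_carrier[OF Pw w]] by simp
    qed
    have fO: "qform (Omat S) (?x @\<^sub>v w) = qform (O1 S) ?x + 2 * (w \<bullet> (O2 S *\<^sub>v ?x)) + qform (O3 S) w"
    proof -
      have T2: "(O2 S)\<^sup>T \<in> carrier_mat n (n * T)" using O2 by simp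
      note mv = mult_mat_vec_carrier[OF O1 x] mult_mat_vec_carrier[OF T2 w] mult_mat_vec_carrier[OF O2 x] mult_mat_vec_carrier[OF O3 w]
      have "qform (Omat S) (?x @\<^sub>v w) = ?x \<bullet> (O1 S *\<^sub>v ?x + (O2 S)\<^sup>T *\<^sub>v w) + w \<bullet> (O2 S *\<^sub>v ?x + O3 S *\<^sub>v w)"
        unfolding qform_def Ofb four_block_mat_mult_vec[OF O1 T2 O2 O3 x w]
        by (rule scalar_prod_append[OF x w add_carrier_vec[OF mv(1,2)] add_carrier_vec[OF mv(3,4)]])
      moreover have "?x \<bullet> ((O2 S)\<^sup>T *\<^sub>v w) = w \<bullet> (O2 S *\<^sub>v ?x)"
        using transpose_vec_mult_scalar[OF O2 x w] comm_scalar_prod[OF x mv(2)] by simp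
      ultimately show ?thesis
        unfolding scalar_prod_add_distrib[OF x mv(1,2)] scalar_prod_add_distrib[OF w mv(3,4)] by (simp add: qform_def)
    qed
    show ?thesis
      using B(3)[OF a w z] f11 f22 f21 f31 fP fO by simp
  qed
  have key: "qform (Omat S) d + s + 2 * (z \<bullet> (\<Phi> *\<^sub>v d)) + qform ?C z = s - reg U d + qform ?C (z + Ccal S *\<^sub>v (\<Phi> *\<^sub>v d))"
    if "d \<in> carrier_vec N" "z \<in> carrier_vec (N + M)" for d s z
    using qform_minv_complete[OF Ccal that(2) Psi_qform(1)[OF U that(1)]] Psi_qform(2)[OF U that(1)]
    by (simp add: \<Phi>_def)
  have "positive_semidefinite L \<longleftrightarrow> (\<forall>v \<in> carrier_vec (1 + (n * T + (N + M))). 0 \<le> qform L v)"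
    using B(1,2) by (auto simp: positive_semidefinite_def qform_def)
  also have "\<dots> \<longleftrightarrow> (\<forall>t. \<forall>w \<in> carrier_vec (n * T). reg U (t \<cdot>\<^sub>v x0 @\<^sub>v w) \<le> c * t\<^sup>2 + qform D w)"
  proof (intro iffI allI ballI)
    fix t and w :: "real vec"
    assume psd: "\<forall>v \<in> carrier_vec (1 + (n * T + (N + M))). 0 \<le> qform L v" and w: "w \<in> carrier_vec (n * T)"
    let ?d = "t \<cdot>\<^sub>v x0 @\<^sub>v w" let ?a = "vec 1 (\<lambda>_. t)"
    note d = delta[OF w, of t]
    note P = Psi_qform(1)[OF U d, folded \<Phi>_def]
    \<comment> \<open>\<open>z = - y\<close> is the minimizing choice, at which the completed square
      vanishes.\<close>
    define y where "y = Ccal S *\<^sub>v (\<Phi> *\<^sub>v ?d)"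
    have y: "y \<in> carrier_vec (N + M)" unfolding y_def by (rule mult_mat_vec_carrier[OF Ccal(1) P])
    have my: "- y \<in> carrier_vec (N + M)" using y by simp
    have a: "?a \<in> carrier_vec 1" "t = ?a $ 0" by (simp_all add: One_nat_def)
    have "?a @\<^sub>v (w @\<^sub>v - y) \<in> carrier_vec (1 + (n * T + (N + M)))"
      by (rule append_carrier_vec[OF a(1) append_carrier_vec[OF w my]])
    then have "0 \<le> qform L (?a @\<^sub>v (w @\<^sub>v - y))" using psd by blast
    also have "\<dots> = (c * t\<^sup>2 + qform D w) - reg U ?d + qform ?C (- y + y)"
      using form[OF a w my] key[OF d my, of "c * t\<^sup>2 + qform D w"] by (simp add: y_def add.assoc)
    also have "- y + y = 0\<^sub>v (N + M)" using y by simp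
    also have "qform ?C (0\<^sub>v (N + M)) = 0" using pC(1) mult_mat_vec_carrier[OF pC(1), of "0\<^sub>v (N + M)"] by (simp add: qform_def)
    finally show "reg U ?d \<le> c * t\<^sup>2 + qform D w" by simp
  next
    fix v :: "real vec"
    assume le: "\<forall>t. \<forall>w \<in> carrier_vec (n * T). reg U (t \<cdot>\<^sub>v x0 @\<^sub>v w) \<le> c * t\<^sup>2 + qform D w"
      and v: "v \<in> carrier_vec (1 + (n * T + (N + M)))"
    define a v' where "a = vec_first v 1" and "v' = vec_last v (n * T + (N + M))"
    define w z where "w = vec_first v' (n * T)" and "z = vec_last v' (N + M)"
    have a: "a \<in> carrier_vec 1" and v': "v' \<in> carrier_vec (n * T + (N + M))" and "v = a @\<^sub>v v'"
      using v by (simp_all add: a_def v'_def)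
    moreover have w: "w \<in> carrier_vec (n * T)" and z: "z \<in> carrier_vec (N + M)" and "v' = w @\<^sub>v z"
      using v' by (simp_all add: w_def z_def)
    ultimately have ve: "v = a @\<^sub>v (w @\<^sub>v z)" by simp
    define t where "t = a $ 0"
    note d = delta[OF w, of t]
    note P = Psi_qform(1)[OF U d, folded \<Phi>_def]
    have "0 \<le> qform ?C (z + Ccal S *\<^sub>v (\<Phi> *\<^sub>v (t \<cdot>\<^sub>v x0 @\<^sub>v w)))"
      by (rule posdef_carrierD(3)[OF pC(3,1)]) (rule add_carrier_vec[OF z mult_mat_vec_carrier[OF Ccal(1) P]])
    moreover have "reg U (t \<cdot>\<^sub>v x0 @\<^sub>v w) \<le> c * t\<^sup>2 + qform D w" using le w by blast
    ultimately show "0 \<le> qform L v"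
      using form[OF a t_def w z] key[OF d z, of "c * t\<^sup>2 + qform D w"] by (simp add: ve add.assoc)
  qed
  finally show ?thesis by (simp add: L_def \<Phi>_def)
qed

end

subsection \<open>Pointwise bounded disturbances\<close>

lemma qform_le_of_coords:
  assumes A: "A \<in> carrier_mat k k" and d: "d \<in> carrier_vec k" and s: "\<And>i. i < k \<Longrightarrow> (d $ i)\<^sup>2 \<le> s"
  shows "qform A d \<le> (\<Sum>i<k. \<Sum>j<k. \<bar>A $$ (i, j)\<bar>) * s"
proof -
  have "A $$ (i, j) * (d $ i * d $ j) \<le> \<bar>A $$ (i, j)\<bar> * s" if "i < k" "j < k" for i j
  proof -
    have "\<bar>d $ i * d $ j\<bar> \<le> s"
    proof -
      have "2 * \<bar>d $ i * d $ j\<bar> \<le> (d $ i)\<^sup>2 + (d $ j)\<^sup>2"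
        using zero_le_power2[of "\<bar>d $ i\<bar> - \<bar>d $ j\<bar>"] by (simp add: power2_diff abs_mult)
      then show ?thesis using s[OF that(1)] s[OF that(2)] by linarith
    qed
    then have "\<bar>A $$ (i, j)\<bar> * \<bar>d $ i * d $ j\<bar> \<le> \<bar>A $$ (i, j)\<bar> * s" by (intro mult_left_mono) auto
    moreover have "A $$ (i, j) * (d $ i * d $ j) \<le> \<bar>A $$ (i, j)\<bar> * \<bar>d $ i * d $ j\<bar>"
      unfolding abs_mult[symmetric, of "A $$ (i, j)"] by (rule abs_ge_self)
    ultimately show ?thesis by (rule order_trans[rotated])
  qed
  then show ?thesis
    unfolding qform_sum[OF A d] sum_distrib_right by (intro sum_mono) auto
qed

lemma qform_zero: "A \<in> carrier_mat k k \<Longrightarrow> qform A (0\<^sub>v k) = 0"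
  by (simp add: qform_sum[of _ k])

lemma coord_sq_le_scalar_prod:
  assumes "v \<in> carrier_vec k" "i < k"
  shows "(v $ i)\<^sup>2 \<le> v \<bullet> (v :: real vec)"
proof -
  have "(v $ i)\<^sup>2 \<le> (\<Sum>i<k. (v $ i)\<^sup>2)" using assms by (intro member_le_sum) auto
  then show ?thesis using assms by (simp add: scalar_prod_def atLeast0LessThan power2_eq_square)
qed

lemma scalar_prod_self_nonneg: "0 \<le> v \<bullet> (v :: real vec)"
  by (simp add: scalar_prod_def sum_nonneg)

locale pwb = lq +
  fixes P :: "real mat" and x0 :: "real vec" and \<omega> :: real
  assumes x0: "x0 \<in> carrier_vec (state_dim S)"
    and P: "P \<in> carrier_mat (state_dim S) (state_dim S)" "positive_definite P"
    and \<omega>: "0 < \<omega>" "\<And>w. w \<in> disturbance_sequences S P \<Longrightarrow> (vnorm w)\<^sup>2 \<le> \<omega>"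
begin

abbreviation "Ws \<equiv> disturbance_sequences S P"

lemma P': "P\<^sup>T = P" "v \<in> carrier_vec n \<Longrightarrow> 0 \<le> qform P v"
  using posdef_carrierD[OF P(2,1)] by auto

lemma Ws_iff: "w \<in> Ws \<longleftrightarrow> w \<in> carrier_vec (n * T) \<and> (\<forall>k < T. qform P (vblock n k w) \<le> 1)"
  by (auto simp: disturbance_sequences_def disturbance_set_def qform_def)

lemma Ws_carrier: "w \<in> Ws \<Longrightarrow> w \<in> carrier_vec (n * T)"
  by (simp add: Ws_iff)

lemma Ws_zero: "0\<^sub>v (n * T) \<in> Ws"
  by (simp add: Ws_iff vblock_zero qform_zero[OF P(1)])

lemma Ws_neg: "w \<in> Ws \<Longrightarrow> (- 1) \<cdot>\<^sub>v w \<in> Ws"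
  using qform_smult[OF P(1) vblock_carrier(1), of "- 1" ]
  by (auto simp: Ws_iff vblock_smult[of w n T])

lemma Ws_norm: "w \<in> Ws \<Longrightarrow> w \<bullet> w \<le> \<omega>"
  using \<omega>(2)[of w] scalar_prod_self_nonneg[of w] by (simp add: vnorm_def)

text \<open>Stacking \<open>T\<close> copies of one normalized vector gives an admissible disturbance sequence.\<close>

lemma norm_le_qform_P:
  assumes p: "p \<in> carrier_vec n"
  shows "p \<bullet> p \<le> \<omega> / real T * qform P p"
proof (cases "p = 0\<^sub>v n")
  case True
  then show ?thesis by (simp add: qform_zero[OF P(1)])
next
  case False
  define s where "s = qform P p"
  have s: "0 < s" unfolding s_def by (rule posdef_carrierD(2)[OF P(2,1) p False])
  define q where "q = (1 / sqrt s) \<cdot>\<^sub>v p"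
  have q: "q \<in> carrier_vec n" "qform P q = 1" "q \<bullet> q = p \<bullet> p / s"
    using p s by (auto simp: q_def qform_smult[OF P(1) p] power_divide s_def[symmetric])
  define w where "w = vec (n * T) (\<lambda>i. q $ (i mod n))"
  have w: "w \<in> carrier_vec (n * T)" by (simp add: w_def)
  have b: "vblock n k w = q" if "k < T" for k
    using q block_index_less[OF that] by (intro eq_vecI) (auto simp: vblock_index w_def div_mod_block)
  have "w \<in> Ws" using w b q by (simp add: Ws_iff)
  then have "w \<bullet> w \<le> \<omega>" by (rule Ws_norm)
  also have "w \<bullet> w = real T * (p \<bullet> p / s)"
    using scalar_prod_vblock[OF w w] b q by simp
  finally show ?thesis using s T_pos by (simp add: s_def[symmetric] field_simps)
qed

lemma norm_le_qform_blocks: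
  assumes w: "w \<in> carrier_vec (n * T)"
  shows "w \<bullet> w \<le> (\<Sum>i<T. \<omega> / real T * qform P (vblock n i w))"
  unfolding scalar_prod_vblock[OF w w] by (intro sum_mono norm_le_qform_P) simp

text \<open>\<open>t\<close> homogenizes the initial state: \<open>t = 1\<close> is the actual
  stacked disturbance, while the matrix inequality speaks about all \<open>t\<close>.\<close>

definition "dl t w = t \<cdot>\<^sub>v x0 @\<^sub>v w"

lemma dl_carrier [simp]: "w \<in> carrier_vec (n * T) \<Longrightarrow> dl t w \<in> carrier_vec N"
  using delta_carrier[of "t \<cdot>\<^sub>v x0" w] x0 by (simp add: dl_def)

lemma dl_index:
  assumes "w \<in> carrier_vec (n * T)" "i < N"
  shows "dl t w $ i = (if i < n then t * x0 $ i else w $ (i - n))"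
  using assms x0 NT by (auto simp: dl_def)

lemma dl_one: "dl 1 w = x0 @\<^sub>v w"
  by (simp add: dl_def)

lemma reg_qform:
  assumes "U \<in> carrier_mat M N" "d \<in> carrier_vec N"
  shows "reg U d = qform ((U - H)\<^sup>T * Wm * (U - H)) d"
  unfolding reg_def by (rule qform_transform[symmetric, OF Wm(1) UH_carrier[OF assms(1)] assms(2)])

lemma reg_carrier:
  assumes "U \<in> carrier_mat M N"
  shows "(U - H)\<^sup>T * Wm * (U - H) \<in> carrier_mat N N"
  by (intro mult_carrier_mat[of _ N M] UH_carrier[OF assms]) (use UH_carrier[OF assms] Wm(1) in auto)

text \<open>A bound of the shape used by the energy-bounded program, available for every response;
  it is what makes that program, and through it the other one, feasible. The factor
  \<open>1 + x0 \<bullet> x0\<close> covers the coordinates of \<open>t x0\<close> as well as those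
  of \<open>w\<close>.\<close>

lemma reg_upper_bound:
  assumes U: "U \<in> carrier_mat M N"
  shows "\<exists>c\<ge>0. \<forall>t. \<forall>w \<in> carrier_vec (n * T). reg U (dl t w) \<le> c * t\<^sup>2 + c * (w \<bullet> w)"
proof -
  define c where "c = (\<Sum>i<N. \<Sum>j<N. \<bar>((U - H)\<^sup>T * Wm * (U - H)) $$ (i, j)\<bar>) * (1 + x0 \<bullet> x0)"
  have "0 \<le> c" unfolding c_def
    by (intro mult_nonneg_nonneg sum_nonneg) (auto intro!: add_nonneg_nonneg scalar_prod_self_nonneg)
  moreover have "reg U (dl t w) \<le> c * t\<^sup>2 + c * (w \<bullet> w)" if w: "w \<in> carrier_vec (n * T)" for t w
  proof -
    have "(dl t w $ i)\<^sup>2 \<le> (1 + x0 \<bullet> x0) * (t\<^sup>2 + w \<bullet> w)" if i: "i < N" for i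
    proof (cases "i < n")
      case True
      have "(dl t w $ i)\<^sup>2 = t\<^sup>2 * (x0 $ i)\<^sup>2" using dl_index[OF w i] True by (simp add: power_mult_distrib)
      also have "\<dots> \<le> t\<^sup>2 * (x0 \<bullet> x0)" by (intro mult_left_mono coord_sq_le_scalar_prod[OF x0 True]) simp
      also have "\<dots> \<le> (1 + x0 \<bullet> x0) * (t\<^sup>2 + w \<bullet> w)"
        using scalar_prod_self_nonneg[of x0] scalar_prod_self_nonneg[of w]
        by (simp add: distrib_left distrib_right mult.commute)
      finally show ?thesis .
    next
      case False
      then have "i - n < n * T" using i NT by linarith
      then have "(dl t w $ i)\<^sup>2 \<le> w \<bullet> w"
        using dl_index[OF w i] False coord_sq_le_scalar_prod[OF w] by simp
      also have "\<dots> \<le> (1 + x0 \<bullet> x0) * (t\<^sup>2 + w \<bullet> w)"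
        using scalar_prod_self_nonneg[of x0] scalar_prod_self_nonneg[of w]
        by (simp add: distrib_left distrib_right)
      finally show ?thesis .
    qed
    from qform_le_of_coords[OF reg_carrier[OF U] dl_carrier[OF w] this]
    show ?thesis unfolding reg_qform[OF U dl_carrier[OF w]] by (simp add: c_def algebra_simps)
  qed
  ultimately show ?thesis by blast
qed

subsection \<open>Compactness of the set of responses\<close>

lemma mult_mat_vec_index_sum:
  assumes "A \<in> carrier_mat a b" "v \<in> carrier_vec b" "i < a"
  shows "(A *\<^sub>v v) $ i = (\<Sum>j<b. A $$ (i, j) * v $ j)"
  using assms by (auto simp: scalar_prod_def atLeast0LessThan)

lemma sum_split_N:
  fixes f :: "nat \<Rightarrow> real"
  shows "(\<Sum>j<N. f j) = (\<Sum>j<n. f j) + (\<Sum>j<n * T. f (n + j))"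
  using sum.atLeastLessThan_concat[of 0 n N f] sum.shift_bounds_nat_ivl[of f 0 n "n * T"] NT
  by (simp add: atLeast0LessThan add.commute)

lemma mult_dl_index:
  assumes U: "U \<in> carrier_mat M N" and w: "w \<in> carrier_vec (n * T)" and i: "i < M"
  shows "(U *\<^sub>v dl t w) $ i = t * (\<Sum>j<n. U $$ (i, j) * x0 $ j) + (\<Sum>j<n * T. U $$ (i, n + j) * w $ j)"
proof -
  have "(U *\<^sub>v dl t w) $ i = (\<Sum>j<n. U $$ (i, j) * dl t w $ j) + (\<Sum>j<n * T. U $$ (i, n + j) * dl t w $ (n + j))"
    unfolding mult_mat_vec_index_sum[OF U dl_carrier[OF w] i] by (rule sum_split_N)
  also have "(\<Sum>j<n. U $$ (i, j) * dl t w $ j) = (\<Sum>j<n. t * (U $$ (i, j) * x0 $ j))"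
    using NT by (intro sum.cong refl) (subst dl_index[OF w], auto)
  also have "(\<Sum>j<n * T. U $$ (i, n + j) * dl t w $ (n + j)) = (\<Sum>j<n * T. U $$ (i, n + j) * w $ j)"
  proof (rule sum.cong[OF refl])
    fix j assume "j \<in> {..<n * T}"
    then have "n + j < N" using NT by simp
    from dl_index[OF w this, of t] show "U $$ (i, n + j) * dl t w $ (n + j) = U $$ (i, n + j) * w $ j" by simp
  qed
  finally show ?thesis by (simp add: sum_distrib_left)
qed

text \<open>Only \<open>U\<close> applied to \<open>x0\<close> matters of the first \<open>n\<close> columns of \<open>U\<close>, so these columns can be replaced
  by a rank-one matrix that is controlled by this product.\<close>

definition "trim U = Matrix.mat M N (\<lambda>(i, j).
  if j < n then (\<Sum>l<n. U $$ (i, l) * x0 $ l) * (x0 $ j / (x0 \<bullet> x0)) else U $$ (i, j))"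

lemma trim:
  assumes U: "causal_controller S U"
  shows "causal_controller S (trim U)" "w \<in> carrier_vec (n * T) \<Longrightarrow> trim U *\<^sub>v dl t w = U *\<^sub>v dl t w"
    "w \<in> carrier_vec (n * T) \<Longrightarrow> reg (trim U) (dl t w) = reg U (dl t w)"
proof -
  note u = causalD[OF U]
  have c: "trim U \<in> carrier_mat M N" by (simp add: trim_def)
  have "block_lower_triangular m n (trim U)"
    using u(1) u(2) unfolding block_lower_triangular_def by (auto simp: trim_def)
  with c show "causal_controller S (trim U)" by (simp add: causal_controller_def)
  show e: "trim U *\<^sub>v dl t w = U *\<^sub>v dl t w" if w: "w \<in> carrier_vec (n * T)" for t w
  proof (rule eq_vecI)
    show "dim_vec (trim U *\<^sub>v dl t w) = dim_vec (U *\<^sub>v dl t w)" using c u(1) by auto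
    fix i assume "i < dim_vec (U *\<^sub>v dl t w)"
    then have i: "i < M" using u(1) by auto
    let ?p = "\<Sum>l<n. U $$ (i, l) * x0 $ l"
    have "(\<Sum>j<n. trim U $$ (i, j) * x0 $ j) = (\<Sum>j<n. ?p * (x0 $ j / (x0 \<bullet> x0)) * x0 $ j)"
    proof (rule sum.cong[OF refl])
      fix j assume "j \<in> {..<n}"
      then have "j < n" "j < N" using NT by auto
      then show "trim U $$ (i, j) * x0 $ j = ?p * (x0 $ j / (x0 \<bullet> x0)) * x0 $ j" using i by (simp add: trim_def)
    qed
    also have "\<dots> = ?p * ((\<Sum>j<n. x0 $ j * x0 $ j) / (x0 \<bullet> x0))"
      unfolding sum_divide_distrib sum_distrib_left by (rule sum.cong) auto
    also have "(\<Sum>j<n. x0 $ j * x0 $ j) = x0 \<bullet> x0" using x0 by (simp add: scalar_prod_def atLeast0LessThan)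
    also have "?p * (x0 \<bullet> x0 / (x0 \<bullet> x0)) = ?p"
    \<comment> \<open>If \<open>x0\<close> vanishes, division by zero makes the first columns of
      \<open>trim U\<close> zero, and \<open>?p\<close> is zero as well.\<close>
    proof (cases "x0 \<bullet> x0 = 0")
      case True
      have "x0 $ l = 0" if "l < n" for l
        using coord_sq_le_scalar_prod[OF x0 that] True by simp
      then have "?p = 0" by (intro sum.neutral) auto
      then show ?thesis by simp
    qed simp
    finally have 1: "(\<Sum>j<n. trim U $$ (i, j) * x0 $ j) = ?p" .
    have "(\<Sum>j<n * T. trim U $$ (i, n + j) * w $ j) = (\<Sum>j<n * T. U $$ (i, n + j) * w $ j)"
    proof (rule sum.cong[OF refl])
      fix j assume "j \<in> {..<n * T}"
      then have "n + j < N" using NT by simp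
      then show "trim U $$ (i, n + j) * w $ j = U $$ (i, n + j) * w $ j" using i by (simp add: trim_def)
    qed
    then show "(trim U *\<^sub>v dl t w) $ i = (U *\<^sub>v dl t w) $ i"
      unfolding mult_dl_index[OF c w i] mult_dl_index[OF u(1) w i] 1 by simp
  qed
  show "reg (trim U) (dl t w) = reg U (dl t w)" if w: "w \<in> carrier_vec (n * T)" for t w
  proof -
    note d = dl_carrier[OF w, of t]
    have "(trim U - H) *\<^sub>v dl t w = (U - H) *\<^sub>v dl t w"
      unfolding minus_mult_distrib_mat_vec[OF c H_carrier d] minus_mult_distrib_mat_vec[OF u(1) H_carrier d] e[OF w] ..
    then show ?thesis by (simp add: reg_def)
  qed
qed

text \<open>By \<open>posdef_coord_bound\<close> the regret bounds every coordinate of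
  \<open>(U - H) \<delta>\<close>. The value at \<open>w = 0\<close> controls \<open>U\<close>
  applied to \<open>x0\<close>; subtracting it from the value at a small multiple of a unit vector
  isolates one entry of the later columns.\<close>

lemma trim_bounded:
  "\<exists>B. \<forall>U. causal_controller S U \<longrightarrow> (\<forall>w \<in> Ws. reg U (dl 1 w) \<le> r) \<longrightarrow>
     (\<forall>i<M. \<forall>j<N. \<bar>trim U $$ (i, j)\<bar> \<le> B i j)"
proof -
  define c where "c i = sqrt (minv Wm $$ (i, i) * r)" for i
  \<comment> \<open>At least 1 and at least every diagonal entry of \<open>P\<close>, so that
    \<open>e\<close> times a unit vector is admissible.\<close>
  define p where "p = 1 + (\<Sum>a<n. \<bar>P $$ (a, a)\<bar>)"
  have p: "1 \<le> p" by (simp add: p_def sum_nonneg)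
  define e where "e = 1 / sqrt p"
  have e: "0 < e" "e\<^sup>2 * p = 1" using p by (auto simp: e_def power_divide)
  have unit: "e \<cdot>\<^sub>v unit_vec (n * T) j \<in> Ws" if j: "j < n * T" for j
  proof -
    have "qform P (vblock n k (e \<cdot>\<^sub>v unit_vec (n * T) j)) \<le> 1" if k: "k < T" for k
    proof -
      have "qform P (vblock n k (unit_vec (n * T) j)) \<le> p"
      proof (cases "k = j div n")
        case True
        note dj = div_less_of_less_mult[OF j]
        have "vblock n k (unit_vec (n * T) j) = unit_vec n (j mod n)"
        proof (rule eq_vecI)
          fix a assume "a < dim_vec (unit_vec n (j mod n) :: real vec)"
          then have a: "a < n" by simp
          have "k * n + a = j \<longleftrightarrow> a = j mod n"
            using div_mod_block[OF a, of k] True by (metis div_mult_mod_eq)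
          then show "vblock n k (unit_vec (n * T) j) $ a = unit_vec n (j mod n) $ a"
            using a block_index_less[OF k a] j dj by (simp add: vblock_index)
        qed simp
        moreover have "qform P (unit_vec n (j mod n)) = P $$ (j mod n, j mod n)"
          unfolding qform_def using P(1) dj by simp
        ultimately show ?thesis
          using dj member_le_sum[of "j mod n" "{..<n}" "\<lambda>a. \<bar>P $$ (a, a)\<bar>"] by (simp add: p_def)
      next
        case False
        have "vblock n k (unit_vec (n * T) j) = 0\<^sub>v n"
        proof (rule eq_vecI)
          fix a assume "a < dim_vec (0\<^sub>v n :: real vec)"
          then have a: "a < n" by simp
          have "k * n + a \<noteq> j" using div_mod_block(1)[OF a, of k] False by auto
          then show "vblock n k (unit_vec (n * T) j) $ a = 0\<^sub>v n $ a"
            using a block_index_less[OF k a] j by (simp add: vblock_index)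
        qed simp
        then show ?thesis using p by (simp add: qform_zero[OF P(1)])
      qed
      then have "e\<^sup>2 * qform P (vblock n k (unit_vec (n * T) j)) \<le> e\<^sup>2 * p" by (intro mult_left_mono) auto
      then show ?thesis
        using vblock_smult[OF unit_vec_carrier[of "n * T" j] k] qform_smult[OF P(1) vblock_carrier(1)] e(2) by simp
    qed
    then show ?thesis by (simp add: Ws_iff)
  qed
  define h where "h i = \<bar>\<Sum>l<n. H $$ (i, l) * x0 $ l\<bar>" for i
  \<comment> \<open>The factor 2 comes from subtracting two quantities bounded by
    \<open>c i\<close>: the values at \<open>e\<close> times a unit vector and at 0.\<close>
  define B where "B i j = (if j < n then (h i + c i) * \<bar>x0 $ j / (x0 \<bullet> x0)\<bar> else \<bar>H $$ (i, j)\<bar> + 2 * c i / e)" for i j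
  show ?thesis
  proof (intro exI[of _ B] allI impI)
    fix U i j assume U: "causal_controller S U" and r: "\<forall>w \<in> Ws. reg U (dl 1 w) \<le> r" and i: "i < M" and j: "j < N"
    note u = causalD(1)[OF U]
    have UH: "U - H \<in> carrier_mat M N" by (rule UH_carrier[OF u])
    have UHi: "(U - H) $$ (i, l) = U $$ (i, l) - H $$ (i, l)" if "l < N" for l
      using that i carrier_matD[OF H_carrier] by simp
    have bd: "\<bar>((U - H) *\<^sub>v dl 1 w) $ i\<bar> \<le> c i" if w: "w \<in> Ws" for w
    proof -
      note d = dl_carrier[OF Ws_carrier[OF w], of 1]
      have "(((U - H) *\<^sub>v dl 1 w) $ i)\<^sup>2 \<le> minv Wm $$ (i, i) * reg U (dl 1 w)"
        unfolding reg_def by (rule posdef_coord_bound[OF Wm mult_mat_vec_carrier[OF UH d] i])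
      also have "\<dots> \<le> minv Wm $$ (i, i) * r"
      proof (rule mult_left_mono)
        have "(unit_vec M i $ i)\<^sup>2 \<le> minv Wm $$ (i, i) * qform Wm (unit_vec M i)"
          by (rule posdef_coord_bound[OF Wm unit_vec_carrier i])
        moreover have "0 \<le> qform Wm (unit_vec M i)" by (rule posdef_carrierD(3)[OF Wm(2,1) unit_vec_carrier])
        ultimately have "0 < minv Wm $$ (i, i) * qform Wm (unit_vec M i)" using i by simp
        then show "0 \<le> minv Wm $$ (i, i)" using \<open>0 \<le> qform Wm (unit_vec M i)\<close>
          by (simp add: zero_less_mult_iff)
      qed (use r w in blast)
      finally show ?thesis unfolding c_def by (intro real_le_rsqrt) simp
    qed
    have z: "\<bar>\<Sum>l<n. (U - H) $$ (i, l) * x0 $ l\<bar> \<le> c i"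
      using bd[OF Ws_zero] unfolding mult_dl_index[OF UH Ws_carrier[OF Ws_zero] i] by simp
    show "\<bar>trim U $$ (i, j)\<bar> \<le> B i j"
    proof (cases "j < n")
      case True
      have "(\<Sum>l<n. (U - H) $$ (i, l) * x0 $ l) = (\<Sum>l<n. U $$ (i, l) * x0 $ l - H $$ (i, l) * x0 $ l)"
      proof (rule sum.cong[OF refl])
        fix l assume "l \<in> {..<n}"
        then have "l < N" using NT by auto
        from UHi[OF this] show "(U - H) $$ (i, l) * x0 $ l = U $$ (i, l) * x0 $ l - H $$ (i, l) * x0 $ l"
          by (simp add: left_diff_distrib)
      qed
      then have "\<bar>\<Sum>l<n. U $$ (i, l) * x0 $ l\<bar> \<le> h i + c i" using z by (simp add: sum_subtractf h_def)
      then have "\<bar>\<Sum>l<n. U $$ (i, l) * x0 $ l\<bar> * \<bar>x0 $ j / (x0 \<bullet> x0)\<bar> \<le> (h i + c i) * \<bar>x0 $ j / (x0 \<bullet> x0)\<bar>"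
        by (intro mult_right_mono) auto
      then show ?thesis using True i j by (simp add: trim_def B_def abs_mult)
    next
      case False
      define j' where "j' = j - n"
      have j': "j' < n * T" "j = n + j'" using False j NT by (auto simp: j'_def)
      let ?e = "e \<cdot>\<^sub>v unit_vec (n * T) j'"
      have "(\<Sum>l<n * T. (U - H) $$ (i, n + l) * ?e $ l) = (\<Sum>l<n * T. if l = j' then (U - H) $$ (i, n + l) * e else 0)"
        using j' by (intro sum.cong) auto
      also have "\<dots> = (U - H) $$ (i, j) * e" using j' by simp
      finally have "((U - H) *\<^sub>v dl 1 ?e) $ i = (\<Sum>l<n. (U - H) $$ (i, l) * x0 $ l) + (U - H) $$ (i, j) * e"
        unfolding mult_dl_index[OF UH Ws_carrier[OF unit[OF j'(1)]] i] by simp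
      then have "\<bar>(U - H) $$ (i, j) * e\<bar> \<le> 2 * c i" using bd[OF unit[OF j'(1)]] z by linarith
      then have "\<bar>U $$ (i, j) - H $$ (i, j)\<bar> \<le> 2 * c i / e"
        using e(1) UHi[OF j] by (simp add: abs_mult pos_le_divide_eq)
      then show ?thesis using False i j by (simp add: trim_def B_def)
    qed
  qed
qed

lemma reg_tendsto:
  assumes U: "\<And>k. Us k \<in> carrier_mat M N" "U \<in> carrier_mat M N" and d: "\<And>k. ds k \<in> carrier_vec N" "d \<in> carrier_vec N"
    and lim: "\<And>i j. i < M \<Longrightarrow> j < N \<Longrightarrow> (\<lambda>k. Us k $$ (i, j)) \<longlonglongrightarrow> U $$ (i, j)"
      "\<And>j. j < N \<Longrightarrow> (\<lambda>k. ds k $ j) \<longlonglongrightarrow> d $ j"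
  shows "(\<lambda>k. reg (Us k) (ds k)) \<longlonglongrightarrow> reg U d"
proof -
  have e: "reg V b = (\<Sum>i<M. \<Sum>j<M. Wm $$ (i, j) *
     ((\<Sum>l<N. (V $$ (i, l) - H $$ (i, l)) * b $ l) * (\<Sum>l<N. (V $$ (j, l) - H $$ (j, l)) * b $ l)))"
    if V: "V \<in> carrier_mat M N" and b: "b \<in> carrier_vec N" for V b
  proof -
    have *: "((V - H) *\<^sub>v b) $ i = (\<Sum>l<N. (V $$ (i, l) - H $$ (i, l)) * b $ l)" if i: "i < M" for i
      unfolding mult_mat_vec_index_sum[OF UH_carrier[OF V] b i]
      using i carrier_matD[OF H_carrier] by (intro sum.cong) auto
    show ?thesis
      unfolding reg_def qform_sum[OF Wm(1) mult_mat_vec_carrier[OF UH_carrier[OF V] b]]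
      by (intro sum.cong refl) (simp add: *)
  qed
  show ?thesis unfolding e[OF U(1) d(1)] e[OF U(2) d(2)]
    by (intro tendsto_sum tendsto_mult tendsto_diff tendsto_const lim) auto
qed

text \<open>The admissible set is closed, and the energy bound keeps its coordinates within
  \<open>sqrt \<omega>\<close>. The maximum is obtained as a minimum of the negated regret.\<close>

lemma has_greatest_reg:
  assumes U: "U \<in> carrier_mat M N"
  shows "has_greatest (\<lambda>r. \<exists>w \<in> Ws. r = reg U (dl 1 w))"
proof -
  define C where "C r f \<longleftrightarrow> vec (n * T) f \<in> Ws \<and> r = - reg U (dl 1 (vec (n * T) f))" for r :: real and f
  obtain c where c: "0 \<le> c" "\<And>t w. w \<in> carrier_vec (n * T) \<Longrightarrow> reg U (dl t w) \<le> c * t\<^sup>2 + c * (w \<bullet> w)"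
    using reg_upper_bound[OF U] by blast
  have "has_least (\<lambda>r. \<exists>f. C r f)"
  proof (rule has_least_of_compact[where I = "{..<n * T}" and b = "- (c + c * \<omega>)" and B = "\<lambda>_. sqrt \<omega>"
        and ?r0.0 = "- reg U (dl 1 (0\<^sub>v (n * T)))" and ?f0.0 = "\<lambda>_. 0"])
    have "vec (n * T) (\<lambda>_. 0) = (0\<^sub>v (n * T) :: real vec)" by auto
    then show "C (- reg U (dl 1 (0\<^sub>v (n * T)))) (\<lambda>_. 0)" using Ws_zero by (simp add: C_def)
  next
    fix r f assume C: "C r f"
    then have w: "vec (n * T) f \<in> Ws" by (simp add: C_def)
    have "c * (vec (n * T) f \<bullet> vec (n * T) f) \<le> c * \<omega>" by (intro mult_left_mono Ws_norm[OF w] c(1))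
    then show "- (c + c * \<omega>) \<le> r"
      using c(2)[OF Ws_carrier[OF w], of 1] C by (simp add: C_def)
    have "\<bar>f i\<bar> \<le> sqrt \<omega>" if "i < n * T" for i
      using coord_sq_le_scalar_prod[OF Ws_carrier[OF w] that] Ws_norm[OF w] that by (intro real_le_rsqrt) simp
    then show "\<exists>g. C r g \<and> (\<forall>i\<in>{..<n * T}. \<bar>g i\<bar> \<le> sqrt \<omega>)" using C by auto
  next
    fix rs fs r f assume C: "\<And>k. C (rs k) (fs k)" and r: "rs \<longlonglongrightarrow> r"
      and f: "\<And>i. i \<in> {..<n * T} \<Longrightarrow> (\<lambda>k. fs k i) \<longlonglongrightarrow> f i"
    let ?w = "\<lambda>f. vec (n * T) f"
    have q: "(\<lambda>k. qform P (vblock n a (?w (fs k)))) \<longlonglongrightarrow> qform P (vblock n a (?w f))" if a: "a < T" for a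
      unfolding qform_sum[OF P(1) vblock_carrier(1)]
      using block_index_less[OF a]
      by (intro tendsto_sum tendsto_mult tendsto_const) (simp_all add: vblock_index f)
    have "qform P (vblock n a (?w f)) \<le> 1" if a: "a < T" for a
      using C a by (intro LIMSEQ_le_const2[OF q[OF a]]) (auto simp: C_def Ws_iff)
    then have "?w f \<in> Ws" by (simp add: Ws_iff)
    moreover have "(\<lambda>k. reg U (dl 1 (?w (fs k)))) \<longlonglongrightarrow> reg U (dl 1 (?w f))"
    proof (rule reg_tendsto)
      fix j assume j: "j < N"
      show "(\<lambda>k. dl 1 (?w (fs k)) $ j) \<longlonglongrightarrow> dl 1 (?w f) $ j"
      proof (cases "j < n")
        case False
        then have "j - n < n * T" using j NT by linarith
        then show ?thesis using f False by (simp add: dl_index[OF _ j])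
      qed (simp add: dl_index[OF _ j])
    qed (use U in auto)
    then have "(\<lambda>k. - rs k) \<longlonglongrightarrow> reg U (dl 1 (?w f))" using C by (simp add: C_def)
    then have "- r = reg U (dl 1 (?w f))" using tendsto_minus[OF r] by (rule LIMSEQ_unique[rotated])
    ultimately show "C r f" by (simp add: C_def)
  qed simp
  then obtain v f where v: "C v f" "\<And>y g. C y g \<Longrightarrow> v \<le> y" by (auto simp: has_least_def)
  show ?thesis unfolding has_greatest_def
  proof (intro exI[of _ "- v"] conjI allI impI)
    show "\<exists>w \<in> Ws. - v = reg U (dl 1 w)" using v(1) by (auto simp: C_def)
    fix y assume "\<exists>w \<in> Ws. y = reg U (dl 1 w)"
    then obtain w where w: "w \<in> Ws" "y = reg U (dl 1 w)" by blast
    have "w = vec (n * T) (\<lambda>i. w $ i)" using Ws_carrier[OF w(1)] by auto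
    then have "C (- y) (\<lambda>i. w $ i)" using w by (simp add: C_def)
    from v(2)[OF this] show "y \<le> - v" by simp
  qed
qed

text \<open>All three minimization problems have this form: \<open>b\<close> bounds the regret and \<open>L\<close> constrains the
  remaining variables \<open>l\<close> in terms of the objective value.\<close>

lemma has_least_response:
  fixes b :: "real \<Rightarrow> real vec \<Rightarrow> real \<Rightarrow> real vec \<Rightarrow> real" and L :: "real \<Rightarrow> real vec \<Rightarrow> bool"
    and D :: "(real \<times> real vec) set" and k :: nat
  defines "C \<equiv> \<lambda>r l U. causal_controller S U \<and> l \<in> carrier_vec k \<and> L r l \<and>
      (\<forall>(t, w) \<in> D. reg U (dl t w) \<le> b r l t w)"
  assumes D: "D \<subseteq> UNIV \<times> carrier_vec (n * T)"
    and ex: "C r0 l0 U0"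
    and regret: "\<And>r l U w. C r l U \<Longrightarrow> w \<in> Ws \<Longrightarrow> reg U (dl 1 w) \<le> r"
    and bounded: "\<And>r l U i. C r l U \<Longrightarrow> r \<le> r0 \<Longrightarrow> i < k \<Longrightarrow> \<bar>l $ i\<bar> \<le> Bl"
    and L_closed: "\<And>rs ls r l. (\<And>j. L (rs j) (ls j)) \<Longrightarrow> (\<And>j. ls j \<in> carrier_vec k) \<Longrightarrow> l \<in> carrier_vec k \<Longrightarrow>
       rs \<longlonglongrightarrow> r \<Longrightarrow> (\<And>i. i < k \<Longrightarrow> (\<lambda>j. ls j $ i) \<longlonglongrightarrow> l $ i) \<Longrightarrow> L r l"
    and b_lim: "\<And>rs ls r l t w. (\<And>j. ls j \<in> carrier_vec k) \<Longrightarrow> l \<in> carrier_vec k \<Longrightarrow>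
       rs \<longlonglongrightarrow> r \<Longrightarrow> (\<And>i. i < k \<Longrightarrow> (\<lambda>j. ls j $ i) \<longlonglongrightarrow> l $ i) \<Longrightarrow>
       (\<lambda>j. b (rs j) (ls j) t w) \<longlonglongrightarrow> b r l t w"
  shows "has_least (\<lambda>r. \<exists>l U. C r l U)"
proof -
  \<comment> \<open>The unknowns \<open>U\<close> and \<open>l\<close> are packed into one function
    on a sum type, the format that \<open>has_least_of_compact\<close> expects.\<close>
  define mU where "mU f = Matrix.mat M N (\<lambda>ij. f (Inl ij))" for f :: "(nat \<times> nat) + nat \<Rightarrow> real"
  define vl where "vl f = vec k (\<lambda>i. f (Inr i))" for f :: "(nat \<times> nat) + nat \<Rightarrow> real"
  define enc where "enc l U = (\<lambda>x. case x of Inl ij \<Rightarrow> U $$ ij | Inr i \<Rightarrow> l $ i)" for l :: "real vec" and U :: "real mat"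
  have dec: "mU (enc l U) = U" "vl (enc l U) = l" if "U \<in> carrier_mat M N" "l \<in> carrier_vec k" for l U
    using that by (auto simp: mU_def vl_def enc_def)
  have mUc: "mU f \<in> carrier_mat M N" and vlc: "vl f \<in> carrier_vec k" for f by (simp_all add: mU_def vl_def)
  obtain B where B: "\<And>U i j. causal_controller S U \<Longrightarrow> \<forall>w \<in> Ws. reg U (dl 1 w) \<le> r0 \<Longrightarrow> i < M \<Longrightarrow> j < N \<Longrightarrow>
      \<bar>trim U $$ (i, j)\<bar> \<le> B i j"
    using trim_bounded[of r0] by blast
  have dec': "C r (vl (enc l U)) (mU (enc l U))" if "C r l U" for r l U
  proof -
    have "U \<in> carrier_mat M N" "l \<in> carrier_vec k" using that causalD(1) by (auto simp: C_def)
    from dec[OF this] that show ?thesis by simp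
  qed
  have "has_least (\<lambda>r. \<exists>f. C r (vl f) (mU f))"
  proof (rule has_least_of_compact[where I = "Inl ` ({..<M} \<times> {..<N}) \<union> Inr ` {..<k}" and b = 0
        and B = "\<lambda>x. case x of Inl ij \<Rightarrow> B (fst ij) (snd ij) | Inr i \<Rightarrow> Bl" and ?r0.0 = r0 and ?f0.0 = "enc l0 U0"])
    show "C r0 (vl (enc l0 U0)) (mU (enc l0 U0))" by (rule dec'[OF ex])
  next
    fix r f assume C: "C r (vl f) (mU f)"
    show "0 \<le> r"
      using reg_nonneg[OF mUc dl_carrier[OF Ws_carrier[OF Ws_zero]]] regret[OF C Ws_zero] by (rule order_trans)
    assume r: "r \<le> r0"
    have U: "causal_controller S (mU f)" using C by (simp add: C_def)
    \<comment> \<open>Trimming keeps all constraints, because \<open>reg\<close> is evaluated only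
      at arguments of the form \<open>dl t w\<close>.\<close>
    have CU: "C r (vl f) (trim (mU f))"
    proof -
      have "reg (trim (mU f)) (dl t w) \<le> b r (vl f) t w" if tw: "(t, w) \<in> D" for t w
      proof -
        have "w \<in> carrier_vec (n * T)" using tw D by auto
        from trim(3)[OF U this] show ?thesis using C tw by (auto simp: C_def)
      qed
      then show ?thesis using C trim(1)[OF U] by (auto simp: C_def)
    qed
    show "\<exists>g. C r (vl g) (mU g) \<and> (\<forall>i \<in> Inl ` ({..<M} \<times> {..<N}) \<union> Inr ` {..<k}.
        \<bar>g i\<bar> \<le> (case i of Inl ij \<Rightarrow> B (fst ij) (snd ij) | Inr i \<Rightarrow> Bl))"
    proof (intro exI[of _ "enc (vl f) (trim (mU f))"] conjI ballI)
      show "C r (vl (enc (vl f) (trim (mU f)))) (mU (enc (vl f) (trim (mU f))))" by (rule dec'[OF CU])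
      have reg: "\<forall>w \<in> Ws. reg (mU f) (dl 1 w) \<le> r0" using regret[OF C] r by fastforce
      fix x assume "x \<in> Inl ` ({..<M} \<times> {..<N}) \<union> Inr ` {..<k}"
      then show "\<bar>enc (vl f) (trim (mU f)) x\<bar> \<le> (case x of Inl ij \<Rightarrow> B (fst ij) (snd ij) | Inr i \<Rightarrow> Bl)"
      proof
        assume "x \<in> Inl ` ({..<M} \<times> {..<N})"
        then obtain i j where "x = Inl (i, j)" "i < M" "j < N" by auto
        with B[OF U reg] show ?thesis by (simp add: enc_def)
      next
        assume "x \<in> Inr ` {..<k}"
        with bounded[OF C r] show ?thesis by (auto simp: enc_def)
      qed
    qed
  next
    fix rs fs r f assume C: "\<And>j. C (rs j) (vl (fs j)) (mU (fs j))" and r: "rs \<longlonglongrightarrow> r"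
      and f: "\<And>x. x \<in> Inl ` ({..<M} \<times> {..<N}) \<union> Inr ` {..<k} \<Longrightarrow> (\<lambda>j. fs j x) \<longlonglongrightarrow> f x"
    have lU: "(\<lambda>a. mU (fs a) $$ (i, j)) \<longlonglongrightarrow> mU f $$ (i, j)" if "i < M" "j < N" for i j
      using f[of "Inl (i, j)"] that by (simp add: mU_def)
    have ll: "(\<lambda>a. vl (fs a) $ i) \<longlonglongrightarrow> vl f $ i" if "i < k" for i
      using f[of "Inr i"] that by (simp add: vl_def)
    have "mU f $$ (i, j) = 0" if ij: "i < M" "j < N" "i div m < j div n" for i j
    proof -
      have "mU (fs a) $$ (i, j) = 0" for a
        using C[of a] ij mUc[of "fs a"] unfolding C_def causal_controller_def block_lower_triangular_def by auto
      then show ?thesis using lU[OF ij(1,2)] by (simp add: LIMSEQ_const_iff)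
    qed
    then have "causal_controller S (mU f)"
      unfolding causal_controller_def block_lower_triangular_def by (auto simp: mU_def)
    moreover have "L r (vl f)"
      using C by (intro L_closed[OF _ vlc vlc r ll]) (auto simp: C_def)
    moreover have "reg (mU f) (dl t w) \<le> b r (vl f) t w" if tw: "(t, w) \<in> D" for t w
    proof (rule LIMSEQ_le)
      have w: "w \<in> carrier_vec (n * T)" using tw D by auto
      show "(\<lambda>a. reg (mU (fs a)) (dl t w)) \<longlonglongrightarrow> reg (mU f) (dl t w)"
        by (rule reg_tendsto[OF mUc mUc dl_carrier[OF w] dl_carrier[OF w] lU tendsto_const])
      show "(\<lambda>a. b (rs a) (vl (fs a)) t w) \<longlonglongrightarrow> b r (vl f) t w"
        by (rule b_lim[OF vlc vlc r ll])
      show "\<exists>a0. \<forall>a\<ge>a0. reg (mU (fs a)) (dl t w) \<le> b (rs a) (vl (fs a)) t w"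
      proof (intro exI[of _ 0] allI impI)
        fix a
        show "reg (mU (fs a)) (dl t w) \<le> b (rs a) (vl (fs a)) t w"
          using C[of a] tw unfolding C_def by blast
      qed
    qed
    ultimately show "C r (vl f) (mU f)" using vlc by (auto simp: C_def)
  qed auto
  then obtain v f where v: "C v (vl f) (mU f)" "\<And>y g. C y (vl g) (mU g) \<Longrightarrow> v \<le> y"
    by (auto simp: has_least_def)
  show ?thesis unfolding has_least_def using v dec' by blast
qed

end

lemma qform_scale_mat:
  assumes "A \<in> carrier_mat k k" "v \<in> carrier_vec k"
  shows "qform (c \<cdot>\<^sub>m A) v = c * qform A v"
  using assms by (simp add: qform_sum[of _ k] sum_distrib_left mult.assoc)

subsection \<open>Affine dependence of the constraints on the variables\<close>

text \<open>Constant blocks of the matrix inequality survive because the weights sum to one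
  (\<open>aff_same\<close>); this is why the combinations are affine. The following lemmas let
  \<open>aff\<close> commute with each matrix constructor involved.\<close>

definition "aff t A B = t \<cdot>\<^sub>m A + (1 - t) \<cdot>\<^sub>m B" for t :: real and A B :: "real mat"

lemma aff_carrier: "A \<in> carrier_mat a b \<Longrightarrow> B \<in> carrier_mat a b \<Longrightarrow> aff t A B \<in> carrier_mat a b"
  by (simp add: aff_def)

lemma aff_index: "i < a \<Longrightarrow> j < b \<Longrightarrow> A \<in> carrier_mat a b \<Longrightarrow> B \<in> carrier_mat a b \<Longrightarrow>
    aff t A B $$ (i, j) = t * A $$ (i, j) + (1 - t) * B $$ (i, j)"
  by (auto simp: aff_def)

lemma aff_same: "aff t A A = A"
  by (intro eq_matI) (auto simp: aff_def algebra_simps)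

lemma aff_transpose: "A \<in> carrier_mat a b \<Longrightarrow> B \<in> carrier_mat a b \<Longrightarrow> (aff t A B)\<^sup>T = aff t (A\<^sup>T) (B\<^sup>T)"
  by (intro eq_matI) (auto simp: aff_def)

lemma aff_mult_right:
  assumes "A \<in> carrier_mat a b" "B \<in> carrier_mat a b" "X \<in> carrier_mat b c"
  shows "aff t A B * X = aff t (A * X) (B * X)"
  using assms by (simp add: aff_def add_mult_distrib_mat[of _ a b] mult_smult_assoc_mat[of _ a b])

lemma aff_mult_left:
  assumes "A \<in> carrier_mat b c" "B \<in> carrier_mat b c" "X \<in> carrier_mat a b"
  shows "X * aff t A B = aff t (X * A) (X * B)"
  unfolding aff_def
  using mult_add_distrib_mat[OF assms(3), of "t \<cdot>\<^sub>m A" c "(1 - t) \<cdot>\<^sub>m B"] mult_smult_distrib[OF assms(3,1)]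
    mult_smult_distrib[OF assms(3,2)] assms by simp

lemma aff_four_block:
  assumes "A \<in> carrier_mat a c" "A' \<in> carrier_mat a c" "B \<in> carrier_mat a d" "B' \<in> carrier_mat a d"
    "C \<in> carrier_mat b c" "C' \<in> carrier_mat b c" "D \<in> carrier_mat b d" "D' \<in> carrier_mat b d"
  shows "four_block_mat (aff t A A') (aff t B B') (aff t C C') (aff t D D') =
    aff t (four_block_mat A B C D) (four_block_mat A' B' C' D')"
  using assms by (intro eq_matI) (auto simp: aff_def)

lemma aff_append:
  assumes "A \<in> carrier_mat a c" "A' \<in> carrier_mat a c" "B \<in> carrier_mat a d" "B' \<in> carrier_mat a d"
  shows "append_cols (aff t A A') (aff t B B') = aff t (append_cols A B) (append_cols A' B')"
  using assms by (intro eq_matI) (auto simp: aff_def append_cols_def)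

lemma aff_append_rows:
  assumes "A \<in> carrier_mat a c" "A' \<in> carrier_mat a c" "B \<in> carrier_mat b c" "B' \<in> carrier_mat b c"
  shows "aff t A A' @\<^sub>r aff t B B' = aff t (A @\<^sub>r B) (A' @\<^sub>r B')"
  using assms by (intro eq_matI) (auto simp: aff_def append_rows_def)

lemma aff_block3:
  assumes "M11 \<in> carrier_mat k1 k1" "M12 \<in> carrier_mat k1 k2" "M13 \<in> carrier_mat k1 k3"
    "M21 \<in> carrier_mat k2 k1" "M22 \<in> carrier_mat k2 k2" "M23 \<in> carrier_mat k2 k3"
    "M31 \<in> carrier_mat k3 k1" "M32 \<in> carrier_mat k3 k2" "M33 \<in> carrier_mat k3 k3"
    and "L11 \<in> carrier_mat k1 k1" "L12 \<in> carrier_mat k1 k2" "L13 \<in> carrier_mat k1 k3"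
    "L21 \<in> carrier_mat k2 k1" "L22 \<in> carrier_mat k2 k2" "L23 \<in> carrier_mat k2 k3"
    "L31 \<in> carrier_mat k3 k1" "L32 \<in> carrier_mat k3 k2" "L33 \<in> carrier_mat k3 k3"
  shows "block3_mat (aff t M11 L11) (aff t M12 L12) (aff t M13 L13) (aff t M21 L21) (aff t M22 L22) (aff t M23 L23)
      (aff t M31 L31) (aff t M32 L32) (aff t M33 L33) =
    aff t (block3_mat M11 M12 M13 M21 M22 M23 M31 M32 M33) (block3_mat L11 L12 L13 L21 L22 L23 L31 L32 L33)"
  unfolding block3_mat_def aff_append[OF assms(2,11,3,12)] aff_append_rows[OF assms(4,13,7,16)]
    aff_four_block[OF assms(5,14,6,15,8,17,9,18)]
  by (rule aff_four_block[of _ k1 k1 _ _ "k2 + k3" _ _ "k2 + k3"])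
    (intro assms append_cols_carrier carrier_append_rows four_block_carrier_mat)+

context lq begin

lemma lmi_matrix_aff:
  assumes x0: "x0 \<in> carrier_vec n" and \<Phi>: "\<Phi> \<in> carrier_mat (N + M) N" "\<Phi>' \<in> carrier_mat (N + M) N"
    and D: "D \<in> carrier_mat (n * T) (n * T)" "D' \<in> carrier_mat (n * T) (n * T)"
  shows "lmi_matrix S x0 (aff t \<Phi> \<Phi>') (t * c + (1 - t) * c') (aff t D D') =
    aff t (lmi_matrix S x0 \<Phi> c D) (lmi_matrix S x0 \<Phi>' c' D')"
proof -
  define X where "X = mat_of_cols n [x0]"
  have X: "X \<in> carrier_mat n 1" using mat_of_cols_carrier(1)[of n "[x0]"] by (simp add: X_def One_nat_def)
  have XT: "X\<^sup>T \<in> carrier_mat 1 n" using X by simp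
  have O1: "O1 S \<in> carrier_mat n n" and O2: "O2 S \<in> carrier_mat (n * T) n" and O3: "O3 S \<in> carrier_mat (n * T) (n * T)"
    and P0: "\<And>\<Phi>. Phi_0 S \<Phi> \<in> carrier_mat (N + M) n" and Pw: "\<And>\<Phi>. Phi_w S \<Phi> \<in> carrier_mat (N + M) (n * T)"
    by (simp_all add: O1_def O2_def O3_def Phi_0_def Phi_w_def submat_def)
  have P0T: "(Phi_0 S \<Phi>)\<^sup>T \<in> carrier_mat n (N + M)" and PwT: "(Phi_w S \<Phi>)\<^sup>T \<in> carrier_mat (n * T) (N + M)" for \<Phi>
    using P0[of \<Phi>] Pw[of \<Phi>] by auto
  have O2T: "(O2 S)\<^sup>T \<in> carrier_mat n (n * T)" using O2 by simp
  have XOX: "X\<^sup>T * O1 S * X \<in> carrier_mat 1 1" by (rule mult_carrier_mat[OF mult_carrier_mat[OF XT O1] X])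
  have c11: "X\<^sup>T * O1 S * X + e \<cdot>\<^sub>m 1\<^sub>m 1 \<in> carrier_mat 1 1" for e by (rule add_carrier_mat) simp
  have lt: "i < n * T \<Longrightarrow> n + i < N" "i < n \<Longrightarrow> i < N" for i using NT by linarith+
  have e0: "Phi_0 S (aff t \<Phi> \<Phi>') = aff t (Phi_0 S \<Phi>) (Phi_0 S \<Phi>')"
    by (rule eq_matI) (use \<Phi> in \<open>auto simp: aff_def Phi_0_def submat_def lt\<close>)
  have ew: "Phi_w S (aff t \<Phi> \<Phi>') = aff t (Phi_w S \<Phi>) (Phi_w S \<Phi>')"
    by (rule eq_matI) (use \<Phi> in \<open>auto simp: aff_def Phi_w_def submat_def lt\<close>)
  have e11: "X\<^sup>T * O1 S * X + (t * c + (1 - t) * c') \<cdot>\<^sub>m 1\<^sub>m 1 =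
      aff t (X\<^sup>T * O1 S * X + c \<cdot>\<^sub>m 1\<^sub>m 1) (X\<^sup>T * O1 S * X + c' \<cdot>\<^sub>m 1\<^sub>m 1)"
  proof -
    have "A + (t * c + (1 - t) * c') \<cdot>\<^sub>m 1\<^sub>m 1 = aff t (A + c \<cdot>\<^sub>m 1\<^sub>m 1) (A + c' \<cdot>\<^sub>m 1\<^sub>m 1)"
      if "A \<in> carrier_mat 1 1" for A
      using that by (intro eq_matI) (auto simp: aff_def algebra_simps)
    from this[OF XOX] show ?thesis .
  qed
  have e22: "O3 S + aff t D D' = aff t (O3 S + D) (O3 S + D')"
    using O3 D by (intro eq_matI) (auto simp: aff_def algebra_simps)
  have e31: "Phi_0 S (aff t \<Phi> \<Phi>') * X = aff t (Phi_0 S \<Phi> * X) (Phi_0 S \<Phi>' * X)"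
    unfolding e0 by (rule aff_mult_right[OF P0 P0 X])
  have e13: "X\<^sup>T * (Phi_0 S (aff t \<Phi> \<Phi>'))\<^sup>T = aff t (X\<^sup>T * (Phi_0 S \<Phi>)\<^sup>T) (X\<^sup>T * (Phi_0 S \<Phi>')\<^sup>T)"
    unfolding e0 aff_transpose[OF P0 P0] by (rule aff_mult_left[OF P0T P0T XT])
  have "lmi_matrix S x0 (aff t \<Phi> \<Phi>') (t * c + (1 - t) * c') (aff t D D') =
    block3_mat (aff t (X\<^sup>T * O1 S * X + c \<cdot>\<^sub>m 1\<^sub>m 1) (X\<^sup>T * O1 S * X + c' \<cdot>\<^sub>m 1\<^sub>m 1))
      (aff t (X\<^sup>T * (O2 S)\<^sup>T) (X\<^sup>T * (O2 S)\<^sup>T)) (aff t (X\<^sup>T * (Phi_0 S \<Phi>)\<^sup>T) (X\<^sup>T * (Phi_0 S \<Phi>')\<^sup>T))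
      (aff t (O2 S * X) (O2 S * X)) (aff t (O3 S + D) (O3 S + D')) (aff t ((Phi_w S \<Phi>)\<^sup>T) ((Phi_w S \<Phi>')\<^sup>T))
      (aff t (Phi_0 S \<Phi> * X) (Phi_0 S \<Phi>' * X)) (aff t (Phi_w S \<Phi>) (Phi_w S \<Phi>')) (aff t (minv (Ccal S)) (minv (Ccal S)))"
    unfolding lmi_matrix_def Let_def X_def[symmetric] e11 e13 e22 e31 ew aff_transpose[OF Pw Pw] aff_same by (rule refl)
  also have "\<dots> = aff t (lmi_matrix S x0 \<Phi> c D) (lmi_matrix S x0 \<Phi>' c' D')"
    unfolding lmi_matrix_def Let_def X_def[symmetric]
    by (rule aff_block3[OF c11 _ _ _ _ PwT _ Pw _ c11 _ _ _ _ PwT _ Pw])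
      (intro mult_carrier_mat[OF XT O2T] mult_carrier_mat[OF XT P0T] mult_carrier_mat[OF O2 X] mult_carrier_mat[OF P0 X]
        add_carrier_mat D posdef_minv(1)[OF Ccal])+
  finally show ?thesis .
qed

lemma causal_responses_aff:
  assumes "\<Phi> \<in> causal_responses S" "\<Phi>' \<in> causal_responses S"
  shows "aff t \<Phi> \<Phi>' \<in> causal_responses S"
proof -
  have c: "\<Phi> \<in> carrier_mat (N + M) N" "\<Phi>' \<in> carrier_mat (N + M) N"
    using assms by (auto simp: causal_responses_def)
  have "Phi_x S (aff t \<Phi> \<Phi>') = aff t (Phi_x S \<Phi>) (Phi_x S \<Phi>')" "Phi_u S (aff t \<Phi> \<Phi>') = aff t (Phi_u S \<Phi>) (Phi_u S \<Phi>')"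
    using c by (auto simp: aff_def Phi_x_def Phi_u_def submat_def intro!: eq_matI)
  moreover have "block_lower_triangular p q (aff t A B)"
    if "block_lower_triangular p q A" "block_lower_triangular p q B" "A \<in> carrier_mat a b" "B \<in> carrier_mat a b" for p q a b A B
    unfolding aff_def using that
    by (intro block_lower_add(1)[of _ a b] block_lower_smult) auto
  moreover have "Phi_x S \<Phi> \<in> carrier_mat N N" "Phi_x S \<Phi>' \<in> carrier_mat N N"
    "Phi_u S \<Phi> \<in> carrier_mat M N" "Phi_u S \<Phi>' \<in> carrier_mat M N"
    by (simp_all add: Phi_x_def Phi_u_def submat_def)
  ultimately show ?thesis using assms aff_carrier[OF c] by (simp add: causal_responses_def)
qed

lemma pwb_constraints_linear:
  assumes x0: "x0 \<in> carrier_vec n"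
  shows "pwb_constraints_linear S P x0"
  unfolding pwb_constraints_linear_def aff_def[symmetric]
proof (intro ballI allI conjI)
  fix \<Phi> \<Phi>' and l l' :: "real vec" and t
  assume \<Phi>: "\<Phi> \<in> causal_responses S" "\<Phi>' \<in> causal_responses S"
    and l: "l \<in> carrier_vec (T + 1)" "l' \<in> carrier_vec (T + 1)"
  have c: "\<Phi> \<in> carrier_mat (N + M) N" "\<Phi>' \<in> carrier_mat (N + M) N"
    using \<Phi> by (auto simp: causal_responses_def)
  show "aff t \<Phi> \<Phi>' \<in> causal_responses S" by (rule causal_responses_aff[OF \<Phi>])
  have "append_cols (1\<^sub>m N - Zcal S * Acal S) (- (Zcal S * Bcal S)) \<in> carrier_mat N (N + M)"
    using append_cols_carrier[OF Y(1) uminus_carrier_mat[OF ZB(1)]] by (simp add: Y_def)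
  then show "achievability_map S (aff t \<Phi> \<Phi>') = aff t (achievability_map S \<Phi>) (achievability_map S \<Phi>')"
    unfolding achievability_map_def by (rule aff_mult_left[OF c])
  have w: "weighted_Pcal S P l \<in> carrier_mat (n * T) (n * T)" for l by (simp add: weighted_Pcal_def)
  have li: "(t \<cdot>\<^sub>v l + (1 - t) \<cdot>\<^sub>v l') $ i = t * l $ i + (1 - t) * l' $ i" if "i < T + 1" for i
    using that l by auto
  have "weighted_Pcal S P (t \<cdot>\<^sub>v l + (1 - t) \<cdot>\<^sub>v l') = aff t (weighted_Pcal S P l) (weighted_Pcal S P l')"
  proof (rule eq_matI)
    fix a b assume ab: "a < dim_row (aff t (weighted_Pcal S P l) (weighted_Pcal S P l'))"
      "b < dim_col (aff t (weighted_Pcal S P l) (weighted_Pcal S P l'))"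
    then have ab: "a < n * T" "b < n * T" using carrier_matD[OF aff_carrier[OF w w, of t l l']] by simp_all
    have "(\<Sum>i<T. (t \<cdot>\<^sub>v l + (1 - t) \<cdot>\<^sub>v l') $ i * Pcal S P (i + 1) $$ (a, b)) =
       (\<Sum>i<T. (t * l $ i + (1 - t) * l' $ i) * Pcal S P (i + 1) $$ (a, b))"
      by (rule sum.cong[OF refl]) (subst li, auto)
    also have "\<dots> = t * (\<Sum>i<T. l $ i * Pcal S P (i + 1) $$ (a, b)) + (1 - t) * (\<Sum>i<T. l' $ i * Pcal S P (i + 1) $$ (a, b))"
      by (simp only: distrib_right sum.distrib sum_distrib_left mult.assoc)
    finally show "weighted_Pcal S P (t \<cdot>\<^sub>v l + (1 - t) \<cdot>\<^sub>v l') $$ (a, b) = aff t (weighted_Pcal S P l) (weighted_Pcal S P l') $$ (a, b)"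
      using ab aff_index[OF ab w w, of t l l'] by (simp add: weighted_Pcal_def)
  qed (simp_all add: weighted_Pcal_def aff_def)
  then show "pwb_lmi S P x0 (aff t \<Phi> \<Phi>') (t \<cdot>\<^sub>v l + (1 - t) \<cdot>\<^sub>v l') =
      aff t (pwb_lmi S P x0 \<Phi> l) (pwb_lmi S P x0 \<Phi>' l')"
    unfolding pwb_lmi_def using lmi_matrix_aff[OF x0 c w w] li[of T] by simp
qed

end

context pwb begin

subsection \<open>The two programs in terms of the regret form\<close>

text \<open>Reconciles \<open>Pcal\<close>, which counts blocks from 1, with the block number
  \<open>a div n\<close>, which starts at 0.\<close>

lemma Pcal_index:
  assumes i: "i < T" and ab: "a < n * T" "b < n * T"
  shows "Pcal S P (i + 1) $$ (a, b) = (if a div n = i \<and> b div n = i then P $$ (a mod n, b mod n) else 0)"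
proof -
  let ?f = "\<lambda>k. if k = i then P else 0\<^sub>m n n"
  have "map (\<lambda>j. if j = i + 1 then P else 0\<^sub>m n n) [1..<T + 1] = map ?f [0..<T]"
    by (simp add: One_nat_def map_Suc_upt[symmetric] o_def del: upt_Suc)
  then have "Pcal S P (i + 1) = diag_block_mat (map ?f [0..<T])" by (simp add: Pcal_def)
  also have "\<dots> = Matrix.mat (n * T) (n * T) (\<lambda>(a, b). if a div n = b div n then ?f (a div n) $$ (a mod n, b mod n) else 0)"
    by (rule diag_block_mat_map) (use P(1) in auto)
  finally show ?thesis using ab div_less_of_less_mult[OF ab(1)] div_less_of_less_mult[OF ab(2)] by simp
qed

text \<open>The matrix is the block diagonal of the multiples
  \<open>l $ k \<cdot>\<^sub>m P\<close>, so its form is a weighted sum over blocks and its symmetry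
  is that of \<open>P\<close>.\<close>

lemma weighted_Pcal:
  shows "weighted_Pcal S P l \<in> carrier_mat (n * T) (n * T)" "(weighted_Pcal S P l)\<^sup>T = weighted_Pcal S P l"
    "w \<in> carrier_vec (n * T) \<Longrightarrow> qform (weighted_Pcal S P l) w = (\<Sum>i<T. l $ i * qform P (vblock n i w))"
proof -
  have c: "l $ k \<cdot>\<^sub>m P \<in> carrier_mat n n" for k using P(1) by simp
  have e: "weighted_Pcal S P l = diag_block_mat (map (\<lambda>k. l $ k \<cdot>\<^sub>m P) [0..<T])"
  proof -
    have "diag_block_mat (map (\<lambda>k. l $ k \<cdot>\<^sub>m P) [0..<T]) = Matrix.mat (n * T) (n * T)
        (\<lambda>(a, b). if a div n = b div n then (l $ (a div n) \<cdot>\<^sub>m P) $$ (a mod n, b mod n) else 0)"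
      by (rule diag_block_mat_map) (rule c)
    also have "\<dots> = weighted_Pcal S P l"
    proof (rule eq_matI)
      fix a b assume "a < dim_row (weighted_Pcal S P l)" "b < dim_col (weighted_Pcal S P l)"
      then have ab: "a < n * T" "b < n * T" by (simp_all add: weighted_Pcal_def)
      note da = div_less_of_less_mult[OF ab(1)] and db = div_less_of_less_mult[OF ab(2)]
      have "(\<Sum>i<T. l $ i * Pcal S P (i + 1) $$ (a, b)) =
          (\<Sum>i<T. if i = a div n then (if a div n = b div n then l $ i * P $$ (a mod n, b mod n) else 0) else 0)"
        by (rule sum.cong[OF refl]) (simp add: Pcal_index[OF _ ab] del: One_nat_def)
      also have "\<dots> = (if a div n = b div n then l $ (a div n) * P $$ (a mod n, b mod n) else 0)"
        using da by (subst sum.delta) auto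
      finally show "Matrix.mat (n * T) (n * T)
        (\<lambda>(a, b). if a div n = b div n then (l $ (a div n) \<cdot>\<^sub>m P) $$ (a mod n, b mod n) else 0) $$ (a, b) =
          weighted_Pcal S P l $$ (a, b)"
        using ab da db carrier_matD[OF P(1)] by (simp add: weighted_Pcal_def)
    qed (simp_all add: weighted_Pcal_def)
    finally show ?thesis ..
  qed
  show w: "weighted_Pcal S P l \<in> carrier_mat (n * T) (n * T)" by (simp add: weighted_Pcal_def)
  have Psym: "P $$ (a, b) = P $$ (b, a)" if "a < n" "b < n" for a b
  proof -
    have "P $$ (a, b) = P\<^sup>T $$ (b, a)" using that P(1) by (subst index_transpose_mat) auto
    then show ?thesis by (simp add: P'(1))
  qed
  show "(weighted_Pcal S P l)\<^sup>T = weighted_Pcal S P l"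
  proof (rule eq_matI)
    fix a b assume "a < dim_row (weighted_Pcal S P l)" "b < dim_col (weighted_Pcal S P l)"
    then have ab: "a < n * T" "b < n * T" by (simp_all add: weighted_Pcal_def)
    have "(\<Sum>i<T. l $ i * Pcal S P (i + 1) $$ (b, a)) = (\<Sum>i<T. l $ i * Pcal S P (i + 1) $$ (a, b))"
    proof (rule sum.cong[OF refl])
      fix i assume i: "i \<in> {..<T}"
      have "P $$ (a mod n, b mod n) = P $$ (b mod n, a mod n)"
        using ab by (intro Psym div_less_of_less_mult)
      then show "l $ i * Pcal S P (i + 1) $$ (b, a) = l $ i * Pcal S P (i + 1) $$ (a, b)"
        using i Pcal_index[of i a b] Pcal_index[of i b a] ab by simp
    qed
    then show "(weighted_Pcal S P l)\<^sup>T $$ (a, b) = weighted_Pcal S P l $$ (a, b)"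
      using ab by (simp add: weighted_Pcal_def)
  qed (simp_all add: weighted_Pcal_def)
  assume v: "w \<in> carrier_vec (n * T)"
  have "qform (diag_block_mat (map (\<lambda>k. l $ k \<cdot>\<^sub>m P) [0..<T])) w = (\<Sum>k<T. qform (l $ k \<cdot>\<^sub>m P) (vblock n k w))"
    by (rule qform_diag_block[OF _ v]) (rule c)
  then show "qform (weighted_Pcal S P l) w = (\<Sum>i<T. l $ i * qform P (vblock n i w))"
    unfolding e by (simp add: qform_scale_mat[OF P(1)])
qed

text \<open>A Lagrangian bound with one weight per constraint: entries below \<open>T\<close> weigh
  the disturbance blocks, entry \<open>T\<close> weighs \<open>t\<^sup>2 \<le> 1\<close>.\<close>

definition "pbound l t w = l $ T * t\<^sup>2 + (\<Sum>i<T. l $ i * qform P (vblock n i w))"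
  for l :: "real vec" and t :: real and w :: "real vec"

lemma pwb_feasible_iff:
  "pwb_feasible S P x0 \<Phi> l \<longleftrightarrow> (\<exists>U. \<Phi> = Psi U \<and> causal_controller S U \<and> l \<in> carrier_vec (T + 1) \<and>
     (\<forall>i \<le> T. 0 \<le> l $ i) \<and> (\<forall>t. \<forall>w \<in> carrier_vec (n * T). reg U (dl t w) \<le> pbound l t w))"
proof -
  have "positive_semidefinite (pwb_lmi S P x0 (Psi U) l) \<longleftrightarrow>
      (\<forall>t. \<forall>w \<in> carrier_vec (n * T). reg U (dl t w) \<le> pbound l t w)" if U: "causal_controller S U" for U
    unfolding pwb_lmi_def lmi_psd_iff[OF U x0 weighted_Pcal(1,2)] dl_def pbound_def
    using weighted_Pcal(3) by simp
  then show ?thesis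
    unfolding pwb_feasible_def using feasible_response_iff[of \<Phi>] by blast
qed

lemma energy_feasible_iff:
  "energy_feasible S x0 \<omega> \<gamma> l \<Phi> \<longleftrightarrow> (\<exists>U. \<Phi> = Psi U \<and> causal_controller S U \<and> 0 \<le> l \<and>
     (\<forall>t. \<forall>w \<in> carrier_vec (n * T). reg U (dl t w) \<le> (- l * \<omega> + \<gamma>) * t\<^sup>2 + l * (w \<bullet> w)))"
proof -
  have D: "l \<cdot>\<^sub>m 1\<^sub>m (n * T) \<in> carrier_mat (n * T) (n * T)" "(l \<cdot>\<^sub>m 1\<^sub>m (n * T))\<^sup>T = l \<cdot>\<^sub>m 1\<^sub>m (n * T)"
    by (auto intro!: eq_matI)
  have q: "qform (l \<cdot>\<^sub>m 1\<^sub>m (n * T)) w = l * (w \<bullet> w)" if "w \<in> carrier_vec (n * T)" for w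
    using that by (simp add: qform_scale_mat[OF one_carrier_mat]) (simp add: qform_def)
  have "positive_semidefinite (lmi_matrix S x0 (Psi U) (- l * \<omega> + \<gamma>) (l \<cdot>\<^sub>m 1\<^sub>m (n * T))) \<longleftrightarrow>
      (\<forall>t. \<forall>w \<in> carrier_vec (n * T). reg U (dl t w) \<le> (- l * \<omega> + \<gamma>) * t\<^sup>2 + l * (w \<bullet> w))"
    if U: "causal_controller S U" for U
    unfolding lmi_psd_iff[OF U x0 D] dl_def using q by simp
  then show ?thesis
    unfolding energy_feasible_def using feasible_response_iff[of \<Phi>] by blast
qed

text \<open>Weak duality: at \<open>t = 1\<close> and admissible \<open>w\<close> every nonnegative
  weight multiplies a quantity of at most 1.\<close>

lemma pbound_regret:
  assumes "\<And>i. i \<le> T \<Longrightarrow> 0 \<le> l $ i" "w \<in> Ws"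
  shows "pbound l 1 w \<le> pwb_objective S l"
proof -
  have "(\<Sum>i<T. l $ i * qform P (vblock n i w)) \<le> (\<Sum>i<T. l $ i * 1)"
    using assms by (intro sum_mono mult_left_mono) (auto simp: Ws_iff)
  then show ?thesis by (simp add: pbound_def pwb_objective_def lessThan_Suc_atMost[symmetric])
qed

section \<open>Comparison of the programs and existence of the minima\<close>

lemma energy_imp_pwb:
  assumes "energy_feasible S x0 \<omega> \<gamma> l \<Phi>"
  shows "\<exists>lv. pwb_feasible S P x0 \<Phi> lv \<and> pwb_objective S lv = \<gamma>"
proof -
  obtain U where U: "\<Phi> = Psi U" "causal_controller S U" "0 \<le> l"
    and le: "\<And>t w. w \<in> carrier_vec (n * T) \<Longrightarrow> reg U (dl t w) \<le> (- l * \<omega> + \<gamma>) * t\<^sup>2 + l * (w \<bullet> w)"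
    using assms unfolding energy_feasible_iff by blast
  define lv where "lv = vec (T + 1) (\<lambda>i. if i < T then l * (\<omega> / real T) else \<gamma> - l * \<omega>)"
  have lv: "lv \<in> carrier_vec (T + 1)" "lv $ T = \<gamma> - l * \<omega>" "\<And>i. i < T \<Longrightarrow> lv $ i = l * (\<omega> / real T)"
    by (simp_all add: lv_def)
  \<comment> \<open>At \<open>t = 1\<close> and \<open>w = 0\<close> the nonnegative regret forces
    \<open>\<gamma> - l * \<omega>\<close> to be nonnegative, the sign that the last multiplier
    needs.\<close>
  have "0 \<le> reg U (dl 1 (0\<^sub>v (n * T)))" by (rule reg_nonneg[OF causalD(1)[OF U(2)]]) simp
  also have "\<dots> \<le> \<gamma> - l * \<omega>" using le[OF Ws_carrier[OF Ws_zero], of 1] by simp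
  finally have "0 \<le> lv $ i" if "i \<le> T" for i
    using that lv U(3) \<omega>(1) by (cases "i = T") auto
  moreover have "reg U (dl t w) \<le> pbound lv t w" if w: "w \<in> carrier_vec (n * T)" for t w
  proof -
    have "l * (w \<bullet> w) \<le> l * (\<Sum>i<T. \<omega> / real T * qform P (vblock n i w))"
      by (intro mult_left_mono norm_le_qform_blocks w U)
    also have "\<dots> = (\<Sum>i<T. lv $ i * qform P (vblock n i w))"
      unfolding sum_distrib_left by (rule sum.cong) (auto simp: lv)
    finally show ?thesis using le[OF w, of t] by (simp add: pbound_def lv algebra_simps)
  qed
  ultimately have "pwb_feasible S P x0 \<Phi> lv"
    unfolding pwb_feasible_iff using U lv by blast
  moreover have "pwb_objective S lv = \<gamma>"
    using T_pos by (simp add: pwb_objective_def lessThan_Suc_atMost[symmetric] lv)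
  ultimately show ?thesis by blast
qed

lemma zero_causal: "causal_controller S (0\<^sub>m M N)"
  by (auto simp: causal_controller_def block_lower_triangular_def)

lemma energy_nonempty: "\<exists>\<gamma> l \<Phi>. energy_feasible S x0 \<omega> \<gamma> l \<Phi>"
proof -
  obtain c where c: "0 \<le> c" "\<And>t w. w \<in> carrier_vec (n * T) \<Longrightarrow> reg (0\<^sub>m M N) (dl t w) \<le> c * t\<^sup>2 + c * (w \<bullet> w)"
    using reg_upper_bound[OF causalD(1)[OF zero_causal]] by blast
  \<comment> \<open>\<open>\<gamma> = c + c * \<omega>\<close> makes the coefficient
    \<open>- c * \<omega> + \<gamma>\<close> equal to \<open>c\<close>.\<close>
  have "energy_feasible S x0 \<omega> (c + c * \<omega>) c (Psi (0\<^sub>m M N))"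
    unfolding energy_feasible_iff using c zero_causal by (intro exI[of _ "0\<^sub>m M N"]) auto
  then show ?thesis by blast
qed

lemma has_least_energy: "has_least (energy_value S x0 \<omega>)"
proof -
  define b where "b r l t w = (- (l $ 0) * \<omega> + r) * t\<^sup>2 + l $ 0 * (w \<bullet> w)"
    for r :: real and l :: "real vec" and t :: real and w :: "real vec"
  define C where "C r l U \<longleftrightarrow> causal_controller S U \<and> l \<in> carrier_vec 1 \<and> 0 \<le> l $ 0 \<and>
      (\<forall>(t, w) \<in> UNIV \<times> carrier_vec (n * T). reg U (dl t w) \<le> b r l t w)" for r l U
  have ev: "energy_value S x0 \<omega> r \<longleftrightarrow> (\<exists>l U. C r l U)" for r
  proof
    assume "energy_value S x0 \<omega> r"
    then obtain l U where "causal_controller S U" "0 \<le> l"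
      "\<And>t w. w \<in> carrier_vec (n * T) \<Longrightarrow> reg U (dl t w) \<le> (- l * \<omega> + r) * t\<^sup>2 + l * (w \<bullet> w)"
      unfolding energy_value_def energy_feasible_iff by blast
    then have "C r (vec 1 (\<lambda>_. l)) U" by (auto simp: C_def b_def One_nat_def)
    then show "\<exists>l U. C r l U" by blast
  next
    assume "\<exists>l U. C r l U"
    then obtain l U where "C r l U" by blast
    then have "energy_feasible S x0 \<omega> r (l $ 0) (Psi U)"
      unfolding energy_feasible_iff C_def b_def by (intro exI[of _ U]) auto
    then show "energy_value S x0 \<omega> r" unfolding energy_value_def by blast
  qed
  obtain r0 l0 U0 where ex: "C r0 l0 U0" using energy_nonempty ev unfolding energy_value_def by blast
  \<comment> \<open>The constraint at \<open>w = 0\<close>; since \<open>\<omega> > 0\<close>, it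
    confines the multiplier to a bounded interval.\<close>
  have pos: "l $ 0 * \<omega> \<le> r" if C: "C r l U" for r l U
  proof -
    have "0 \<le> reg U (dl 1 (0\<^sub>v (n * T)))" using C by (intro reg_nonneg) (auto simp: C_def dest: causalD)
    also have "\<dots> \<le> b r l 1 (0\<^sub>v (n * T))" using C by (auto simp: C_def)
    finally show ?thesis by (simp add: b_def)
  qed
  have "has_least (\<lambda>r. \<exists>l U. C r l U)"
  proof (rule has_least_response[where L = "\<lambda>_ l. 0 \<le> l $ 0" and Bl = "r0 / \<omega>"
        and k = 1 and D = "UNIV \<times> carrier_vec (n * T)" and b = b, folded C_def])
    show "C r0 l0 U0" by (rule ex)
    fix r l U assume C: "C r l U"
    show "reg U (dl 1 w) \<le> r" if w: "w \<in> Ws" for w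
    proof -
      have "reg U (dl 1 w) \<le> b r l 1 w" using C Ws_carrier[OF w] by (auto simp: C_def)
      also have "l $ 0 * (w \<bullet> w) \<le> l $ 0 * \<omega>" using C by (intro mult_left_mono Ws_norm[OF w]) (simp add: C_def)
      then have "b r l 1 w \<le> r" by (simp add: b_def)
      finally show ?thesis .
    qed
    show "\<bar>l $ i\<bar> \<le> r0 / \<omega>" if "r \<le> r0" "i < 1" for i
      using that pos[OF C] C \<omega>(1) by (simp add: C_def One_nat_def pos_le_divide_eq)
  next
    fix ls :: "nat \<Rightarrow> real vec" and l :: "real vec" assume "\<And>j. 0 \<le> (ls j :: real vec) $ 0" "\<And>i. i < 1 \<Longrightarrow> (\<lambda>j. ls j $ i) \<longlonglongrightarrow> l $ i"
    then show "0 \<le> l $ 0" by (intro LIMSEQ_le_const[of "\<lambda>j. ls j $ 0"]) auto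
  next
    fix rs :: "nat \<Rightarrow> real" and ls :: "nat \<Rightarrow> real vec" and r t :: real and w l :: "real vec"
    assume "rs \<longlonglongrightarrow> r" "\<And>i. i < 1 \<Longrightarrow> (\<lambda>j. (ls j :: real vec) $ i) \<longlonglongrightarrow> l $ i"
    then show "(\<lambda>j. b (rs j) (ls j) t w) \<longlonglongrightarrow> b r l t w"
      unfolding b_def by (intro tendsto_intros) auto
  qed simp
  then show ?thesis using ev by presburger
qed

lemma pwb_value_iff:
  "pwb_value S P x0 r \<longleftrightarrow> (\<exists>l U. causal_controller S U \<and> l \<in> carrier_vec (T + 1) \<and>
      ((\<forall>i \<le> T. 0 \<le> l $ i) \<and> r = pwb_objective S l) \<and>
      (\<forall>(t, w) \<in> UNIV \<times> carrier_vec (n * T). reg U (dl t w) \<le> pbound l t w))"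
  unfolding pwb_value_def pwb_feasible_iff by blast

lemma has_least_pwb: "has_least (pwb_value S P x0)"
proof -
  define C where "C r l U \<longleftrightarrow> causal_controller S U \<and> l \<in> carrier_vec (T + 1) \<and>
      ((\<forall>i \<le> T. 0 \<le> l $ i) \<and> r = pwb_objective S l) \<and>
      (\<forall>(t, w) \<in> UNIV \<times> carrier_vec (n * T). reg U (dl t w) \<le> pbound l t w)" for r l U
  have ev: "pwb_value S P x0 r \<longleftrightarrow> (\<exists>l U. C r l U)" for r
    unfolding C_def by (rule pwb_value_iff)
  \<comment> \<open>A feasible point is inherited from the energy-bounded program.\<close>
  obtain r0 l0 U0 where ex: "C r0 l0 U0"
    using energy_nonempty energy_imp_pwb ev unfolding pwb_value_def by metis
  have "has_least (\<lambda>r. \<exists>l U. C r l U)"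
  proof (rule has_least_response[where L = "\<lambda>r l. (\<forall>i \<le> T. 0 \<le> l $ i) \<and> r = pwb_objective S l"
        and Bl = r0 and b = "\<lambda>_. pbound" and k = "T + 1" and D = "UNIV \<times> carrier_vec (n * T)", folded C_def])
    show "C r0 l0 U0" by (rule ex)
    fix r l U assume C: "C r l U"
    show "reg U (dl 1 w) \<le> r" if w: "w \<in> Ws" for w
    proof -
      have "reg U (dl 1 w) \<le> pbound l 1 w" using C Ws_carrier[OF w] by (auto simp: C_def)
      also have "\<dots> \<le> r" using pbound_regret[OF _ w, of l] C by (auto simp: C_def)
      finally show ?thesis .
    qed
    show "\<bar>l $ i\<bar> \<le> r0" if "r \<le> r0" "i < T + 1" for i
    proof -
      have "l $ i \<le> (\<Sum>i\<le>T. l $ i)" using C that by (intro member_le_sum) (auto simp: C_def)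
      then show ?thesis using C that by (auto simp: C_def pwb_objective_def)
    qed
  next
    fix rs :: "nat \<Rightarrow> real" and ls :: "nat \<Rightarrow> real vec" and r :: real and l :: "real vec"
    assume L: "\<And>j. (\<forall>i \<le> T. 0 \<le> (ls j :: real vec) $ i) \<and> rs j = pwb_objective S (ls j)"
      and r: "rs \<longlonglongrightarrow> r" and l: "\<And>i. i < T + 1 \<Longrightarrow> (\<lambda>j. ls j $ i) \<longlonglongrightarrow> l $ i"
    have l_nonneg: "0 \<le> l $ i" if "i \<le> T" for i
      using L that by (intro LIMSEQ_le_const[OF l]) auto
    have "(\<lambda>j. pwb_objective S (ls j)) \<longlonglongrightarrow> pwb_objective S l"
      unfolding pwb_objective_def by (intro tendsto_sum l) auto
    moreover have "rs = (\<lambda>j. pwb_objective S (ls j))" using L by blast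
    ultimately have "rs \<longlonglongrightarrow> pwb_objective S l" by simp
    then have "r = pwb_objective S l" using r by (rule LIMSEQ_unique[rotated])
    then show "(\<forall>i \<le> T. 0 \<le> l $ i) \<and> r = pwb_objective S l" using l_nonneg by blast
  next
    fix rs :: "nat \<Rightarrow> real" and ls :: "nat \<Rightarrow> real vec" and r t :: real and w l :: "real vec"
    assume "rs \<longlonglongrightarrow> r" and l: "\<And>i. i < T + 1 \<Longrightarrow> (\<lambda>j. (ls j :: real vec) $ i) \<longlonglongrightarrow> l $ i"
    show "(\<lambda>j. pbound (ls j) t w) \<longlonglongrightarrow> pbound l t w"
      unfolding pbound_def by (intro tendsto_intros l) auto
  qed simp
  then show ?thesis using ev by presburger
qed

text \<open>The minimax problem with responses in place of controllers and upper bounds in place of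
  attained maxima: for each \<open>w\<close> the condition on \<open>U\<close> and \<open>r\<close>
  passes to limits, as compactness requires.\<close>

definition "regret_bound r \<longleftrightarrow> (\<exists>U. causal_controller S U \<and> (\<forall>w \<in> Ws. reg U (dl 1 w) \<le> r))"

lemma has_least_regret_bound: "has_least regret_bound"
proof -
  define C where "C r l U \<longleftrightarrow> causal_controller S U \<and> l \<in> carrier_vec 0 \<and> True \<and>
      (\<forall>(t, w) \<in> {1} \<times> Ws. reg U (dl t w) \<le> r)" for r :: real and l :: "real vec" and U
  have ev: "regret_bound r \<longleftrightarrow> (\<exists>l U. C r l U)" for r
    by (auto simp: regret_bound_def C_def intro!: exI[of _ "0\<^sub>v 0"])
  obtain v where "pwb_value S P x0 v" using has_least_pwb by (auto simp: has_least_def)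
  then obtain l U where U: "causal_controller S U" "\<And>i. i \<le> T \<Longrightarrow> 0 \<le> l $ i"
    "\<And>w. w \<in> carrier_vec (n * T) \<Longrightarrow> reg U (dl 1 w) \<le> pbound l 1 w"
    unfolding pwb_value_iff by blast
  have "reg U (dl 1 w) \<le> pwb_objective S l" if "w \<in> Ws" for w
    using U(3)[OF Ws_carrier[OF that]] pbound_regret[OF U(2) that] by simp
  then have ex: "C (pwb_objective S l) (0\<^sub>v 0) U" using U(1) by (simp add: C_def)
  have "has_least (\<lambda>r. \<exists>l U. C r l U)"
  proof (rule has_least_response[where L = "\<lambda>_ _. True" and b = "\<lambda>r _ _ _. r"
        and k = 0 and D = "{1} \<times> Ws", folded C_def])
    show "C (pwb_objective S l) (0\<^sub>v 0) U" by (rule ex)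
    show "{1} \<times> Ws \<subseteq> UNIV \<times> carrier_vec (n * T)" using Ws_carrier by auto
  qed (auto simp: C_def)
  then show ?thesis using ev by presburger
qed

subsection \<open>The lower bound\<close>

text \<open>The regret is a convex function of the multiple \<open>t\<close> of \<open>x0\<close>, and the set of disturbances is
  symmetric, so \<open>t = 1\<close> is the worst case among \<open>\<bar>t\<bar> \<le> 1\<close>.\<close>

lemma regret_scaled_initial_state:
  assumes U: "U \<in> carrier_mat M N" and R: "\<And>w. w \<in> Ws \<Longrightarrow> reg U (dl 1 w) \<le> R"
    and w: "w \<in> Ws" and t: "t\<^sup>2 \<le> 1"
  shows "reg U (dl t w) \<le> R"
proof -
  note wc = Ws_carrier[OF w] and zc = Ws_carrier[OF Ws_zero]
  note UH = UH_carrier[OF U] and pW = posdef_carrierD[OF Wm(2,1)]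
  define a b where "a = (U - H) *\<^sub>v dl 1 (0\<^sub>v (n * T))" and "b = (U - H) *\<^sub>v dl 0 w"
  have a: "a \<in> carrier_vec M" and b: "b \<in> carrier_vec M"
    unfolding a_def b_def by (rule mult_mat_vec_carrier[OF UH dl_carrier[OF zc]], rule mult_mat_vec_carrier[OF UH dl_carrier[OF wc]])
  define B where "B = a \<bullet> (Wm *\<^sub>v b)"
  \<comment> \<open>A quadratic polynomial in \<open>(s, c)\<close>. Passing from \<open>w\<close>
    to \<open>- w\<close> flips the mixed term, so the bound at \<open>s = 1\<close> holds with the
    modulus of \<open>B\<close>, and a smaller modulus of \<open>s\<close> can only help.\<close>
  have reg: "reg U (dl s (c \<cdot>\<^sub>v w)) = s\<^sup>2 * qform Wm a + 2 * s * c * B + c\<^sup>2 * qform Wm b" for s c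
  proof -
    have "dl s (c \<cdot>\<^sub>v w) = s \<cdot>\<^sub>v dl 1 (0\<^sub>v (n * T)) + c \<cdot>\<^sub>v dl 0 w"
      using x0 wc by (intro eq_vecI) (auto simp: dl_def)
    then have "(U - H) *\<^sub>v dl s (c \<cdot>\<^sub>v w) = s \<cdot>\<^sub>v a + c \<cdot>\<^sub>v b"
      unfolding a_def b_def using UH dl_carrier[OF zc] dl_carrier[OF wc]
      by (simp add: mult_add_distrib_mat_vec[OF UH] mult_mat_vec[OF UH])
    moreover have "(s \<cdot>\<^sub>v a) \<bullet> (Wm *\<^sub>v (c \<cdot>\<^sub>v b)) = s * c * B"
      using a mult_mat_vec_carrier[OF Wm(1) b] by (simp add: mult_mat_vec[OF Wm(1) b] B_def)
    ultimately show ?thesis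
      using qform_add[OF Wm(1) pW(1), of "s \<cdot>\<^sub>v a" "c \<cdot>\<^sub>v b"] a b
      by (simp add: reg_def qform_smult[OF Wm(1)])
  qed
  have "qform Wm a + 2 * B + qform Wm b \<le> R" "qform Wm a - 2 * B + qform Wm b \<le> R"
    using R[OF w] R[OF Ws_neg[OF w]] reg[of 1 1] reg[of 1 "- 1"] by simp_all
  then have 1: "qform Wm a + 2 * \<bar>B\<bar> + qform Wm b \<le> R" by (auto simp: abs_if)
  have "t\<^sup>2 * qform Wm a \<le> 1 * qform Wm a" by (intro mult_right_mono t pW(3)[OF a])
  moreover have "t * B \<le> 1 * \<bar>B\<bar>"
  proof -
    have "\<bar>t\<bar> \<le> 1" using t by (simp add: abs_square_le_1)
    then have "\<bar>t\<bar> * \<bar>B\<bar> \<le> 1 * \<bar>B\<bar>" by (intro mult_right_mono) auto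
    moreover have "t * B \<le> \<bar>t\<bar> * \<bar>B\<bar>" by (metis abs_ge_self abs_mult)
    ultimately show ?thesis by linarith
  qed
  ultimately show ?thesis using 1 reg[of t 1] by simp
qed

text \<open>Strong duality up to \<open>pi / 2\<close>: \<open>psd_block_domination\<close> is
  applied in coordinates where \<open>w\<close> is blockwise the image under \<open>V\<close>, so
  that each disturbance constraint becomes a unit ball. One more coordinate, of index
  \<open>n * T\<close>, carries \<open>t\<close> and forms block \<open>T\<close> alone.\<close>

lemma multipliers_of_regret_bound:
  assumes U: "U \<in> carrier_mat M N" and R: "\<And>w. w \<in> Ws \<Longrightarrow> reg U (dl 1 w) \<le> R"
  shows "\<exists>l \<in> carrier_vec (T + 1). (\<forall>i \<le> T. 0 \<le> l $ i) \<and> pwb_objective S l = pi / 2 * R \<and>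
    (\<forall>t. \<forall>w \<in> carrier_vec (n * T). reg U (dl t w) \<le> pbound l t w)"
proof -
  obtain V where V: "V \<in> carrier_mat n n" "det V \<noteq> 0"
    and qV: "\<And>z. z \<in> carrier_vec n \<Longrightarrow> qform P (V *\<^sub>v z) = (\<Sum>k<n. (z $ k)\<^sup>2)"
    using posdef_orthonormal_coordinates[OF P] by blast
  define Dv where "Dv = diag_block_mat (map (\<lambda>_. V) [0..<T])"
  have Dv: "Dv \<in> carrier_mat (n * T) (n * T)" unfolding Dv_def by (rule diag_block_mat_map_carrier) (rule V)
  have dDv: "det Dv \<noteq> 0" unfolding Dv_def by (rule minv_diag_block_lower(1)) (rule V)+
  define K where "K = Suc (n * T)"
  define z w where "z y = vec (n * T) y" and "w y = Dv *\<^sub>v z y" for y :: "nat \<Rightarrow> real"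
  have z: "z y \<in> carrier_vec (n * T)" and w: "w y \<in> carrier_vec (n * T)" for y
    unfolding w_def z_def by (simp, rule mult_mat_vec_carrier[OF Dv vec_carrier])
  \<comment> \<open>The linear map that sends \<open>(z, t)\<close> to
    \<open>(t x0, Dv z)\<close>.\<close>
  define \<Delta> where "\<Delta> = Matrix.mat N K (\<lambda>(i, j). if i < n then (if j = n * T then x0 $ i else 0)
    else (if j < n * T then Dv $$ (i - n, j) else 0))"
  have \<Delta>: "\<Delta> \<in> carrier_mat N K" by (simp add: \<Delta>_def)
  have \<Delta>y: "\<Delta> *\<^sub>v vec K y = dl (y (n * T)) (w y)" for y
  proof (rule eq_vecI)
    have dc: "dl (y (n * T)) (w y) \<in> carrier_vec N" by (rule dl_carrier[OF w])
    show "dim_vec (\<Delta> *\<^sub>v vec K y) = dim_vec (dl (y (n * T)) (w y))" using carrier_vecD[OF dc] \<Delta> by simp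
    fix i assume "i < dim_vec (dl (y (n * T)) (w y))"
    then have i: "i < N" using carrier_vecD[OF dc] by simp
    have e: "(\<Delta> *\<^sub>v vec K y) $ i = (\<Sum>j<K. \<Delta> $$ (i, j) * y j)"
      unfolding mult_mat_vec_index_sum[OF \<Delta> vec_carrier i] by (rule sum.cong) auto
    show "(\<Delta> *\<^sub>v vec K y) $ i = dl (y (n * T)) (w y) $ i"
    proof (cases "i < n")
      case True
      have "(\<Sum>j<K. \<Delta> $$ (i, j) * y j) = x0 $ i * y (n * T)"
        unfolding K_def using i True by (simp add: \<Delta>_def K_def)
      then show ?thesis using e dl_index[OF w i] True by simp
    next
      case False
      then have i': "i - n < n * T" using i NT by linarith
      have "(\<Sum>j<K. \<Delta> $$ (i, j) * y j) = (\<Sum>j<n * T. Dv $$ (i - n, j) * y j)"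
        unfolding K_def using i False by (simp add: \<Delta>_def K_def)
      also have "\<dots> = w y $ (i - n)"
        unfolding w_def mult_mat_vec_index_sum[OF Dv z i'] by (rule sum.cong) (auto simp: z_def)
      finally show ?thesis using e dl_index[OF w i] False by simp
    qed
  qed
  define L where "L = (U - H) * \<Delta>"
  have L: "L \<in> carrier_mat M K" unfolding L_def by (rule mult_carrier_mat[OF UH_carrier[OF U] \<Delta>])
  define A where "A = L\<^sup>T * Wm * L"
  have A: "A \<in> carrier_mat K K" unfolding A_def
    by (rule mult_carrier_mat[OF mult_carrier_mat[OF _ Wm(1)] L]) (use L in simp)
  define q where "q y = (\<Sum>i<K. \<Sum>j<K. A $$ (i, j) * (y i * y j))" for y
  have q: "q y = reg U (dl (y (n * T)) (w y))" for y
  proof -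
    have "q y = qform A (vec K y)"
      unfolding q_def qform_sum[OF A vec_carrier] by (intro sum.cong refl) simp
    also have "\<dots> = qform Wm (L *\<^sub>v vec K y)"
      unfolding A_def by (rule qform_transform[OF Wm(1) L vec_carrier])
    also have "L *\<^sub>v vec K y = (U - H) *\<^sub>v (\<Delta> *\<^sub>v vec K y)"
      unfolding L_def by (rule assoc_mult_mat_vec[OF UH_carrier[OF U] \<Delta> vec_carrier])
    finally show ?thesis by (simp add: \<Delta>y reg_def)
  qed
  define b where "b j = (if j < n * T then j div n else T)" for j
  define p where "p i y = (\<Sum>j | j < K \<and> b j = i. (y j)\<^sup>2)" for i and y :: "nat \<Rightarrow> real"
  have pT: "p T y = (y (n * T))\<^sup>2" for y
  proof -
    have "{j. j < K \<and> b j = T} = {n * T}"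
      by (auto simp: K_def b_def less_Suc_eq split: if_splits dest: div_less_of_less_mult(1))
    then show ?thesis by (simp add: p_def)
  qed
  have pi: "p i y = qform P (vblock n i (w y))" if i: "i < T" for i y
  proof -
    have "{j. j < K \<and> b j = i} = {j \<in> {..<n * T}. i = j div n}"
      using i by (auto simp: K_def b_def)
    then have "p i y = (\<Sum>j<n * T. if i = j div n then (y j)\<^sup>2 else 0)"
      unfolding p_def by (simp only: sum.inter_filter[OF finite_lessThan])
    also have "\<dots> = (\<Sum>c<n. (y (i * n + c))\<^sup>2)" by (rule sum_single_block[OF i])
    also have "\<dots> = (\<Sum>c<n. (vblock n i (z y) $ c)\<^sup>2)"
      using block_index_less[OF i] by (intro sum.cong) (auto simp: vblock_index z_def)
    also have "\<dots> = qform P (V *\<^sub>v vblock n i (z y))" by (rule qV[symmetric]) simp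
    also have "V *\<^sub>v vblock n i (z y) = vblock n i (w y)"
      unfolding w_def Dv_def by (rule vblock_diag_mult[symmetric, OF V(1) z i])
    finally show ?thesis .
  qed
  have "\<exists>l. (\<forall>i \<le> T. 0 \<le> l i) \<and> (\<Sum>i\<le>T. l i) = pi / 2 * R \<and> (\<forall>y. q y \<le> (\<Sum>i\<le>T. l i * p i y))"
    unfolding q_def p_def
  proof (rule psd_block_domination, fold q_def p_def)
    show "0 \<le> q y" for y unfolding q by (rule reg_nonneg[OF U dl_carrier[OF w]])
    show "b j \<le> T" if "j < K" for j
      using div_less_of_less_mult(1)[of j n T] by (auto simp: b_def)
    show "q y \<le> R" if y: "\<And>i. i \<le> T \<Longrightarrow> p i y \<le> 1" for y
      unfolding q
    \<comment> \<open>The ball of block \<open>T\<close> yields only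
      \<open>t\<^sup>2 \<le> 1\<close>, whereas the hypothesis on \<open>R\<close> is about
      \<open>t = 1\<close>.\<close>
    proof (rule regret_scaled_initial_state[OF U R])
      show "w y \<in> Ws" unfolding Ws_iff
      proof (intro conjI allI impI w)
        fix k assume k: "k < T"
        show "qform P (vblock n k (w y)) \<le> 1" unfolding pi[OF k, symmetric] by (rule y) (use k in simp)
      qed
      show "(y (n * T))\<^sup>2 \<le> 1" using y[of T] pT by simp
    qed
  qed
  then obtain l where l: "\<And>i. i \<le> T \<Longrightarrow> 0 \<le> l i" "(\<Sum>i\<le>T. l i) = pi / 2 * R" "\<And>y. q y \<le> (\<Sum>i\<le>T. l i * p i y)"
    by blast
  define lv where "lv = vec (T + 1) l"
  have lv: "lv $ i = l i" if "i \<le> T" for i using that by (simp add: lv_def)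
  have "reg U (dl t v) \<le> pbound lv t v" if v: "v \<in> carrier_vec (n * T)" for t v
  proof -
    \<comment> \<open>The coordinates are invertible, so the domination reaches every pair
      \<open>(t, v)\<close>.\<close>
    define u where "u = minv Dv *\<^sub>v v"
    define y where "y j = (if j < n * T then u $ j else t)" for j
    have "u \<in> carrier_vec (n * T)"
      unfolding u_def by (rule mult_mat_vec_carrier[OF minv_inverse(1)[OF Dv dDv] v])
    then have "z y = u" by (intro eq_vecI) (auto simp: z_def y_def)
    then have wy: "w y = v" using minv_mult_vec(1)[OF Dv dDv v] by (simp add: w_def u_def)
    have ty: "y (n * T) = t" by (simp add: y_def)
    have "reg U (dl t v) \<le> (\<Sum>i\<le>T. l i * p i y)" using l(3)[of y] by (simp add: q wy ty)
    also have "\<dots> = (\<Sum>i<T. l i * p i y) + l T * p T y" by (simp add: lessThan_Suc_atMost[symmetric])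
    also have "(\<Sum>i<T. l i * p i y) = (\<Sum>i<T. lv $ i * qform P (vblock n i v))"
      by (rule sum.cong) (auto simp: pi wy lv)
    finally show ?thesis by (simp add: pbound_def pT ty lv)
  qed
  moreover have "pwb_objective S lv = pi / 2 * R"
    unfolding pwb_objective_def l(2)[symmetric] by (rule sum.cong) (auto simp: lv)
  ultimately show ?thesis using l(1) lv by (intro bexI[of _ lv]) (auto simp: lv_def)
qed

subsection \<open>Regret of controllers\<close>

lemma closed_loop_regret:
  assumes U: "causal_controller S U" and w: "w \<in> carrier_vec (n * T)"
  shows "dynamic_regret S x0 (U *\<^sub>v (x0 @\<^sub>v w)) w = reg U (dl 1 w)"
proof -
  note u = causalD(1)[OF U] and d = delta_carrier[OF x0 w]
  show ?thesis
    unfolding dynamic_regret_eq[OF x0 mult_mat_vec_carrier[OF u d] w] reg_def dl_one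
      minus_mult_distrib_mat_vec[OF u H_carrier d] by (rule refl)
qed

lemma regret_value_iff:
  assumes U: "causal_controller S U"
    and cl: "\<forall>w \<in> carrier_vec (n * T). \<forall>u. closed_loop S K x0 w u \<longleftrightarrow> u = U *\<^sub>v (x0 @\<^sub>v w)"
  shows "regret_value S P x0 K r \<longleftrightarrow> (\<exists>w \<in> Ws. r = reg U (dl 1 w))"
  unfolding regret_value_def using cl Ws_carrier closed_loop_regret[OF U] by fastforce

lemma worst_case_regret:
  assumes U: "causal_controller S U"
    and cl: "\<forall>w \<in> carrier_vec (n * T). \<forall>u. closed_loop S K x0 w u \<longleftrightarrow> u = U *\<^sub>v (x0 @\<^sub>v w)"
  shows "has_greatest (regret_value S P x0 K)" "w \<in> Ws \<Longrightarrow> reg U (dl 1 w) \<le> worst_case_regret S P x0 K"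
    "(\<And>w. w \<in> Ws \<Longrightarrow> reg U (dl 1 w) \<le> r) \<Longrightarrow> worst_case_regret S P x0 K \<le> r"
proof -
  have e: "regret_value S P x0 K = (\<lambda>r. \<exists>w \<in> Ws. r = reg U (dl 1 w))"
    by (rule ext) (rule regret_value_iff[OF U cl])
  show g: "has_greatest (regret_value S P x0 K)"
    unfolding e by (rule has_greatest_reg[OF causalD(1)[OF U]])
  then obtain v where v: "regret_value S P x0 K v" "\<And>y. regret_value S P x0 K y \<Longrightarrow> y \<le> v"
    by (auto simp: has_greatest_def)
  then have wv: "worst_case_regret S P x0 K = v"
    unfolding worst_case_regret_def by (rule Greatest_equality)
  show "reg U (dl 1 w) \<le> worst_case_regret S P x0 K" if "w \<in> Ws"
    unfolding wv by (rule v(2)) (use that in \<open>auto simp: e\<close>)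
  show "worst_case_regret S P x0 K \<le> r" if "\<And>w. w \<in> Ws \<Longrightarrow> reg U (dl 1 w) \<le> r"
    using v(1) that unfolding wv by (auto simp: e)
qed

text \<open>The response of a controller turns its worst case into a bound, so no worst case lies
  below the least bound \<open>v\<close>. The controller that realizes an optimal response has worst
  case at most \<open>v\<close>, hence exactly \<open>v\<close>.\<close>

lemma has_least_minimax:
  shows "has_least (minimax_value S P x0)" "regret_bound (regret_PWB S P x0)"
    "regret_bound r \<Longrightarrow> regret_PWB S P x0 \<le> r"
proof -
  obtain v where v: "regret_bound v" "\<And>y. regret_bound y \<Longrightarrow> v \<le> y"
    using has_least_regret_bound by (auto simp: has_least_def)
  have mm: "v \<le> y" if y: "minimax_value S P x0 y" for y
  proof -
    obtain K where K: "causal_controller S K" "y = worst_case_regret S P x0 K"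
      using y by (auto simp: minimax_value_def)
    obtain U where U: "causal_controller S U"
      and cl: "\<forall>w \<in> carrier_vec (n * T). \<forall>u. closed_loop S K x0 w u \<longleftrightarrow> u = U *\<^sub>v (x0 @\<^sub>v w)"
      using closed_loop_response[OF K(1)] x0 by blast
    have "regret_bound y"
      unfolding regret_bound_def K(2) using worst_case_regret(2)[OF U cl] U by blast
    then show ?thesis by (rule v(2))
  qed
  obtain U where U: "causal_controller S U" "\<And>w. w \<in> Ws \<Longrightarrow> reg U (dl 1 w) \<le> v"
    using v(1) by (auto simp: regret_bound_def)
  let ?K = "U * minv (G + F * U)"
  note rc = response_controller(4,5)[OF U(1)]
  have cl: "\<forall>w \<in> carrier_vec (n * T). \<forall>u. closed_loop S ?K x0 w u \<longleftrightarrow> u = U *\<^sub>v (x0 @\<^sub>v w)"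
    using rc(2)[OF x0] by blast
  have "minimax_value S P x0 (worst_case_regret S P x0 ?K)"
    using rc(1) by (auto simp: minimax_value_def)
  moreover have "worst_case_regret S P x0 ?K \<le> v"
    by (rule worst_case_regret(3)[OF U(1) cl U(2)])
  ultimately have mv: "minimax_value S P x0 v" using mm by (metis order_antisym)
  then show "has_least (minimax_value S P x0)" unfolding has_least_def using mm by blast
  have "regret_PWB S P x0 = v" unfolding regret_PWB_def using mv mm by (rule Least_equality)
  then show "regret_bound (regret_PWB S P x0)" "regret_bound r \<Longrightarrow> regret_PWB S P x0 \<le> r"
    using v by auto
qed

lemma extrema: "extrema_attained S P x0 \<omega>"
  unfolding extrema_attained_def
proof (intro conjI ballI allI impI has_least_minimax(1) has_least_pwb has_least_energy)
  show "has_least (cost_value S x0 w)" if "w \<in> carrier_vec (n * T)" for w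
    by (rule optimal_cost_eq(1)[OF x0 that])
  fix K assume K: "causal_controller S K"
  then obtain U where U: "causal_controller S U"
    and cl: "\<forall>w \<in> carrier_vec (n * T). \<forall>u. closed_loop S K x0 w u \<longleftrightarrow> u = U *\<^sub>v (x0 @\<^sub>v w)"
    using closed_loop_response[OF K] x0 by blast
  show "\<exists>!u. closed_loop S K x0 w u" if "w \<in> carrier_vec (n * T)" for w
    using cl that by simp
  show "has_greatest (regret_value S P x0 K)" by (rule worst_case_regret(1)[OF U cl])
qed

section \<open>The chain of inequalities and the optimal controller\<close>

lemma gamma_bar:
  shows "pwb_value S P x0 (gamma_bar S P x0)" "pwb_value S P x0 g \<Longrightarrow> gamma_bar S P x0 \<le> g"
proof -
  obtain v where v: "pwb_value S P x0 v" "\<And>y. pwb_value S P x0 y \<Longrightarrow> v \<le> y"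
    using has_least_pwb by (auto simp: has_least_def)
  then have "gamma_bar S P x0 = v" unfolding gamma_bar_def by (rule Least_equality)
  then show "pwb_value S P x0 (gamma_bar S P x0)" "pwb_value S P x0 g \<Longrightarrow> gamma_bar S P x0 \<le> g"
    using v by auto
qed

lemma feasible_regret:
  assumes "pwb_feasible S P x0 (Psi U) l" "causal_controller S U" "w \<in> Ws"
  shows "reg U (dl 1 w) \<le> pwb_objective S l"
proof -
  obtain V where *: "Psi U = Psi V \<and> causal_controller S V \<and> l \<in> carrier_vec (T + 1) \<and>
     (\<forall>i \<le> T. 0 \<le> l $ i) \<and> (\<forall>t. \<forall>w \<in> carrier_vec (n * T). reg V (dl t w) \<le> pbound l t w)"
    using assms(1)[unfolded pwb_feasible_iff] ..
  note V = *[THEN conjunct1] *[THEN conjunct2, THEN conjunct1]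
  note l = *[THEN conjunct2, THEN conjunct2, THEN conjunct2, THEN conjunct1]
    and le = *[THEN conjunct2, THEN conjunct2, THEN conjunct2, THEN conjunct2]
  \<comment> \<open>\<open>Psi\<close> is injective, since its lower part is the matrix
    itself.\<close>
  have "U = V" using arg_cong[OF V(1), of "Phi_u S"] unfolding Psi_carrier(3)[OF assms(2)] Psi_carrier(3)[OF V(2)] .
  then have "reg U (dl 1 w) \<le> pbound l 1 w" using le Ws_carrier[OF assms(3)] by blast
  also have "\<dots> \<le> pwb_objective S l" by (rule pbound_regret[OF _ assms(3)]) (use l in blast)
  finally show ?thesis .
qed

lemma bounds:
  "2 / pi * gamma_bar S P x0 \<le> regret_PWB S P x0" "regret_PWB S P x0 \<le> gamma_bar S P x0"
  "gamma_bar S P x0 \<le> gamma_star S x0 \<omega>"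
proof -
  \<comment> \<open>The minimax response itself becomes feasible for the semidefinite program, with
    objective \<open>pi / 2\<close> times its regret bound.\<close>
  obtain U where U: "causal_controller S U" "\<And>w. w \<in> Ws \<Longrightarrow> reg U (dl 1 w) \<le> regret_PWB S P x0"
    using has_least_minimax(2) by (auto simp: regret_bound_def)
  obtain l where l: "l \<in> carrier_vec (T + 1)" "\<forall>i \<le> T. 0 \<le> l $ i" "pwb_objective S l = pi / 2 * regret_PWB S P x0"
    "\<forall>t. \<forall>w \<in> carrier_vec (n * T). reg U (dl t w) \<le> pbound l t w"
    using multipliers_of_regret_bound[OF causalD(1)[OF U(1)] U(2)] by blast
  have "pwb_feasible S P x0 (Psi U) l" unfolding pwb_feasible_iff using U l by blast
  then have "pwb_value S P x0 (pi / 2 * regret_PWB S P x0)" unfolding pwb_value_def l(3)[symmetric] by blast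
  then have "gamma_bar S P x0 \<le> pi / 2 * regret_PWB S P x0" by (rule gamma_bar(2))
  then show "2 / pi * gamma_bar S P x0 \<le> regret_PWB S P x0" by (simp add: field_simps)
  obtain \<Phi> l where f: "pwb_feasible S P x0 \<Phi> l" "gamma_bar S P x0 = pwb_objective S l"
    using gamma_bar(1) by (auto simp: pwb_value_def)
  obtain V where V: "\<Phi> = Psi V" "causal_controller S V" using f(1) unfolding pwb_feasible_iff by blast
  have "regret_bound (gamma_bar S P x0)"
    unfolding regret_bound_def f(2) using feasible_regret[OF f(1)[unfolded V(1)] V(2)] V(2) by blast
  then show "regret_PWB S P x0 \<le> gamma_bar S P x0" by (rule has_least_minimax(3))
  obtain v where v: "energy_value S x0 \<omega> v" "\<And>y. energy_value S x0 \<omega> y \<Longrightarrow> v \<le> y"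
    using has_least_energy by (auto simp: has_least_def)
  then have "gamma_star S x0 \<omega> = v" unfolding gamma_star_def by (rule Least_equality)
  moreover have "pwb_value S P x0 v"
    using v(1) energy_imp_pwb unfolding energy_value_def pwb_value_def by blast
  ultimately show "gamma_bar S P x0 \<le> gamma_star S x0 \<omega>" using gamma_bar(2) by simp
qed

text \<open>For \<open>\<Phi> = Psi U\<close> the quotient of the two parts is the controller of
  \<open>response_controller\<close>, so the closed loop has the response \<open>U\<close>, whose
  regret the multipliers bound.\<close>

lemma optimal_controller:
  assumes "pwb_optimal S P x0 \<Phi> l"
  shows "invertible_mat (Phi_x S \<Phi>)" "causal_controller S (Phi_u S \<Phi> * minv (Phi_x S \<Phi>))"
    "\<lbrakk>w \<in> Ws; closed_loop S (Phi_u S \<Phi> * minv (Phi_x S \<Phi>)) x0 w u\<rbrakk> \<Longrightarrow>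
      dynamic_regret S x0 u w \<le> gamma_bar S P x0"
proof -
  have f: "pwb_feasible S P x0 \<Phi> l" and opt: "\<And>\<Phi>' l'. pwb_feasible S P x0 \<Phi>' l' \<Longrightarrow> pwb_objective S l \<le> pwb_objective S l'"
    using assms by (auto simp: pwb_optimal_def)
  obtain U where U: "\<Phi> = Psi U" "causal_controller S U" using f unfolding pwb_feasible_iff by blast
  have obj: "pwb_objective S l \<le> gamma_bar S P x0"
    using gamma_bar(1) opt by (auto simp: pwb_value_def)
  note parts = Psi_carrier(2,3)[OF U(2), folded U(1)] and rc = response_controller(3,4,5)[OF U(2)]
  show "invertible_mat (Phi_x S \<Phi>)" "causal_controller S (Phi_u S \<Phi> * minv (Phi_x S \<Phi>))"
    unfolding parts by (rule rc)+
  assume w: "w \<in> Ws" and cl: "closed_loop S (Phi_u S \<Phi> * minv (Phi_x S \<Phi>)) x0 w u"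
  have "u = U *\<^sub>v (x0 @\<^sub>v w)" using cl rc(3)[OF x0 Ws_carrier[OF w]] unfolding parts by simp
  then have "dynamic_regret S x0 u w = reg U (dl 1 w)"
    using closed_loop_regret[OF U(2) Ws_carrier[OF w]] by simp
  also have "\<dots> \<le> pwb_objective S l" by (rule feasible_regret[OF f[unfolded U(1)] U(2) w])
  finally show "dynamic_regret S x0 u w \<le> gamma_bar S P x0" using obj by simp
qed

end

theorem theorem2:
  fixes S :: lq_system and P :: "real mat" and x0 :: "real vec" and \<omega> :: real
  assumes "valid_system S"
    and "x0 \<in> carrier_vec (state_dim S)"
    and "P \<in> carrier_mat (state_dim S) (state_dim S)"
    and "positive_definite P"
    and "\<omega> > 0"
    and "\<forall>w \<in> disturbance_sequences S P. (vnorm w)^2 \<le> \<omega>"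
  shows "extrema_attained S P x0 \<omega> \<and>
    pwb_constraints_linear S P x0 \<and>
    2 / pi * gamma_bar S P x0 \<le> regret_PWB S P x0 \<and>
    regret_PWB S P x0 \<le> gamma_bar S P x0 \<and>
    gamma_bar S P x0 \<le> gamma_star S x0 \<omega> \<and>
    (\<forall>\<Phi> l. pwb_optimal S P x0 \<Phi> l \<longrightarrow>
       invertible_mat (Phi_x S \<Phi>) \<and>
       causal_controller S (Phi_u S \<Phi> * minv (Phi_x S \<Phi>)) \<and>
       (\<forall>w \<in> disturbance_sequences S P. \<forall>u.
          closed_loop S (Phi_u S \<Phi> * minv (Phi_x S \<Phi>)) x0 w u \<longrightarrow>
          dynamic_regret S x0 u w \<le> gamma_bar S P x0))"
proof -
  interpret pwb S P x0 \<omega>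
    using assms by unfold_locales auto
  show ?thesis
    using extrema pwb_constraints_linear[OF x0] bounds optimal_controller by blast
qed

end
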